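(* Under the standing assumptions below, let $K$ be the kernel $K(m_1,m_2)=\frac{1}{(2\pi i)^2}\oint_C\frac{dz}{z}\oint_D\frac{dw}{w}g(z,w;m_1,m_2)$ and $L(m_1,m_2)=\frac{1}{(2\pi i)^2}\oint_C\frac{dz}{z}\oint_{\bar D}\frac{dw}{w}g(z,w;m_1,m_2)$. Then \[\det(1-fK)_{\ell^2(\mathbb{Z})}=\det(1+fL)_{\ell^2(\mathbb{Z})}.\]
   Context: Standing assumptions: $0<q<1$, $N\ge1$, $a_1,\dots,a_N,b_1,\dots,b_N\in(0,1)$ distinct with $a_1>a_2>\dots>a_N$ and $a_1/a_N<q^{-1/2+\epsilon}$ for a fixed $\epsilon\in(0,1/2)$; $t>0$, $k\in\mathbb{Z}_{\ge0}$. $(x;q)_\infty=\prod_{j\ge0}(1-xq^j)$. $f(m)=\frac{tq^{1/2+k+m}}{1+tq^{1/2+k+m}}$, $m\in\mathbb{Z}$, acting by multiplication. $g(z,w;m_1,m_2)=\frac{w^{m_2}}{z^{m_1}}\frac{w}{z-w}\prod_{i=1}^N\frac{(a_iz;q)_\infty}{(a_iw;q)_\infty}\prod_{j=1}^N\frac{(b_j/w;q)_\infty}{(b_j/z;q)_\infty}$. $C$ is the positively oriented circle $|z|=r$ with $\max_j b_j<r<1/a_1$. $D$ is a positively oriented contour lying outside $C$ enclosing $w=1/a_i$, $i=1,\dots,N$, and no other singularity of $g$ in $w$ (not $0$, not $1/(a_iq^j)$ for $j\ge1$). $\bar D$ is a positively oriented contour enclosing $C$ and no point $1/(a_iq^j)$,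 $j\ge0$. *)

theory Defs
  imports "HOL-Complex_Analysis.Complex_Analysis"
begin

definition qpoch :: "complex \<Rightarrow> real \<Rightarrow> complex" where
  "qpoch x q = (\<Prod>j. 1 - x * of_real (q ^ j))"

definition fmult :: "real \<Rightarrow> real \<Rightarrow> nat \<Rightarrow> int \<Rightarrow> complex" where
  "fmult q t k m = of_real (t * q powr (1/2 + real k + real_of_int m) /
                            (1 + t * q powr (1/2 + real k + real_of_int m)))"

definition gfun :: "nat \<Rightarrow> real \<Rightarrow> (nat \<Rightarrow> real) \<Rightarrow> (nat \<Rightarrow> real) \<Rightarrow>
                    complex \<Rightarrow> complex \<Rightarrow> int \<Rightarrow> int \<Rightarrow> complex" where
  "gfun N q a b z w m1 m2 =
     (w powi m2 / z powi m1) * (w / (z - w)) *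
     (\<Prod>i\<in>{1..N}. qpoch (of_real (a i) * z) q / qpoch (of_real (a i) * w) q) *
     (\<Prod>j\<in>{1..N}. qpoch (of_real (b j) / w) q / qpoch (of_real (b j) / z) q)"

definition kernel :: "nat \<Rightarrow> real \<Rightarrow> (nat \<Rightarrow> real) \<Rightarrow> (nat \<Rightarrow> real) \<Rightarrow> real \<Rightarrow>
                      (real \<Rightarrow> complex) \<Rightarrow> int \<Rightarrow> int \<Rightarrow> complex" where
  "kernel N q a b r \<Gamma> m1 m2 =
     (1 / (2 * pi * \<i>)^2) *
     contour_integral (circlepath 0 r)
       (\<lambda>z. contour_integral \<Gamma> (\<lambda>w. gfun N q a b z w m1 m2 / w) / z)"

text \<open>Fredholm determinant det(1 + A) on l^2(Z) of an operator with kernel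
  A : Z x Z -> C, defined by the Fredholm series
  sum_n 1/n! sum_{x_1..x_n in Z} det[A(x_i,x_j)]_{i,j=1..n}.\<close>
definition fredholm_det :: "(int \<Rightarrow> int \<Rightarrow> complex) \<Rightarrow> complex" where
  "fredholm_det A =
     (\<Sum>n. (1 / of_nat (fact n)) *
        (\<Sum>\<^sub>\<infinity>x\<in>PiE {..<n} (\<lambda>_. (UNIV :: int set)).
           (\<Sum>p | p permutes {..<n}. of_int (sign p) * (\<Prod>i<n. A (x i) (x (p i))))))"

end

theory Submission
  imports Defs
begin

text \<open>Put \<open>s = t q\<^bsup>k + 1/2\<^esup>\<close>, so that \<open>f(m) = s q\<^sup>m / (1 + s q\<^sup>m)\<close>, and let \<open>\<Phi>\<close> be the quotient of
  \<open>q\<close>-Pochhammer products with \<open>g = (w\<^bsup>m2\<^esup> / z\<^bsup>m1\<^esup>) (w / (z - w)) \<Phi>(z) / \<Phi>(w)\<close>. Expanding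
  \<open>1 / (z - w)\<close> gives \<open>L = - M \<Pi> M\<^sup>-\<^sup>1\<close>, where \<open>M\<close> is the Laurent matrix of \<open>\<Phi>\<close> and \<open>\<Pi>\<close> projects onto the
  nonnegative indices. Moving the \<open>w\<close>-contour across the points \<open>1 / a\<^sub>i\<close> shows \<open>K = L' - L\<close> with
  \<open>L' = - M \<Pi> M'\<close>, where \<open>M'\<close> holds the Laurent coefficients of \<open>1 / \<Phi>\<close> in the outer annulus
  \<open>1 / a\<^sub>N < |w| < 1 / (q a\<^sub>1)\<close>. On that annulus \<open>\<Phi>(q z) / \<Phi>(z)\<close> is a rational function that vanishes
  at infinity, so \<open>\<Pi> M' q\<^sup>m M\<close> is strictly triangular; hence \<open>L' q\<^sup>m (1 + L) = 0\<close>, which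
  is the factorization \<open>1 - f K = (1 + A) (1 + f L)\<close> with \<open>A = - f L' (1 + s q\<^sup>m)\<close>. The same
  triangularity makes every factor \<open>1 + (rank one)\<close> in the truncations of \<open>1 + A\<close> have determinant \<open>1\<close>,
  so \<open>det (1 + A) = 1\<close>.\<close>

section \<open>Finite determinants and finite Fredholm series\<close>

text \<open>The determinant is a bare Fredholm series, so multiplicativity and limits are proved by
  hand for one class of kernels: entries bounded by c \<open>\<alpha> x * \<beta> y\<close>, with
  \<open>\<alpha> x * \<beta> x\<close> geometrically small in both directions. The class survives
  truncation and products, and every kernel of the factorization has to fit the same pair of
  weights. On the diagonal L' is only bounded by (column radius / row radius)^m, which grows as m
  tends to +infinity; the factor f, of order q^m there, must compensate. If columns are estimated on
  the outer circle of radius R, this asks for row circles x1 < q R < x2. So p = q R has to lie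
  between max b_j and 1/a_1 while R lies beyond 1/a_N. Both are possible because q/a_N < 1/a_1,
  which is how the bound on a_1/a_N enters. The form of A is dictated by (1 + s q^m) f = s q^m: it
  gives (1 + A) f L = f L - s f L' q^m L, and L' q^m (1 + L) = 0 turns the last term into + s f L'
  q^m, exactly the part of A that must cancel.\<close>

definition detS :: "'a set \<Rightarrow> ('a \<Rightarrow> 'a \<Rightarrow> complex) \<Rightarrow> complex" where
  "detS S M = (\<Sum>p | p permutes S. of_int (sign p) * (\<Prod>i\<in>S. M i (p i)))"

lemma detS_cong:
  assumes "S = T" "\<And>i j. i \<in> T \<Longrightarrow> j \<in> T \<Longrightarrow> M i j = M' i j"
  shows "detS S M = detS T M'"
  unfolding detS_def assms(1)
  by (intro sum.cong refl arg_cong2[where f = "(*)"] prod.cong assms(2)) (auto simp: permutes_in_image)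

lemma detS_permute_rows:
  assumes "finite S" "q permutes S"
  shows "detS S (\<lambda>i. M (q i)) = of_int (sign q) * detS S M"
proof -
  have "detS S (\<lambda>i. M (q i)) =
      (\<Sum>p | p permutes S. of_int (sign (p \<circ> q)) * (\<Prod>i\<in>S. M (q i) ((p \<circ> q) i)))"
    unfolding detS_def by (subst sum_permutations_compose_right[OF assms(2)]) simp
  also have "\<dots> = (\<Sum>p | p permutes S. of_int (sign q) * (of_int (sign p) * (\<Prod>i\<in>S. M i (p i))))"
  proof (rule sum.cong, simp)
    fix p assume "p \<in> {p. p permutes S}"
    then have p: "p permutes S" by simp
    have "sign (p \<circ> q) = sign p * sign q"
      using p assms by (intro sign_compose) (auto simp: permutation_permutes)
    moreover have "(\<Prod>i\<in>S. M (q i) ((p \<circ> q) i)) = (\<Prod>i\<in>S. M i (p i))"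
      using prod.permute[OF assms(2), of "\<lambda>i. M i (p i)"] by (simp add: o_def)
    ultimately show "of_int (sign (p \<circ> q)) * (\<Prod>i\<in>S. M (q i) ((p \<circ> q) i)) =
        of_int (sign q) * (of_int (sign p) * (\<Prod>i\<in>S. M i (p i)))" by (simp add: mult_ac)
  qed
  finally show ?thesis by (simp add: detS_def sum_distrib_left)
qed

lemma detS_identical_rows:
  assumes "finite S" "i \<in> S" "j \<in> S" "i \<noteq> j" "\<And>k. k \<in> S \<Longrightarrow> M i k = M j k"
  shows "detS S M = 0"
proof -
  let ?q = "Transposition.transpose i j"
  have "?q permutes S" using assms by (simp add: permutes_swap_id)
  then have "detS S (\<lambda>k. M (?q k)) = of_int (sign ?q) * detS S M"
    using assms(1) by (rule detS_permute_rows[rotated])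
  also have "detS S (\<lambda>k. M (?q k)) = detS S M"
    using assms by (intro detS_cong) (auto simp: Transposition.transpose_def)
  finally show ?thesis using assms(4) by (simp add: sign_swap_id)
qed

text \<open>Permutations of \<open>S\<close> are the identity off \<open>S\<close>, members of
  \<open>PiE\<close> are \<open>undefined\<close> there. Restriction translates between the two
  conventions, so that a sum over injective selection functions becomes a sum over
  permutations.\<close>

lemma bij_betw_permutes_PiE:
  "bij_betw (\<lambda>p. restrict p S) {p. p permutes S} {f \<in> PiE S (\<lambda>_. S). inj_on f S}" if "finite S"
proof (rule bij_betwI)
  let ?g = "\<lambda>f x. if x \<in> S then f x else x"
  show "(\<lambda>p. restrict p S) \<in> {p. p permutes S} \<rightarrow> {f \<in> PiE S (\<lambda>_. S). inj_on f S}"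
    by (auto simp: permutes_in_image permutes_inj_on inj_on_def permutes_def) metis
  show "?g \<in> {f \<in> PiE S (\<lambda>_. S). inj_on f S} \<rightarrow> {p. p permutes S}"
  proof safe
    fix f assume f: "f \<in> PiE S (\<lambda>_. S)" "inj_on f S"
    then have "f ` S = S" using that by (intro endo_inj_surj) auto
    with f have "bij_betw f S S" by (simp add: bij_betw_def)
    then have "bij_betw (?g f) S S" by (subst bij_betw_cong[of S _ f]) auto
    then show "?g f permutes S" by (intro bij_imp_permutes) auto
  qed
  show "?g (restrict p S) = p" if "p \<in> {p. p permutes S}" for p
    using that by (auto simp: fun_eq_iff permutes_not_in)
  show "restrict (?g f) S = f" if "f \<in> {f \<in> PiE S (\<lambda>_. S). inj_on f S}" for f
    using that by (auto simp: fun_eq_iff PiE_def extensional_def)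
qed

text \<open>Expanding every row of the product selects one row \<open>f i\<close> of
  \<open>B\<close> for each \<open>i\<close>. A non-injective \<open>f\<close> repeats a row and
  contributes 0; an injective one permutes the rows of \<open>B\<close>.\<close>

lemma detS_mult:
  assumes "finite S"
  shows "detS S (\<lambda>i j. \<Sum>k\<in>S. A i k * B k j) = detS S A * detS S B"
proof -
  let ?F = "\<lambda>f. (\<Prod>i\<in>S. A i (f i)) * detS S (\<lambda>i j. B (f i) j)"
  have "detS S (\<lambda>i j. \<Sum>k\<in>S. A i k * B k j) =
      (\<Sum>p | p permutes S. of_int (sign p) * (\<Sum>f\<in>PiE S (\<lambda>_. S). \<Prod>i\<in>S. A i (f i) * B (f i) (p i)))"
    unfolding detS_def using assms by (simp add: prod_sum_PiE)
  also have "\<dots> = (\<Sum>f\<in>PiE S (\<lambda>_. S). \<Sum>p | p permutes S.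
      of_int (sign p) * (\<Prod>i\<in>S. A i (f i) * B (f i) (p i)))"
    by (simp add: sum_distrib_left) (rule sum.swap)
  also have "\<dots> = (\<Sum>f\<in>PiE S (\<lambda>_. S). ?F f)"
    by (simp add: detS_def sum_distrib_left prod.distrib mult_ac)
  also have "\<dots> = (\<Sum>f | f \<in> PiE S (\<lambda>_. S) \<and> inj_on f S. ?F f)"
  proof (rule sum.mono_neutral_right)
    show "\<forall>f\<in>PiE S (\<lambda>_. S) - {f \<in> PiE S (\<lambda>_. S). inj_on f S}. ?F f = 0"
    proof
      fix f assume "f \<in> PiE S (\<lambda>_. S) - {f \<in> PiE S (\<lambda>_. S). inj_on f S}"
      then obtain i j where "i \<in> S" "j \<in> S" "i \<noteq> j" "f i = f j" by (auto simp: inj_on_def)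
      then have "detS S (\<lambda>i j. B (f i) j) = 0"
        using assms by (intro detS_identical_rows[of S i j]) auto
      then show "?F f = 0" by simp
    qed
  qed (use assms in \<open>auto intro: finite_PiE\<close>)
  also have "\<dots> = (\<Sum>p | p permutes S. ?F (restrict p S))"
    using sum.reindex_bij_betw[OF bij_betw_permutes_PiE[OF assms], of ?F] by simp
  also have "\<dots> = (\<Sum>p | p permutes S. of_int (sign p) * (\<Prod>i\<in>S. A i (p i)) * detS S B)"
  proof (rule sum.cong, simp)
    fix p assume "p \<in> {p. p permutes S}"
    then have p: "p permutes S" by simp
    have "detS S (\<lambda>i j. B (restrict p S i) j) = detS S (\<lambda>i. B (p i))"
      by (rule detS_cong) auto
    also have "\<dots> = of_int (sign p) * detS S B" by (rule detS_permute_rows[OF assms p])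
    finally show "?F (restrict p S) = of_int (sign p) * (\<Prod>i\<in>S. A i (p i)) * detS S B"
      by (simp add: mult_ac)
  qed
  finally show ?thesis by (simp add: detS_def sum_distrib_right)
qed

text \<open>The Fredholm series indexes minors by tuples, the expansion of det(1 + A) by subsets;
  this passes from one to the other.\<close>

lemma detS_reindex:
  assumes "bij_betw f T S" "finite T"
  shows "detS T (\<lambda>i j. M (f i) (f j)) = detS S M"
proof -
  let ?h = "\<lambda>p. map_permutation T f p"
  have inj: "inj_on f T" and S: "f ` T = S" using assms(1) by (auto simp: bij_betw_def)
  have h: "bij_betw ?h {p. p permutes T} {p. p permutes S}"
    using bij_betw_permutations[OF assms(1)]
    by (rule bij_betw_cong[THEN iffD1, rotated])
       (auto simp: map_permutation_def restrict_id_def fun_eq_iff S)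
  have "detS S M = (\<Sum>p | p permutes T. of_int (sign (?h p)) * (\<Prod>i\<in>S. M i (?h p i)))"
    unfolding detS_def by (rule sum.reindex_bij_betw[OF h, symmetric])
  also have "\<dots> = detS T (\<lambda>i j. M (f i) (f j))"
    unfolding detS_def
  proof (rule sum.cong, simp)
    fix p assume "p \<in> {p. p permutes T}"
    then have p: "p permutes T" by simp
    have "(\<Prod>i\<in>S. M i (?h p i)) = (\<Prod>i\<in>T. M (f i) (?h p (f i)))"
      by (rule prod.reindex_bij_betw[OF assms(1), symmetric])
    also have "\<dots> = (\<Prod>i\<in>T. M (f i) (f (p i)))"
      by (intro prod.cong refl) (simp add: map_permutation_apply[OF inj])
    finally show "of_int (sign (?h p)) * (\<Prod>i\<in>S. M i (?h p i)) =
        of_int (sign p) * (\<Prod>i\<in>T. M (f i) (f (p i)))"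
      by (simp add: sign_map_permutation[OF inj p assms(2)])
  qed
  finally show ?thesis ..
qed

text \<open>Let \<open>J\<close> be the set of rows in which the summand \<open>A\<close> is taken.
  The remaining rows of the identity force the permutation to fix \<open>S - J\<close>, which leaves
  the principal minor on \<open>J\<close>.\<close>

lemma detS_one_plus:
  assumes "finite S"
  shows "detS S (\<lambda>i j. of_bool (i = j) + A i j) = (\<Sum>J\<in>Pow S. detS J A)"
proof -
  have "detS S (\<lambda>i j. of_bool (i = j) + A i j) =
      (\<Sum>p | p permutes S. of_int (sign p) *
        (\<Sum>J\<in>Pow S. (\<Prod>i\<in>J. A i (p i)) * (\<Prod>i\<in>S-J. of_bool (i = p i))))"
    unfolding detS_def by (subst add.commute, subst prod_add[OF assms]) rule
  also have "\<dots> = (\<Sum>J\<in>Pow S. \<Sum>p | p permutes S. of_int (sign p) *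
        ((\<Prod>i\<in>J. A i (p i)) * (\<Prod>i\<in>S-J. of_bool (i = p i))))"
    by (simp add: sum_distrib_left) (rule sum.swap)
  also have "\<dots> = (\<Sum>J\<in>Pow S. detS J A)"
  proof (rule sum.cong[OF refl])
    fix J assume "J \<in> Pow S"
    then have J: "J \<subseteq> S" by simp
    have fin: "finite (S - J)" using assms by simp
    show "(\<Sum>p | p permutes S. of_int (sign p) *
        ((\<Prod>i\<in>J. A i (p i)) * (\<Prod>i\<in>S-J. of_bool (i = p i)))) = detS J A"
      unfolding detS_def
    proof (rule sum.mono_neutral_cong_right)
      show "finite {p. p permutes S}" using assms by (rule finite_permutations)
      show "{p. p permutes J} \<subseteq> {p. p permutes S}" using J by (auto intro: permutes_subset)
      show "\<forall>p\<in>{p. p permutes S} - {p. p permutes J}. of_int (sign p) *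
        ((\<Prod>i\<in>J. A i (p i)) * (\<Prod>i\<in>S-J. of_bool (i = p i))) = 0"
      proof
        fix p assume p: "p \<in> {p. p permutes S} - {p. p permutes J}"
        obtain i where "i \<in> S - J" "p i \<noteq> i"
        proof (rule ccontr)
          note * = that
          assume "\<not> thesis"
          then have "\<forall>i\<in>S-J. p i = i" using * by blast
          then have "p permutes J" using p by (intro permutes_superset[of p S J]) auto
          with p show False by simp
        qed
        then have "(\<Prod>i\<in>S-J. of_bool (i = p i)) = (0::complex)"
          using fin by (intro prod_zero bexI[of _ i]) auto
        then show "of_int (sign p) *
          ((\<Prod>i\<in>J. A i (p i)) * (\<Prod>i\<in>S-J. of_bool (i = p i))) = 0" by simp
      qed
      fix p assume "p \<in> {p. p permutes J}"
      then have "(\<Prod>i\<in>S-J. of_bool (i = p i)) = (1::complex)"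
        by (intro prod.neutral) (auto simp: permutes_def)
      then show "of_int (sign p) * ((\<Prod>i\<in>J. A i (p i)) * (\<Prod>i\<in>S-J. of_bool (i = p i))) =
         of_int (sign p) * (\<Prod>i\<in>J. A i (p i))" by simp
    qed
  qed
  finally show ?thesis .
qed

section \<open>Fredholm series of kernels with finitely many nonzero rows and of rank-one
  kernels\<close>

lemma fredholm_det_altdef:
  "fredholm_det A = (\<Sum>n. (1 / fact n) *
     (\<Sum>\<^sub>\<infinity>x\<in>PiE {..<n} (\<lambda>_. UNIV). detS {..<n} (\<lambda>i j. A (x i) (x j))))"
  by (simp add: fredholm_det_def detS_def)

lemma detS_pullback_not_inj:
  assumes "\<not> inj_on x {..<n::nat}"
  shows "detS {..<n} (\<lambda>i j. A (x i) (x j)) = 0"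
proof -
  obtain i j where "i \<in> {..<n}" "j \<in> {..<n}" "i \<noteq> j" "x i = x j"
    using assms by (auto simp: inj_on_def)
  then show ?thesis by (intro detS_identical_rows[of _ i j]) auto
qed

lemma card_inj_PiE:
  assumes "finite J" "card J = n"
  shows "card {x \<in> PiE {..<n} (\<lambda>_. J). inj_on x {..<n}} = fact n"
proof -
  have "card {f \<in> {..<n} \<rightarrow>\<^sub>E J. inj_on f {..<n}} = prod ((-) n) {0..<n}"
    using card_inj_on_subset_funcset[of "{..<n}" J "{..<n}"] assms by simp
  also have "\<dots> = fact n"
    using fact_prod_rev[of n, where ?'a = nat] by simp
  finally show ?thesis by simp
qed

text \<open>A tuple with a repeated entry or with an entry off \<open>S\<close> gives a zero minor,
  and each \<open>n\<close>-element subset of \<open>S\<close> is enumerated by n! injective tuples,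
  which cancels the factor 1/n!. Vanishing rows suffice for this, so columns off \<open>S\<close>
  are unrestricted.\<close>

lemma fredholm_det_finite_support:
  assumes S: "finite S" and supp: "\<And>x y. x \<notin> S \<Longrightarrow> A x y = 0"
  shows "fredholm_det A = (\<Sum>J\<in>Pow S. detS J A)"
proof -
  let ?d = "\<lambda>(n::nat) x. detS {..<n} (\<lambda>i j. A (x i) (x j))"
  let ?P = "\<lambda>n::nat. {x \<in> PiE {..<n} (\<lambda>_. S). inj_on x {..<n}}"
  have fP: "finite (?P n)" for n
    by (rule finite_subset[of _ "PiE {..<n} (\<lambda>_. S)"]) (use S in \<open>auto intro!: finite_PiE\<close>)
  have inner: "(\<Sum>\<^sub>\<infinity>x\<in>PiE {..<n} (\<lambda>_. UNIV). ?d n x) = fact n * (\<Sum>J | J \<subseteq> S \<and> card J = n. detS J A)" for n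
  proof -
    have "(\<Sum>\<^sub>\<infinity>x\<in>PiE {..<n} (\<lambda>_. UNIV). ?d n x) = (\<Sum>\<^sub>\<infinity>x\<in>?P n. ?d n x)"
    proof (rule infsum_cong_neutral)
      fix x assume x: "x \<in> PiE {..<n} (\<lambda>_. UNIV) - ?P n"
      show "?d n x = 0"
      proof (cases "inj_on x {..<n}")
        case True
        with x obtain i where i: "i < n" "x i \<notin> S" by (auto simp: PiE_def)
        show ?thesis unfolding detS_def
        proof (rule sum.neutral, safe)
          fix p
          have "(\<Prod>j<n. A (x j) (x (p j))) = 0" using i supp by (intro prod_zero) auto
          then show "of_int (sign p) * (\<Prod>j<n. A (x j) (x (p j))) = 0" by simp
        qed
      qed (rule detS_pullback_not_inj)
    qed (auto simp: PiE_def)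
    also have "\<dots> = (\<Sum>x\<in>?P n. ?d n x)" using fP by simp
    also have "\<dots> = (\<Sum>x\<in>?P n. detS (x ` {..<n}) A)"
      by (intro sum.cong refl detS_reindex) (auto simp: bij_betw_def)
    also have "\<dots> = (\<Sum>J\<in>{J. J \<subseteq> S \<and> card J = n}. \<Sum>x\<in>{x\<in>?P n. x ` {..<n} = J}. detS (x ` {..<n}) A)"
      using fP S by (intro sum.group[symmetric]) (auto simp: card_image)
    also have "\<dots> = (\<Sum>J\<in>{J. J \<subseteq> S \<and> card J = n}. fact n * detS J A)"
    proof (rule sum.cong[OF refl])
      fix J assume J: "J \<in> {J. J \<subseteq> S \<and> card J = n}"
      then have fJ: "finite J" using S finite_subset by blast
      have *: "{x\<in>?P n. x ` {..<n} = J} = {x \<in> PiE {..<n} (\<lambda>_. J). inj_on x {..<n}}"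
      proof (intro equalityI subsetI)
        fix x assume "x \<in> {x \<in> PiE {..<n} (\<lambda>_. J). inj_on x {..<n}}"
        then have x: "x \<in> PiE {..<n} (\<lambda>_. J)" "inj_on x {..<n}" by auto
        have "x ` {..<n} = J" using x J fJ by (intro card_subset_eq) (auto simp: card_image)
        then show "x \<in> {x\<in>?P n. x ` {..<n} = J}" using x J by (auto simp: PiE_def)
      qed (auto simp: PiE_def)
      have "(\<Sum>x\<in>{x\<in>?P n. x ` {..<n} = J}. detS (x ` {..<n}) A) =
          (\<Sum>x\<in>{x\<in>?P n. x ` {..<n} = J}. detS J A)" by (intro sum.cong) auto
      also have "\<dots> = fact n * detS J A"
        unfolding * using card_inj_PiE[OF fJ, of n] J by simp
      finally show "(\<Sum>x\<in>{x\<in>?P n. x ` {..<n} = J}. detS (x ` {..<n}) A) = fact n * detS J A" .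
    qed
    finally show ?thesis by (simp add: sum_distrib_left)
  qed
  have "fredholm_det A = (\<Sum>n. \<Sum>J | J \<subseteq> S \<and> card J = n. detS J A)"
    unfolding fredholm_det_altdef inner by simp
  also have "\<dots> = (\<Sum>n\<in>{..card S}. \<Sum>J | J \<subseteq> S \<and> card J = n. detS J A)"
  proof (rule suminf_finite)
    fix n assume "n \<notin> {..card S}"
    then have "{J. J \<subseteq> S \<and> card J = n} = {}" using card_mono[OF S] by force
    then show "(\<Sum>J | J \<subseteq> S \<and> card J = n. detS J A) = 0" by (simp only: sum.empty)
  qed simp
  also have "\<dots> = (\<Sum>n\<in>{..card S}. \<Sum>J | J \<in> Pow S \<and> card J = n. detS J A)"
    by simp
  also have "\<dots> = (\<Sum>J\<in>Pow S. detS J A)"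
    using S card_mono[OF S] by (intro sum.group) auto
  finally show ?thesis .
qed

text \<open>The kernel on the left is (1 + A)(1 + B) - 1, and all three series collapse to ordinary
  determinants over \<open>S\<close>.\<close>

lemma fredholm_det_finite_mult:
  assumes S: "finite S"
    and A: "\<And>x y. x \<notin> S \<Longrightarrow> A x y = 0" and B: "\<And>x y. x \<notin> S \<Longrightarrow> B x y = 0"
  shows "fredholm_det (\<lambda>x y. A x y + B x y + (\<Sum>m\<in>S. A x m * B m y)) = fredholm_det A * fredholm_det B"
proof -
  let ?C = "\<lambda>x y. A x y + B x y + (\<Sum>m\<in>S. A x m * B m y)"
  let ?I = "\<lambda>A i j. of_bool (i = j) + A i j"
  have "fredholm_det ?C = detS S (?I ?C)"
    unfolding detS_one_plus[OF S] using assms by (intro fredholm_det_finite_support) auto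
  also have "\<dots> = detS S (\<lambda>i j. \<Sum>k\<in>S. ?I A i k * ?I B k j)"
  proof (rule detS_cong[OF refl])
    fix i j assume ij: "i \<in> S" "j \<in> S"
    have "(\<Sum>k\<in>S. ?I A i k * ?I B k j) =
        (\<Sum>k\<in>S. of_bool (i = k) * of_bool (k = j)) + (\<Sum>k\<in>S. A i k * of_bool (k = j)) +
        (\<Sum>k\<in>S. of_bool (i = k) * B k j) + (\<Sum>k\<in>S. A i k * B k j)"
      unfolding sum.distrib[symmetric] by (rule sum.cong) (simp_all add: algebra_simps)
    moreover have "(\<Sum>k\<in>S. A i k * of_bool (k = j)) = A i j"
      using S ij sum.delta[of S j "\<lambda>k. A i k"] by (simp add: of_bool_def if_distrib[of "\<lambda>x. _ * x"] cong: if_cong)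
    moreover have "(\<Sum>k\<in>S. of_bool (i = k) * B k j) = B i j"
      using S ij sum.delta'[of S i "\<lambda>k. B k j"] by (simp add: of_bool_def if_distrib[of "\<lambda>x. x * _"] cong: if_cong)
    moreover have "(\<Sum>k\<in>S. of_bool (i = k) * of_bool (k = j)) = (of_bool (i = j) :: complex)"
      using S ij sum.delta'[of S i "\<lambda>k. of_bool (k = j) :: complex"]
      by (simp add: of_bool_def if_distrib[of "\<lambda>x. x * _"] cong: if_cong)
    ultimately show "?I ?C i j = (\<Sum>k\<in>S. ?I A i k * ?I B k j)" by simp
  qed
  also have "\<dots> = detS S (?I A) * detS S (?I B)" by (rule detS_mult[OF S])
  also have "\<dots> = fredholm_det A * fredholm_det B"
    unfolding detS_one_plus[OF S] using assms
    by (simp add: fredholm_det_finite_support[of S A] fredholm_det_finite_support[of S B])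
  finally show ?thesis .
qed

lemma detS_rank_one:
  assumes "finite S" "2 \<le> card S"
  shows "detS S (\<lambda>i j. X i * Y j) = 0"
proof -
  obtain a b where ab: "a \<in> S" "b \<in> S" "a \<noteq> b"
    using assms by (metis card_le_Suc0_iff_eq not_less_eq_eq numeral_2_eq_2)
  have "detS S (\<lambda>i j. X i * Y j) = (\<Prod>i\<in>S. X i) * detS S (\<lambda>i. Y)"
    by (simp add: detS_def prod.distrib sum_distrib_left mult_ac)
  also have "detS S (\<lambda>i. Y) = 0" using assms ab by (intro detS_identical_rows[of S a b]) auto
  finally show ?thesis by simp
qed

text \<open>Minors of order at least two vanish, so the series stops after the trace. The same
  \<open>infsum\<close> stands on both sides, so convergence of the trace is not at issue.\<close>

lemma fredholm_det_rank_one: "fredholm_det (\<lambda>x y. X x * Y y) = 1 + (\<Sum>\<^sub>\<infinity>m. X m * Y m)"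
proof -
  let ?t = "\<lambda>n. (1 / fact n) * (\<Sum>\<^sub>\<infinity>x\<in>PiE {..<n} (\<lambda>_. UNIV). detS {..<n} (\<lambda>i j. X (x i) * Y (x j)))"
  have "fredholm_det (\<lambda>x y. X x * Y y) = (\<Sum>n\<in>{0,1}. ?t n)"
    unfolding fredholm_det_altdef
  proof (rule suminf_finite)
    fix n :: nat assume "n \<notin> {0, 1}"
    then have "detS {..<n} (\<lambda>i j. X (x i) * Y (x j)) = 0" for x :: "nat \<Rightarrow> int"
      by (intro detS_rank_one) auto
    then show "?t n = 0" by simp
  qed simp
  moreover have "?t 0 = 1" by (simp add: detS_def)
  moreover have "?t 1 = (\<Sum>\<^sub>\<infinity>m. X m * Y m)"
  proof -
    have bij: "bij_betw (\<lambda>m::int. restrict (\<lambda>_. m) {..<1::nat}) UNIV (PiE {..<1} (\<lambda>_. UNIV))"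
      by (rule bij_betwI[where g = "\<lambda>x. x 0"]) (auto simp: fun_eq_iff PiE_def extensional_def)
    show ?thesis
      by (subst infsum_reindex_bij_betw[OF bij, symmetric])
         (simp add: detS_def lessThan_Suc permutes_sing)
  qed
  ultimately show ?thesis by simp
qed

section \<open>Continuity and multiplicativity of the Fredholm determinant\<close>

lemma summable_on_dominated:
  fixes f :: "'a \<Rightarrow> 'b::banach" and M :: "'a \<Rightarrow> real"
  assumes M: "M summable_on X" and bound: "\<And>x. x \<in> X \<Longrightarrow> norm (f x) \<le> M x"
  shows "f summable_on X"
proof (rule abs_summable_summable)
  show "(\<lambda>x. norm (f x)) summable_on X"
    by (rule summable_on_comparison_test[OF M bound]) auto
qed

text \<open>The majorant makes the finite partial sums converge uniformly in \<open>k\<close>, and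
  uniformity allows the two limits to be exchanged.\<close>

lemma tendsto_infsum_dominated:
  fixes f :: "nat \<Rightarrow> 'a \<Rightarrow> 'b::banach"
  assumes lim: "\<And>x. x \<in> X \<Longrightarrow> (\<lambda>k. f k x) \<longlonglongrightarrow> g x"
    and bound: "\<And>k x. x \<in> X \<Longrightarrow> norm (f k x) \<le> M x" and M: "M summable_on X"
  shows "(\<lambda>k. infsum (f k) X) \<longlonglongrightarrow> infsum g X"
proof (rule swap_uniform_limit')
  have gM: "norm (g x) \<le> M x" if "x \<in> X" for x
    by (rule tendsto_upperbound[OF tendsto_norm[OF lim[OF that]]]) (use bound[OF that] in auto)
  show "(sum g \<longlongrightarrow> infsum g X) (finite_subsets_at_top X)"
    by (rule infsum_tendsto[OF summable_on_dominated[OF M gM]])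
  show "uniform_limit UNIV (\<lambda>Y k. \<Sum>x\<in>Y. f k x) (\<lambda>k. infsum (f k) X) (finite_subsets_at_top X)"
    by (rule Weierstrass_m_test_general[OF _ M]) (use bound in auto)
  show "\<forall>\<^sub>F Y in finite_subsets_at_top X. ((\<lambda>k. \<Sum>x\<in>Y. f k x) \<longlongrightarrow> sum g Y) sequentially"
    by (rule eventually_finite_subsets_at_top_weakI) (use lim in \<open>auto intro!: tendsto_sum\<close>)
qed auto

lemma filterlim_atLeastAtMost_int_finite_subsets:
  "filterlim (\<lambda>n. {- int n..int n}) (finite_subsets_at_top UNIV) sequentially"
  unfolding filterlim_def le_filter_def eventually_filtermap
proof safe
  fix P assume "eventually P (finite_subsets_at_top (UNIV :: int set))"
  then obtain X where X: "finite X" "\<And>Y. finite Y \<Longrightarrow> X \<subseteq> Y \<Longrightarrow> P Y"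
    by (auto simp: eventually_finite_subsets_at_top)
  have "P {- int n..int n}" if n: "n \<ge> (\<Sum>x\<in>X. nat \<bar>x\<bar>)" for n
  proof (rule X(2))
    show "X \<subseteq> {- int n..int n}"
    proof
      fix x assume "x \<in> X"
      then have "nat \<bar>x\<bar> \<le> (\<Sum>x\<in>X. nat \<bar>x\<bar>)" using X(1) by (intro member_le_sum) auto
      with n show "x \<in> {- int n..int n}" by auto
    qed
  qed simp
  then show "\<forall>\<^sub>F n in sequentially. P {- int n..int n}"
    by (auto simp: eventually_sequentially)
qed

lemma has_sum_int_geometric:
  fixes \<sigma> :: real
  assumes "0 < \<sigma>" "\<sigma> < 1"
  shows "((\<lambda>m::int. \<sigma> ^ nat \<bar>m\<bar>) has_sum (1 / (1 - \<sigma>) + \<sigma> / (1 - \<sigma>))) UNIV"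
proof -
  have "((\<lambda>n. \<sigma> ^ n) has_sum 1 / (1 - \<sigma>)) UNIV"
    using geometric_sums[of \<sigma>] assms by (intro sums_nonneg_imp_has_sum) auto
  also have "?this \<longleftrightarrow> ((\<lambda>m::int. \<sigma> ^ nat \<bar>m\<bar>) has_sum (1 / (1 - \<sigma>))) {0..}"
    by (rule has_sum_reindex_bij_witness[of _ nat int]) auto
  finally have 1: "((\<lambda>m::int. \<sigma> ^ nat \<bar>m\<bar>) has_sum (1 / (1 - \<sigma>))) {0..}" .
  have "((\<lambda>n. \<sigma> ^ n) has_sum \<sigma> / (1 - \<sigma>)) {1..}"
    using has_sum_geometric_from_1[of \<sigma>] assms by simp
  also have "?this \<longleftrightarrow> ((\<lambda>m::int. \<sigma> ^ nat \<bar>m\<bar>) has_sum (\<sigma> / (1 - \<sigma>))) {..-1}"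
    by (rule has_sum_reindex_bij_witness[of _ "\<lambda>m. nat (- m)" "\<lambda>n. - int n"]) auto
  finally have 2: "((\<lambda>m::int. \<sigma> ^ nat \<bar>m\<bar>) has_sum (\<sigma> / (1 - \<sigma>))) {..-1}" .
  have "{0..} \<union> {..-1::int} = UNIV" by auto
  moreover have "{0..} \<inter> {..-1::int} = {}" by auto
  ultimately show ?thesis using has_sum_Un_disjoint[OF 1 2] by simp
qed

lemma sum_prod_PiE_le:
  fixes f :: "'a \<Rightarrow> real"
  assumes f: "\<And>x. 0 \<le> f x" "f summable_on UNIV" and I: "finite I"
    and F: "finite F" "F \<subseteq> PiE I (\<lambda>_. UNIV)"
  shows "(\<Sum>x\<in>F. \<Prod>i\<in>I. f (x i)) \<le> infsum f UNIV ^ card I"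
proof -
  \<comment> \<open>All values taken by members of \<open>F\<close>: then \<open>F\<close> lies in a
    finite box with side \<open>?T\<close>, over which the sum of products factorizes.\<close>
  let ?T = "(\<lambda>(x, i). x i) ` (F \<times> I)"
  have T: "finite ?T" using F I by auto
  have "x \<in> PiE I (\<lambda>_. ?T)" if x: "x \<in> F" for x
  proof (rule PiE_I)
    show "x i \<in> ?T" if "i \<in> I" for i
      by (rule image_eqI[of _ _ "(x, i)"]) (use x that in auto)
    show "x i = undefined" if "i \<notin> I" for i
      using x F(2) that by (meson PiE_arb subsetD)
  qed
  then have "(\<Sum>x\<in>F. \<Prod>i\<in>I. f (x i)) \<le> (\<Sum>x\<in>PiE I (\<lambda>_. ?T). \<Prod>i\<in>I. f (x i))"
    using f I T by (intro sum_mono2 finite_PiE prod_nonneg) auto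
  also have "\<dots> = (\<Prod>i\<in>I. sum f ?T)"
    using prod_sum_PiE[OF I, of "\<lambda>_. ?T" "\<lambda>_. f"] T by simp
  also have "\<dots> \<le> infsum f UNIV ^ card I"
    using f T by (simp add: power_mono sum_nonneg finite_sum_le_infsum)
  finally show ?thesis .
qed

lemma
  fixes f :: "'a \<Rightarrow> real"
  assumes f: "\<And>x. 0 \<le> f x" "f summable_on UNIV" and I: "finite I"
  shows summable_on_prod_PiE: "(\<lambda>x. \<Prod>i\<in>I. f (x i)) summable_on PiE I (\<lambda>_. UNIV)" (is ?A)
    and infsum_prod_PiE_le: "(\<Sum>\<^sub>\<infinity>x\<in>PiE I (\<lambda>_. UNIV). \<Prod>i\<in>I. f (x i)) \<le> infsum f UNIV ^ card I" (is ?B)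
proof -
  show A: ?A
  proof (rule nonneg_bdd_above_summable_on)
    show "bdd_above (sum (\<lambda>x. \<Prod>i\<in>I. f (x i)) ` {F. F \<subseteq> PiE I (\<lambda>_. UNIV) \<and> finite F})"
      by (rule bdd_aboveI2[where M = "infsum f UNIV ^ card I"])
         (use sum_prod_PiE_le[OF f I] in auto)
  qed (use f in \<open>auto intro: prod_nonneg\<close>)
  show ?B by (rule infsum_le_finite_sums[OF A]) (use sum_prod_PiE_le[OF f I] in auto)
qed

text \<open>Pigeonhole: distinct entries of absolute value below \<open>T\<close> are at most as
  many as the integers in \<open>{- int T..int T}\<close>.\<close>

lemma card_large_abs:
  fixes x :: "nat \<Rightarrow> int"
  assumes "inj_on x {..<n}"
  shows "n \<le> card {i. i < n \<and> T \<le> nat \<bar>x i\<bar>} + (2 * T + 1)"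
proof -
  have "card {i. i < n \<and> nat \<bar>x i\<bar> < T} = card (x ` {i. i < n \<and> nat \<bar>x i\<bar> < T})"
    using assms by (intro card_image[symmetric]) (auto simp: inj_on_def)
  also have "\<dots> \<le> card {- int T..int T}" by (intro card_mono) auto
  also have "\<dots> = 2 * T + 1" by simp
  finally have "card {i. i < n \<and> nat \<bar>x i\<bar> < T} \<le> 2 * T + 1" .
  moreover have "n = card ({i. i < n \<and> T \<le> nat \<bar>x i\<bar>} \<union> {i. i < n \<and> nat \<bar>x i\<bar> < T})"
  proof -
    have "{i. i < n \<and> T \<le> nat \<bar>x i\<bar>} \<union> {i. i < n \<and> nat \<bar>x i\<bar> < T} = {..<n}" by auto
    then show ?thesis by simp
  qed
  moreover have "card ({i. i < n \<and> T \<le> nat \<bar>x i\<bar>} \<union> {i. i < n \<and> nat \<bar>x i\<bar> < T}) \<le>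
      card {i. i < n \<and> T \<le> nat \<bar>x i\<bar>} + card {i. i < n \<and> nat \<bar>x i\<bar> < T}"
    by (rule card_Un_le)
  ultimately show ?thesis by linarith
qed

text \<open>A permutation only reorders the column weights, so all n! terms obey the same product
  bound.\<close>

lemma norm_detS_le:
  assumes S: "finite S" and A: "\<And>i j. i \<in> S \<Longrightarrow> j \<in> S \<Longrightarrow> norm (A i j) \<le> a i * b j"
    and nonneg: "\<And>i. i \<in> S \<Longrightarrow> 0 \<le> a i" "\<And>i. i \<in> S \<Longrightarrow> 0 \<le> b i"
  shows "norm (detS S A) \<le> fact (card S) * (\<Prod>i\<in>S. a i * b i)"
proof -
  have "norm (detS S A) \<le> (\<Sum>p | p permutes S. norm (of_int (sign p) * (\<Prod>i\<in>S. A i (p i))))"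
    unfolding detS_def by (rule norm_sum)
  also have "\<dots> \<le> (\<Sum>p | p permutes S. \<Prod>i\<in>S. a i * b i)"
  proof (rule sum_mono)
    fix p assume "p \<in> {p. p permutes S}"
    then have p: "p permutes S" by simp
    have "norm (of_int (sign p) * (\<Prod>i\<in>S. A i (p i))) = (\<Prod>i\<in>S. norm (A i (p i)))"
      by (simp add: norm_mult sign_def prod_norm)
    also have "\<dots> \<le> (\<Prod>i\<in>S. a i * b (p i))"
      using A p by (intro prod_mono) (auto simp: permutes_in_image)
    also have "\<dots> = (\<Prod>i\<in>S. a i) * (\<Prod>i\<in>S. b (p i))" by (rule prod.distrib)
    also have "(\<Prod>i\<in>S. b (p i)) = (\<Prod>i\<in>S. b i)"
      using prod.permute[OF p, of b] by (simp add: o_def)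
    finally show "norm (of_int (sign p) * (\<Prod>i\<in>S. A i (p i))) \<le> (\<Prod>i\<in>S. a i * b i)"
      by (simp add: prod.distrib)
  qed
  also have "\<dots> = fact (card S) * (\<Prod>i\<in>S. a i * b i)"
    using card_permutations[OF refl S] by simp
  finally show ?thesis .
qed

text \<open>The determinant of a pullback along \<open>x\<close> vanishes unless the \<open>n\<close> integers \<open>x i\<close> are distinct,
  and then all but boundedly many of them are large. This makes the Fredholm series converge
  with the crude bound \<open>n!\<close> on the number of permutations, without Hadamard's inequality.\<close>

lemma detS_pullback_majorant:
  assumes \<alpha>: "\<And>x::int. 0 \<le> \<alpha> x" and \<beta>: "\<And>x. 0 \<le> \<beta> x" and \<rho>: "0 < \<rho>" "\<rho> < 1"
    and \<alpha>\<beta>: "\<And>x. \<alpha> x * \<beta> x \<le> C * \<rho> ^ nat \<bar>x\<bar>"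
  obtains G :: "nat \<Rightarrow> (nat \<Rightarrow> int) \<Rightarrow> real" where
    "\<And>n. G n summable_on PiE {..<n} (\<lambda>_. UNIV)"
    "summable (\<lambda>n. infsum (G n) (PiE {..<n} (\<lambda>_. UNIV)))"
    "\<And>n x. 0 \<le> G n x"
    "\<And>A n x. (\<And>x y. norm (A x y) \<le> \<alpha> x * \<beta> y) \<Longrightarrow>
       norm (detS {..<n} (\<lambda>i j. A (x i) (x j)) / fact n) \<le> G n x"
proof -
  \<comment> \<open>Half of the decay is kept for each of two purposes, as \<sigma> * \<sigma> =
    \<rho>. One factor makes the sum over tuples converge, to at most \<open>S ^ n\<close>; the
    other is spent, using distinctness of the entries, to beat \<open>(D * S) ^ n\<close>.\<close>
  define \<sigma> where "\<sigma> = sqrt \<rho>"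
  define S where "S = (\<Sum>\<^sub>\<infinity>m::int. \<sigma> ^ nat \<bar>m\<bar>)"
  define D where "D = max C 1"
  have \<sigma>: "0 < \<sigma>" "\<sigma> < 1" "\<sigma> * \<sigma> = \<rho>" using \<rho> by (auto simp: \<sigma>_def)
  have sum\<sigma>: "(\<lambda>m::int. \<sigma> ^ nat \<bar>m\<bar>) summable_on UNIV"
    using has_sum_int_geometric[OF \<sigma>(1,2)] by (rule has_sum_imp_summable)
  have S: "S > 0" using infsumI[OF has_sum_int_geometric[OF \<sigma>(1,2)]] \<sigma>
    by (auto simp: S_def intro!: add_pos_pos)
  have "1 / (2 * D * S) > 0" using S by (auto simp: D_def)
  \<comment> \<open>With this threshold each entry of absolute value at least \<open>T\<close> gains
    a factor \<theta> with \<open>D * \<theta> * S\<close> at most 1/2, so the terms of the series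
    are dominated by a multiple of 2^(-n).\<close>
  then obtain T where T: "\<sigma> ^ T < 1 / (2 * D * S)" using real_arch_pow_inv \<sigma> by blast
  define \<theta> where "\<theta> = \<sigma> ^ T"
  have \<theta>: "0 < \<theta>" "\<theta> \<le> 1" using \<sigma> by (auto simp: \<theta>_def power_le_one)
  have D\<theta>: "D * \<theta> \<le> 1 / (2 * S)"
    using T S by (simp add: \<theta>_def[symmetric] D_def field_simps)
  \<comment> \<open>Compensates for the at most \<open>2 * T + 1\<close> small entries, whose factor
    is only bounded by 1.\<close>
  define K where "K = 1 / \<theta> ^ (2 * T + 1)"
  have K: "K > 0" using \<theta> by (auto simp: K_def)
  define G where "G = (\<lambda>n (x::nat\<Rightarrow>int). K * (1 / (2 * S)) ^ n * (\<Prod>i<n. \<sigma> ^ nat \<bar>x i\<bar>))"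
  have P: "(\<lambda>x. \<Prod>i\<in>{..<n}. \<sigma> ^ nat \<bar>x i\<bar>) summable_on PiE {..<n::nat} (\<lambda>_. UNIV::int set)"
    "(\<Sum>\<^sub>\<infinity>x\<in>PiE {..<n} (\<lambda>_. UNIV::int set). \<Prod>i\<in>{..<n}. \<sigma> ^ nat \<bar>x i\<bar>) \<le> S ^ n" for n
    using summable_on_prod_PiE[OF _ sum\<sigma>, of "{..<n}"] infsum_prod_PiE_le[OF _ sum\<sigma>, of "{..<n}"] \<sigma>
    by (auto simp: S_def)
  show thesis
  proof (rule that[of G])
    show G: "G n summable_on PiE {..<n} (\<lambda>_. UNIV)" for n
      unfolding G_def by (intro summable_on_cmult_right P)
    show G0: "0 \<le> G n x" for n x
      unfolding G_def using K S \<sigma> by (intro mult_nonneg_nonneg prod_nonneg) auto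
    have le: "infsum (G n) (PiE {..<n} (\<lambda>_. UNIV)) \<le> K * (1 / 2) ^ n" for n
    proof -
      have "infsum (G n) (PiE {..<n} (\<lambda>_. UNIV)) = K * (1 / (2 * S)) ^ n *
          (\<Sum>\<^sub>\<infinity>x\<in>PiE {..<n} (\<lambda>_. UNIV). \<Prod>i\<in>{..<n}. \<sigma> ^ nat \<bar>x i\<bar>)"
        unfolding G_def by (rule infsum_cmult_right) (rule P)
      also have "\<dots> \<le> K * (1 / (2 * S)) ^ n * S ^ n"
        using P(2) K S by (intro mult_left_mono) auto
      also have "\<dots> = K * (1 / 2) ^ n" using S by (simp add: field_simps power_mult_distrib)
      finally show ?thesis .
    qed
    show "summable (\<lambda>n. infsum (G n) (PiE {..<n} (\<lambda>_. UNIV)))"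
    proof (rule summable_comparison_test')
      show "summable (\<lambda>n. K * (1 / 2) ^ n)" by (intro summable_mult summable_geometric) simp
      show "norm (infsum (G n) (PiE {..<n} (\<lambda>_. UNIV))) \<le> K * (1 / 2) ^ n" if "n \<ge> 0" for n
        using le[of n] infsum_nonneg[of "PiE {..<n} (\<lambda>_. UNIV)" "G n"] G0 by auto
    qed
    fix A :: "int \<Rightarrow> int \<Rightarrow> complex" and n and x :: "nat \<Rightarrow> int"
    assume A: "\<And>x y. norm (A x y) \<le> \<alpha> x * \<beta> y"
    show "norm (detS {..<n} (\<lambda>i j. A (x i) (x j)) / fact n) \<le> G n x"
    proof (cases "inj_on x {..<n}")
      case False
      then show ?thesis using G0 by (simp add: detS_pullback_not_inj)
    next
      case True
      have "norm (detS {..<n} (\<lambda>i j. A (x i) (x j)) / fact n) \<le> (\<Prod>i<n. \<alpha> (x i) * \<beta> (x i))"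
        using norm_detS_le[of "{..<n}" "\<lambda>i j. A (x i) (x j)" "\<lambda>i. \<alpha> (x i)" "\<lambda>i. \<beta> (x i)"] A \<alpha> \<beta>
        by (simp add: norm_divide field_simps)
      also have "\<dots> \<le> (\<Prod>i<n. D * \<sigma> ^ nat \<bar>x i\<bar> * \<sigma> ^ nat \<bar>x i\<bar>)"
      proof (rule prod_mono, safe)
        fix i
        have "\<alpha> (x i) * \<beta> (x i) \<le> C * \<rho> ^ nat \<bar>x i\<bar>" by (rule \<alpha>\<beta>)
        also have "\<dots> \<le> D * \<rho> ^ nat \<bar>x i\<bar>" using \<rho> by (intro mult_right_mono) (auto simp: D_def)
        also have "\<rho> ^ nat \<bar>x i\<bar> = \<sigma> ^ nat \<bar>x i\<bar> * \<sigma> ^ nat \<bar>x i\<bar>"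
          using \<sigma>(3) by (simp flip: power_mult_distrib)
        finally show "\<alpha> (x i) * \<beta> (x i) \<le> D * \<sigma> ^ nat \<bar>x i\<bar> * \<sigma> ^ nat \<bar>x i\<bar>" by (simp add: mult_ac)
      qed (use \<alpha> \<beta> in auto)
      also have "\<dots> = D ^ n * (\<Prod>i<n. \<sigma> ^ nat \<bar>x i\<bar>) * (\<Prod>i<n. \<sigma> ^ nat \<bar>x i\<bar>)"
        by (simp add: prod.distrib)
      also have "\<dots> \<le> D ^ n * (K * \<theta> ^ n) * (\<Prod>i<n. \<sigma> ^ nat \<bar>x i\<bar>)"
      proof (intro mult_right_mono mult_left_mono prod_nonneg)
        let ?J = "{i. i < n \<and> T \<le> nat \<bar>x i\<bar>}"
        have "(\<Prod>i<n. \<sigma> ^ nat \<bar>x i\<bar>) \<le> (\<Prod>i<n. if i \<in> ?J then \<theta> else 1)"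
          using \<sigma> by (intro prod_mono) (auto simp: \<theta>_def power_le_one intro!: power_decreasing)
        also have "\<dots> = \<theta> ^ card ?J"
          by (subst prod.If_cases) (auto simp: Int_def intro!: arg_cong[of _ _ "\<lambda>S. \<theta> ^ card S"])
        also have "\<dots> = K * \<theta> ^ (card ?J + (2 * T + 1))"
          using \<theta> by (simp add: K_def power_add)
        also have "\<dots> \<le> K * \<theta> ^ n"
          using card_large_abs[OF True, of T] \<theta> K by (intro mult_left_mono power_decreasing) auto
        finally show "(\<Prod>i<n. \<sigma> ^ nat \<bar>x i\<bar>) \<le> K * \<theta> ^ n" .
      qed (use \<sigma> in \<open>auto simp: D_def\<close>)
      also have "\<dots> = K * (D * \<theta>) ^ n * (\<Prod>i<n. \<sigma> ^ nat \<bar>x i\<bar>)"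
        by (simp add: power_mult_distrib)
      also have "\<dots> \<le> G n x"
        unfolding G_def using D\<theta> \<theta> K \<sigma>
        by (intro mult_right_mono mult_left_mono power_mono prod_nonneg) (auto simp: D_def)
      finally show ?thesis .
    qed
  qed
qed

text \<open>Two nested dominated limits: \<open>G n\<close> controls the sum over tuples for fixed
  \<open>n\<close>, and its total controls the series over \<open>n\<close> by Tannery's theorem.
  The separate constant \<open>c\<close> lets different kernels share one pair of weights.\<close>

lemma tendsto_fredholm_det:
  fixes A :: "nat \<Rightarrow> int \<Rightarrow> int \<Rightarrow> complex"
  assumes weight: "\<And>x. 0 \<le> \<alpha> x" "\<And>x. 0 \<le> \<beta> x" "0 < \<rho>" "\<rho> < 1"
      "\<And>x. \<alpha> x * \<beta> x \<le> C * \<rho> ^ nat \<bar>x\<bar>"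
    and bound: "\<And>k x y. norm (A k x y) \<le> c * (\<alpha> x * \<beta> y)" and "0 \<le> c"
    and lim: "\<And>x y. (\<lambda>k. A k x y) \<longlonglongrightarrow> B x y"
  shows "(\<lambda>k. fredholm_det (A k)) \<longlonglongrightarrow> fredholm_det B"
proof -
  have "(c * \<alpha> x) * \<beta> x \<le> (c * C) * \<rho> ^ nat \<bar>x\<bar>" for x
    using mult_left_mono[OF weight(5) \<open>0 \<le> c\<close>, of x] by (simp add: mult_ac)
  from detS_pullback_majorant[of "\<lambda>x. c * \<alpha> x" \<beta>, OF _ weight(2-4) this] weight(1) \<open>0 \<le> c\<close>
  obtain G where G: "\<And>n. G n summable_on PiE {..<n} (\<lambda>_. UNIV)"
    "summable (\<lambda>n. infsum (G n) (PiE {..<n} (\<lambda>_. UNIV)))"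
    "\<And>n x. 0 \<le> G n x"
    "\<And>A n x. (\<And>x y. norm (A x y) \<le> c * \<alpha> x * \<beta> y) \<Longrightarrow>
       norm (detS {..<n} (\<lambda>i j. A (x i) (x j)) / fact n) \<le> G n x"
    by auto
  let ?P = "\<lambda>n. PiE {..<n} (\<lambda>_. UNIV) :: (nat \<Rightarrow> int) set"
  let ?d = "\<lambda>A n x. detS {..<n} (\<lambda>i j. A (x i) (x j)) / fact n"
  have eq: "fredholm_det A = (\<Sum>n. \<Sum>\<^sub>\<infinity>x\<in>?P n. ?d A n x)" for A
    unfolding fredholm_det_altdef
    by (subst infsum_cmult_right'[symmetric]) (simp add: field_simps)
  have d: "norm (?d (A k) n x) \<le> G n x" for k n x
    using bound by (intro G(4)) (simp add: mult_ac)
  have dlim: "(\<lambda>k. ?d (A k) n x) \<longlonglongrightarrow> ?d B n x" for n x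
    unfolding detS_def by (intro tendsto_intros lim) auto
  have "(\<lambda>k. \<Sum>\<^sub>\<infinity>x\<in>?P n. ?d (A k) n x) \<longlonglongrightarrow> (\<Sum>\<^sub>\<infinity>x\<in>?P n. ?d B n x)" for n
    by (rule tendsto_infsum_dominated[OF dlim d G(1)])
  moreover have "norm (\<Sum>\<^sub>\<infinity>x\<in>?P n. ?d (A k) n x) \<le> infsum (G n) (?P n)" for n k
  proof (rule norm_infsum_le)
    show "((\<lambda>x. ?d (A k) n x) has_sum (\<Sum>\<^sub>\<infinity>x\<in>?P n. ?d (A k) n x)) (?P n)"
      by (intro has_sum_infsum summable_on_dominated[OF G(1) d])
    show "(G n has_sum infsum (G n) (?P n)) (?P n)" using G(1) by (rule has_sum_infsum)
  qed (rule d)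
  ultimately show ?thesis
    unfolding eq
    by (intro tannerys_theorem[THEN conjunct2, THEN conjunct2, OF _ _ G(2)])
       (auto intro!: always_eventually)
qed

lemma summable_on_int_weight:
  fixes \<gamma> :: "int \<Rightarrow> real"
  assumes "\<And>x::int. 0 \<le> \<gamma> x" "0 < \<rho>" "\<rho> < 1" "\<And>x. \<gamma> x \<le> C * \<rho> ^ nat \<bar>x\<bar>"
  shows "\<gamma> summable_on UNIV"
proof (rule summable_on_dominated)
  show "(\<lambda>x. C * \<rho> ^ nat \<bar>x\<bar>) summable_on UNIV"
    using has_sum_int_geometric[OF assms(2,3)]
    by (intro summable_on_cmult_right) (rule has_sum_imp_summable)
qed (use assms in auto)

text \<open>Truncation to the square on \<open>{- int n..int n}\<close> reduces this to finite
  determinants. The composition of the truncations is still bounded by \<open>c * d * W\<close>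
  times the weights, so continuity applies to all three determinants.\<close>

lemma fredholm_det_mult:
  fixes A B :: "int \<Rightarrow> int \<Rightarrow> complex"
  assumes weight: "\<And>x. 0 \<le> \<alpha> x" "\<And>x. 0 \<le> \<beta> x" "0 < \<rho>" "\<rho> < 1"
      "\<And>x. \<alpha> x * \<beta> x \<le> C * \<rho> ^ nat \<bar>x\<bar>"
    and A: "\<And>x y. norm (A x y) \<le> c * (\<alpha> x * \<beta> y)"
    and B: "\<And>x y. norm (B x y) \<le> d * (\<alpha> x * \<beta> y)" and cd: "0 \<le> c" "0 \<le> d"
  shows "fredholm_det (\<lambda>x y. A x y + B x y + (\<Sum>\<^sub>\<infinity>m. A x m * B m y)) = fredholm_det A * fredholm_det B"
proof -
  define S where "S = (\<lambda>n. {- int n..int n})"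
  define tr where "tr = (\<lambda>A n x y. if x \<in> S n \<and> y \<in> S n then A x y else (0::complex))"
  define W where "W = (\<Sum>\<^sub>\<infinity>m. \<alpha> m * \<beta> m)"
  have W: "(\<lambda>m. \<alpha> m * \<beta> m) summable_on UNIV"
    by (rule summable_on_int_weight[OF _ weight(3-5)]) (use weight in auto)
  have W0: "W \<ge> 0" unfolding W_def using weight by (intro infsum_nonneg) auto
  have fin: "finite (S n)" for n by (simp add: S_def)
  have ev: "\<forall>\<^sub>F n in sequentially. x \<in> S n" for x
    using eventually_ge_at_top[of "nat \<bar>x\<bar>"] by eventually_elim (auto simp: S_def)
  have tr_lim: "(\<lambda>n. tr A n x y) \<longlonglongrightarrow> A x y" for A x y
    by (rule tendsto_eventually) (use ev[of x] ev[of y] in eventually_elim, simp add: tr_def)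
  have trA: "norm (tr A n x y) \<le> c * (\<alpha> x * \<beta> y)" for n x y
    using A[of x y] cd weight by (auto simp: tr_def)
  have trB: "norm (tr B n x y) \<le> d * (\<alpha> x * \<beta> y)" for n x y
    using B[of x y] cd weight by (auto simp: tr_def)
  have AB: "norm (A x m * B m y) \<le> (c * d * \<alpha> x * \<beta> y) * (\<alpha> m * \<beta> m)" for x m y
    using mult_mono[OF A[of x m] B[of m y]] cd weight by (simp add: norm_mult mult_ac)
  have trAB: "norm (tr A n x m * tr B n m y) \<le> (c * d * \<alpha> x * \<beta> y) * (\<alpha> m * \<beta> m)" for x m y n
    using mult_mono[OF trA[of n x m] trB[of n m y]] cd weight by (simp add: norm_mult mult_ac)
  have lim: "(\<lambda>n. \<Sum>m\<in>S n. tr A n x m * tr B n m y) \<longlonglongrightarrow> (\<Sum>\<^sub>\<infinity>m. A x m * B m y)" for x y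
  proof -
    have "((\<lambda>m. A x m * B m y) has_sum (\<Sum>\<^sub>\<infinity>m. A x m * B m y)) UNIV"
      by (intro has_sum_infsum summable_on_dominated[OF summable_on_cmult_right[OF W] AB])
    then have "(\<lambda>n. \<Sum>m\<in>S n. A x m * B m y) \<longlonglongrightarrow> (\<Sum>\<^sub>\<infinity>m. A x m * B m y)"
      unfolding has_sum_def S_def
      by (rule filterlim_compose[OF _ filterlim_atLeastAtMost_int_finite_subsets])
    then show ?thesis
    proof (rule Lim_transform_eventually)
      show "\<forall>\<^sub>F n in sequentially. (\<Sum>m\<in>S n. A x m * B m y) = (\<Sum>m\<in>S n. tr A n x m * tr B n m y)"
        using ev[of x] ev[of y] by eventually_elim (simp add: tr_def)
    qed
  qed
  let ?P = "\<lambda>n x y. tr A n x y + tr B n x y + (\<Sum>m\<in>S n. tr A n x m * tr B n m y)"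
  have "(\<lambda>n. fredholm_det (?P n)) \<longlonglongrightarrow>
      fredholm_det (\<lambda>x y. A x y + B x y + (\<Sum>\<^sub>\<infinity>m. A x m * B m y))"
  proof (rule tendsto_fredholm_det[OF weight])
    show "norm (?P n x y) \<le> (c + d + c * d * W) * (\<alpha> x * \<beta> y)" for n x y
    proof -
      have "norm (\<Sum>m\<in>S n. tr A n x m * tr B n m y) \<le> (\<Sum>m\<in>S n. (c * d * \<alpha> x * \<beta> y) * (\<alpha> m * \<beta> m))"
        by (intro sum_norm_le trAB)
      also have "\<dots> = (c * d * \<alpha> x * \<beta> y) * (\<Sum>m\<in>S n. \<alpha> m * \<beta> m)" by (simp add: sum_distrib_left)
      also have "\<dots> \<le> (c * d * \<alpha> x * \<beta> y) * W"
        unfolding W_def using weight cd fin W by (intro mult_left_mono finite_sum_le_infsum) auto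
      finally have "norm (?P n x y) \<le> c * (\<alpha> x * \<beta> y) + d * (\<alpha> x * \<beta> y) + (c * d * \<alpha> x * \<beta> y) * W"
        using trA trB by (intro norm_triangle_le add_mono) auto
      then show ?thesis by (simp add: algebra_simps)
    qed
    show "0 \<le> c + d + c * d * W" using cd W0 by simp
    show "(\<lambda>n. ?P n x y) \<longlonglongrightarrow> A x y + B x y + (\<Sum>\<^sub>\<infinity>m. A x m * B m y)" for x y
      by (intro tendsto_add tr_lim lim)
  qed
  moreover have "fredholm_det (?P n) = fredholm_det (tr A n) * fredholm_det (tr B n)" for n
    by (rule fredholm_det_finite_mult[OF fin]) (auto simp: tr_def)
  moreover have "(\<lambda>n. fredholm_det (tr A n) * fredholm_det (tr B n)) \<longlonglongrightarrow> fredholm_det A * fredholm_det B"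
    by (intro tendsto_mult tendsto_fredholm_det[OF weight trA] tendsto_fredholm_det[OF weight trB] cd tr_lim)
  ultimately show ?thesis using LIMSEQ_unique by force
qed

section \<open>Laurent coefficients on circles\<close>

text \<open>The k-th Laurent coefficient as read on the circle of radius \<rho>. The radius is an
  argument because the same function has different expansions in different annuli.\<close>

definition lc :: "(complex \<Rightarrow> complex) \<Rightarrow> real \<Rightarrow> int \<Rightarrow> complex" where
  "lc f \<rho> k = contour_integral (circlepath 0 \<rho>) (\<lambda>z. f z * z powi (- k - 1)) / (2 * pi * \<i>)"

definition annulus :: "real \<Rightarrow> real \<Rightarrow> complex set" where
  "annulus r1 r2 = {z. r1 < cmod z \<and> cmod z < r2}"

lemma open_annulus: "open (annulus r1 r2)"
  unfolding annulus_def by (intro open_Collect_conj open_Collect_less continuous_intros)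

lemma sphere_subset_annulus: "r1 < \<rho> \<Longrightarrow> \<rho> < r2 \<Longrightarrow> sphere 0 \<rho> \<subseteq> annulus r1 r2"
  by (auto simp: annulus_def)

lemma continuous_on_powi:
  fixes S :: "complex set"
  assumes "0 \<notin> S" shows "continuous_on S (\<lambda>z. z powi k)"
  using assms by (intro continuous_intros) auto

lemma contour_integral_circlepath_annulus:
  assumes f: "f holomorphic_on annulus r1 r2" and r: "0 \<le> r1" "r1 < a" "a < r2" "r1 < b" "b < r2"
  shows "contour_integral (circlepath 0 a) f = contour_integral (circlepath 0 b) f"
proof (rule Cauchy_theorem_homotopic_loops[OF _ open_annulus f])
  show "homotopic_loops (annulus r1 r2) (circlepath 0 a) (circlepath 0 b)"
  proof (rule homotopic_loops_linear)
    fix t :: real assume "t \<in> {0..1}"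
    show "closed_segment (circlepath 0 a t) (circlepath 0 b t) \<subseteq> annulus r1 r2"
    proof
      fix w assume "w \<in> closed_segment (circlepath 0 a t) (circlepath 0 b t)"
      then obtain u where u: "0 \<le> u" "u \<le> 1"
        "w = (1 - u) *\<^sub>R circlepath 0 a t + u *\<^sub>R circlepath 0 b t" by (auto simp: in_segment)
      have "w = of_real ((1 - u) * a + u * b) * exp (2 * of_real pi * \<i> * t)"
        unfolding u(3) circlepath by (simp add: scaleR_conv_of_real algebra_simps)
      then have "cmod w = \<bar>(1 - u) * a + u * b\<bar>"
        by (simp only: norm_mult norm_of_real norm_exp_eq_Re) simp
      moreover have "(1 - u) * a + u * b > r1" "(1 - u) * a + u * b < r2"
        using convex_real_interval(8)[of r1 r2] r u by (auto simp: convex_alt)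
      ultimately show "w \<in> annulus r1 r2" using r by (auto simp: annulus_def)
    qed
  qed auto
qed auto

lemma lc_annulus:
  assumes "f holomorphic_on annulus r1 r2" "0 \<le> r1" "r1 < a" "a < r2" "r1 < b" "b < r2"
  shows "lc f a k = lc f b k"
proof -
  have "(\<lambda>z. f z * z powi (- k - 1)) holomorphic_on annulus r1 r2"
    using assms by (intro holomorphic_intros) (auto simp: annulus_def)
  then show ?thesis unfolding lc_def
    by (subst contour_integral_circlepath_annulus[of _ r1 r2 a b]) (use assms in auto)
qed

lemma continuous_on_sphere_bounded:
  fixes f :: "complex \<Rightarrow> complex"
  assumes "continuous_on (sphere 0 \<rho>) f"
  obtains B where "0 \<le> B" "\<And>z. cmod z = \<rho> \<Longrightarrow> cmod (f z) \<le> B"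
proof -
  have "bounded (f ` sphere 0 \<rho>)"
    using assms by (intro compact_imp_bounded compact_continuous_image) auto
  then obtain B where "\<And>z. cmod z = \<rho> \<Longrightarrow> cmod (f z) \<le> B" unfolding bounded_iff by force
  then show thesis by (intro that[of "max B 0"]) fastforce+
qed

lemma contour_integrable_circlepath:
  assumes "continuous_on (sphere 0 \<rho>) f" "0 < \<rho>"
  shows "f contour_integrable_on circlepath 0 \<rho>"
  using assms by (intro contour_integrable_continuous_circlepath) auto

lemma norm_lc_le:
  assumes \<rho>: "0 < \<rho>" and f: "continuous_on (sphere 0 \<rho>) f" and B: "0 \<le> B" "\<And>z. cmod z = \<rho> \<Longrightarrow> cmod (f z) \<le> B"
  shows "cmod (lc f \<rho> k) \<le> B * \<rho> powi (- k)"
proof -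
  have "continuous_on (sphere 0 \<rho>) (\<lambda>z. f z * z powi (- k - 1))"
    using \<rho> by (intro continuous_intros f continuous_on_powi) auto
  then have "((\<lambda>z. f z * z powi (- k - 1)) has_contour_integral
      contour_integral (circlepath 0 \<rho>) (\<lambda>z. f z * z powi (- k - 1))) (circlepath 0 \<rho>)"
    using \<rho> by (intro has_contour_integral_integral contour_integrable_circlepath)
  then have "cmod (contour_integral (circlepath 0 \<rho>) (\<lambda>z. f z * z powi (- k - 1)))
      \<le> B * \<rho> powi (- k - 1) * (2 * pi * \<rho>)"
    by (rule has_contour_integral_bound_circlepath)
       (use \<rho> B in \<open>auto simp: norm_mult norm_power_int intro!: mult_right_mono\<close>)
  also have "\<dots> = B * \<rho> powi (- k) * (2 * pi)"
    using \<rho> by (simp add: power_int_diff)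
  finally show ?thesis by (simp add: lc_def norm_divide norm_mult divide_simps)
qed

lemma lc_bounded:
  assumes "0 < \<rho>" "continuous_on (sphere 0 \<rho>) f"
  obtains B where "0 \<le> B" "\<And>k. cmod (lc f \<rho> k) \<le> B * \<rho> powi (- k)"
  using norm_lc_le[OF assms] continuous_on_sphere_bounded[OF assms(2)] by metis

lemma contour_integral_circlepath_sums:
  assumes \<rho>: "0 < \<rho>" and g: "\<And>n. continuous_on (sphere 0 \<rho>) (g n)"
    and M: "\<And>n z. cmod z = \<rho> \<Longrightarrow> cmod (g n z) \<le> M n" "summable M"
  shows "(\<lambda>z. \<Sum>n. g n z) contour_integrable_on circlepath 0 \<rho>"
    and "(\<lambda>n. contour_integral (circlepath 0 \<rho>) (g n)) sums
           contour_integral (circlepath 0 \<rho>) (\<lambda>z. \<Sum>n. g n z)"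
proof -
  have int: "g n contour_integrable_on circlepath 0 \<rho>" for n
    by (rule contour_integrable_circlepath[OF g \<rho>])
  have ul: "uniform_limit (sphere 0 \<rho>) (\<lambda>n z. \<Sum>i<n. g i z) (\<lambda>z. \<Sum>i. g i z) sequentially"
    by (rule Weierstrass_m_test[OF _ M(2)]) (use M in auto)
  have ev: "\<forall>\<^sub>F n in sequentially. (\<lambda>z. \<Sum>i<n. g i z) contour_integrable_on circlepath 0 \<rho>"
    by (intro always_eventually allI contour_integrable_sum int) auto
  note * = contour_integral_uniform_limit_circlepath[OF ev ul _ \<rho>]
  show "(\<lambda>z. \<Sum>n. g n z) contour_integrable_on circlepath 0 \<rho>" using * by simp
  have "(\<lambda>n. contour_integral (circlepath 0 \<rho>) (\<lambda>z. \<Sum>i<n. g i z)) \<longlonglongrightarrow>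
      contour_integral (circlepath 0 \<rho>) (\<lambda>z. \<Sum>n. g n z)" using * by simp
  then show "(\<lambda>n. contour_integral (circlepath 0 \<rho>) (g n)) sums
           contour_integral (circlepath 0 \<rho>) (\<lambda>z. \<Sum>n. g n z)"
    unfolding sums_def using int by (simp add: contour_integral_sum)
qed

text \<open>Geometric expansion of 1/(w - z) in powers of z/w. Since |z| < |w|, only nonnegative
  indices occur, which is the origin of the projection onto them.\<close>

lemma cauchy_kernel_sums:
  assumes \<rho>: "0 < \<rho>" and G: "continuous_on (sphere 0 \<rho>) G" and z: "cmod z < \<rho>"
  shows "(\<lambda>n. z ^ n * lc G \<rho> (int n)) sums
    (contour_integral (circlepath 0 \<rho>) (\<lambda>w. G w / (w - z)) / (2 * pi * \<i>))"
proof -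
  obtain B where B: "0 \<le> B" "\<And>w. cmod w = \<rho> \<Longrightarrow> cmod (G w) \<le> B"
    using continuous_on_sphere_bounded[OF G] by blast
  let ?g = "\<lambda>n w. z ^ n * (G w * w powi (- int n - 1))"
  have geo: "(\<Sum>n. ?g n w) = G w / (w - z)" if w: "cmod w = \<rho>" for w
  proof (rule sums_unique[symmetric])
    have "w \<noteq> 0" "w \<noteq> z" using w \<rho> z by auto
    have "cmod (z / w) < 1" using w z \<rho> by (simp add: norm_divide)
    then have "(\<lambda>n. G w / w * (z / w) ^ n) sums (G w / w * (1 / (1 - z / w)))"
      by (intro sums_mult geometric_sums)
    also have "(\<lambda>n. G w / w * (z / w) ^ n) = (\<lambda>n. ?g n w)"
      using \<open>w \<noteq> 0\<close> by (auto simp: power_int_diff power_int_minus field_simps)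
    also have "G w / w * (1 / (1 - z / w)) = G w / (w - z)"
      using \<open>w \<noteq> 0\<close> \<open>w \<noteq> z\<close> by (simp add: field_simps)
    finally show "(\<lambda>n. ?g n w) sums (G w / (w - z))" .
  qed
  have cont: "continuous_on (sphere 0 \<rho>) (\<lambda>w. G w * w powi (- int n - 1))" for n
    using \<rho> by (intro continuous_intros G continuous_on_powi) auto
  have "(\<lambda>n. contour_integral (circlepath 0 \<rho>) (?g n)) sums
      contour_integral (circlepath 0 \<rho>) (\<lambda>w. \<Sum>n. ?g n w)"
  proof (rule contour_integral_circlepath_sums[OF \<rho>])
    show "continuous_on (sphere 0 \<rho>) (?g n)" for n
      by (intro continuous_on_mult continuous_on_const cont)
    show "cmod (?g n w) \<le> B / \<rho> * (cmod z / \<rho>) ^ n" if w: "cmod w = \<rho>" for n w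
    proof -
      have "cmod (?g n w) = cmod (G w) * (cmod z ^ n * \<rho> powi (- int n - 1))"
        using w by (simp add: norm_mult norm_power norm_power_int)
      also have "\<dots> \<le> B * (cmod z ^ n * \<rho> powi (- int n - 1))"
        using B(2)[OF w] \<rho> by (intro mult_right_mono) auto
      also have "\<dots> = B / \<rho> * (cmod z / \<rho>) ^ n"
        using \<rho> by (simp add: power_int_diff power_int_minus field_simps)
      finally show ?thesis .
    qed
    show "summable (\<lambda>n. B / \<rho> * (cmod z / \<rho>) ^ n)"
      using \<rho> z by (intro summable_mult summable_geometric) auto
  qed
  moreover have "contour_integral (circlepath 0 \<rho>) (?g n) = z ^ n * lc G \<rho> (int n) * (2 * pi * \<i>)" for n
    using contour_integrable_circlepath[OF cont \<rho>]
    by (subst contour_integral_lmul) (auto simp: lc_def)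
  moreover have "contour_integral (circlepath 0 \<rho>) (\<lambda>w. \<Sum>n. ?g n w) =
      contour_integral (circlepath 0 \<rho>) (\<lambda>w. G w / (w - z))"
    by (rule contour_integral_eq) (use geo \<rho> in auto)
  ultimately have "(\<lambda>n. z ^ n * lc G \<rho> (int n) * (2 * pi * \<i>)) sums
      contour_integral (circlepath 0 \<rho>) (\<lambda>w. G w / (w - z))" by simp
  from sums_divide[OF this, of "2 * pi * \<i>"] show ?thesis by simp
qed

text \<open>Integrating \<open>z ^ n\<close> against \<open>F\<close> gives the coefficient of index
  \<open>- int n - 1\<close>, so a double integral with the Cauchy kernel over nested circles is one
  half of a Laurent convolution.\<close>

lemma
  assumes \<rho>: "0 < \<rho>1" "\<rho>1 < \<rho>2"
    and F: "continuous_on (sphere 0 \<rho>1) F" and G: "continuous_on (sphere 0 \<rho>2) G"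
  shows double_contour_integrable:
      "(\<lambda>z. F z * contour_integral (circlepath 0 \<rho>2) (\<lambda>w. G w / (w - z)))
         contour_integrable_on circlepath 0 \<rho>1" (is ?A)
    and double_contour_sums:
      "(\<lambda>n. lc F \<rho>1 (- int n - 1) * lc G \<rho>2 (int n)) sums
       (contour_integral (circlepath 0 \<rho>1)
          (\<lambda>z. F z * contour_integral (circlepath 0 \<rho>2) (\<lambda>w. G w / (w - z))) / (2 * pi * \<i>)^2)" (is ?B)
proof -
  have \<rho>2: "0 < \<rho>2" using \<rho> by simp
  obtain B where B: "0 \<le> B" "\<And>z. cmod z = \<rho>1 \<Longrightarrow> cmod (F z) \<le> B"
    using continuous_on_sphere_bounded[OF F] by blast
  obtain D where D: "0 \<le> D" "\<And>k. cmod (lc G \<rho>2 k) \<le> D * \<rho>2 powi (- k)"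
    using lc_bounded[OF \<rho>2 G] by blast
  let ?g = "\<lambda>n z. lc G \<rho>2 (int n) * (F z * z ^ n)"
  let ?I = "\<lambda>z. contour_integral (circlepath 0 \<rho>2) (\<lambda>w. G w / (w - z))"
  have cont: "continuous_on (sphere 0 \<rho>1) (\<lambda>z. F z * z ^ n)" for n
    by (intro continuous_intros F)
  have g: "continuous_on (sphere 0 \<rho>1) (?g n)" for n
    by (intro continuous_on_mult continuous_on_const cont)
  have M: "cmod (?g n z) \<le> D * B * (\<rho>1 / \<rho>2) ^ n" if z: "cmod z = \<rho>1" for n z
  proof -
    have "cmod (?g n z) \<le> (D * \<rho>2 powi (- int n)) * (B * \<rho>1 ^ n)"
      unfolding norm_mult norm_power using D B z \<rho> by (intro mult_mono) auto
    then show ?thesis using \<rho> by (simp add: power_int_minus field_simps)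
  qed
  have sM: "summable (\<lambda>n. D * B * (\<rho>1 / \<rho>2) ^ n)"
    using \<rho> by (intro summable_mult summable_geometric) auto
  have sum: "(\<Sum>n. ?g n z) = F z * ?I z / (2 * pi * \<i>)" if "z \<in> sphere 0 \<rho>1" for z
  proof (rule sums_unique[symmetric])
    have "(\<lambda>n. F z * (z ^ n * lc G \<rho>2 (int n))) sums (F z * (?I z / (2 * pi * \<i>)))"
      using that \<rho> by (intro sums_mult cauchy_kernel_sums \<rho>2 G) auto
    then show "(\<lambda>n. ?g n z) sums (F z * ?I z / (2 * pi * \<i>))" by (simp add: mult_ac)
  qed
  note * = contour_integral_circlepath_sums[OF \<rho>(1) g M sM]
  have "(\<lambda>z. F z * ?I z / (2 * pi * \<i>)) contour_integrable_on circlepath 0 \<rho>1"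
    by (rule contour_integrable_eq[OF *(1)]) (use sum \<rho> in auto)
  from contour_integrable_rmul[OF this, of "2 * pi * \<i>"] show A: ?A by simp
  have "contour_integral (circlepath 0 \<rho>1) (\<lambda>z. \<Sum>n. ?g n z) =
      contour_integral (circlepath 0 \<rho>1) (\<lambda>z. F z * ?I z / (2 * pi * \<i>))"
    by (rule contour_integral_eq) (use sum \<rho> in auto)
  also have "\<dots> = contour_integral (circlepath 0 \<rho>1) (\<lambda>z. F z * ?I z) / (2 * pi * \<i>)"
    using A by (rule contour_integral_div)
  finally have "(\<lambda>n. contour_integral (circlepath 0 \<rho>1) (?g n)) sums
    (contour_integral (circlepath 0 \<rho>1) (\<lambda>z. F z * ?I z) / (2 * pi * \<i>))" using *(2) by simp
  from sums_divide[OF this, of "2 * pi * \<i>"]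
  show ?B
    using contour_integrable_circlepath[OF cont \<rho>(1)]
    by (subst (asm) contour_integral_lmul) (auto simp: lc_def power2_eq_square mult_ac)
qed

text \<open>The difference quotient of \<open>f\<close> at \<open>z\<close> has a removable
  singularity, so its integral is the same over both circles. What remains is the integral of 1/(w -
  z), equal to 2 pi i over the outer and to 0 over the inner circle.\<close>

lemma cauchy_integral_annulus:
  assumes f: "f holomorphic_on annulus r1 r2" and r: "0 \<le> r1" "r1 < a" "a < cmod z" "cmod z < b" "b < r2"
  shows "contour_integral (circlepath 0 b) (\<lambda>w. f w / (w - z)) -
         contour_integral (circlepath 0 a) (\<lambda>w. f w / (w - z)) = 2 * pi * \<i> * f z"
proof -
  let ?A = "annulus r1 r2"
  let ?h = "\<lambda>w. if w = z then deriv f z else (f w - f z) / (w - z)"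
  have z: "z \<in> ?A" using r by (auto simp: annulus_def)
  have h: "?h holomorphic_on ?A"
    by (rule pole_lemma_open[OF f open_annulus])
  have eq: "contour_integral (circlepath 0 \<rho>) ?h =
      contour_integral (circlepath 0 \<rho>) (\<lambda>w. f w / (w - z)) -
      f z * contour_integral (circlepath 0 \<rho>) (\<lambda>w. 1 / (w - z))"
    if \<rho>: "\<rho> = a \<or> \<rho> = b" for \<rho>
  proof -
    have pos: "0 < \<rho>" "cmod z \<noteq> \<rho>" "sphere 0 \<rho> \<subseteq> ?A" using \<rho> r by (auto simp: annulus_def)
    have c: "continuous_on (sphere 0 \<rho>) f"
      using f pos(3) holomorphic_on_imp_continuous_on continuous_on_subset by blast
    have i1: "(\<lambda>w. f w / (w - z)) contour_integrable_on circlepath 0 \<rho>"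
      using pos by (intro contour_integrable_circlepath continuous_intros c) auto
    have i2: "(\<lambda>w. 1 / (w - z)) contour_integrable_on circlepath 0 \<rho>"
      using pos by (intro contour_integrable_circlepath continuous_intros) auto
    have "contour_integral (circlepath 0 \<rho>) ?h =
        contour_integral (circlepath 0 \<rho>) (\<lambda>w. f w / (w - z) - f z * (1 / (w - z)))"
      using pos by (intro contour_integral_eq) (auto simp: diff_divide_distrib)
    also have "\<dots> = contour_integral (circlepath 0 \<rho>) (\<lambda>w. f w / (w - z)) -
      contour_integral (circlepath 0 \<rho>) (\<lambda>w. f z * (1 / (w - z)))"
      using i1 contour_integrable_lmul[OF i2] by (rule contour_integral_diff)
    also have "contour_integral (circlepath 0 \<rho>) (\<lambda>w. f z * (1 / (w - z))) =
        f z * contour_integral (circlepath 0 \<rho>) (\<lambda>w. 1 / (w - z))"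
      using i2 by (rule contour_integral_lmul)
    finally show ?thesis .
  qed
  have "contour_integral (circlepath 0 a) ?h = contour_integral (circlepath 0 b) ?h"
    using contour_integral_circlepath_annulus[OF h, of a b] r by auto
  moreover have "contour_integral (circlepath 0 b) (\<lambda>w. 1 / (w - z)) = 2 * pi * \<i>"
    using Cauchy_integral_circlepath_simple[of "\<lambda>_. 1" 0 b z] r
    by (intro contour_integral_unique) auto
  moreover have "contour_integral (circlepath 0 a) (\<lambda>w. 1 / (w - z)) = 0"
  proof (rule contour_integral_unique, rule Cauchy_theorem_convex_simple)
    show "(\<lambda>w. 1 / (w - z)) holomorphic_on ball 0 (cmod z)"
      by (intro holomorphic_intros) auto
  qed (use r in auto)
  ultimately show ?thesis using eq[of a] eq[of b] by (simp add: algebra_simps)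
qed

lemma lc_mult_powi:
  assumes "0 < \<rho>"
  shows "lc (\<lambda>z. f z * z powi m) \<rho> k = lc f \<rho> (k - m)"
  unfolding lc_def using assms
  by (intro arg_cong[where f = "\<lambda>x. x / _"] contour_integral_eq)
    (auto simp flip: power_int_add intro!: arg_cong[where f = "\<lambda>k. _ powi k"])

text \<open>Splitting the convolution at index \<open>0\<close> turns each half into a double contour integral with
  the Cauchy kernel; the two differ by moving one circle across the other, and the residue picked
  up on the way is the coefficient of the product.\<close>

lemma lc_convolution:
  assumes f: "f holomorphic_on annulus r1 r2" and g: "g holomorphic_on annulus r1 r2"
    and r: "0 \<le> r1" "r1 < \<rho>" "\<rho> < r2"
  shows "(\<lambda>k. lc f \<rho> k * lc g \<rho> (n - k)) summable_on UNIV"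
    and "(\<Sum>\<^sub>\<infinity>k. lc f \<rho> k * lc g \<rho> (n - k)) = lc (\<lambda>z. f z * g z) \<rho> n"
proof -
  obtain a where a: "r1 < a" "a < \<rho>" using dense r by blast
  obtain b where b: "\<rho> < b" "b < r2" using dense r by blast
  have pos: "0 < a" "0 < \<rho>" "0 < b" using r a b by auto
  have cont: "continuous_on (sphere 0 c) f" "continuous_on (sphere 0 c) g" if "r1 < c" "c < r2" for c
    using f g sphere_subset_annulus[OF that] holomorphic_on_imp_continuous_on continuous_on_subset by blast+
  have lca: "lc f a k = lc f \<rho> k" for k using lc_annulus[OF f, of a \<rho>] r a b by auto
  have lcb: "lc f b k = lc f \<rho> k" for k using lc_annulus[OF f, of b \<rho>] r a b by auto
  let ?t = "\<lambda>k. lc f \<rho> k * lc g \<rho> (n - k)"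
  obtain D where D: "0 \<le> D" "\<And>k. cmod (lc g \<rho> k) \<le> D * \<rho> powi (- k)"
    using lc_bounded[of \<rho> g] cont r a b pos by auto
  obtain Ca where Ca: "0 \<le> Ca" "\<And>k. cmod (lc f \<rho> k) \<le> Ca * a powi (- k)"
    using lc_bounded[of a f] cont r a b pos lca by auto
  obtain Cb where Cb: "0 \<le> Cb" "\<And>k. cmod (lc f \<rho> k) \<le> Cb * b powi (- k)"
    using lc_bounded[of b f] cont r a b pos lcb by auto
  \<comment> \<open>The coefficients of \<open>f\<close> are estimated on the larger circle
    \<open>b\<close> for k at least 0 and on the smaller circle \<open>a\<close> for negative k,
    those of \<open>g\<close> always on \<rho>; the ratios yield decay in both directions.\<close>
  define \<sigma> where "\<sigma> = max (a / \<rho>) (\<rho> / b)"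
  have \<sigma>: "0 < \<sigma>" "\<sigma> < 1" using pos a b by (auto simp: \<sigma>_def less_max_iff_disj)
  have bound: "cmod (?t k) \<le> max Ca Cb * D * \<rho> powi (- n) * \<sigma> ^ nat \<bar>k\<bar>" for k
  proof (cases "k \<ge> 0")
    case True
    then obtain j where j: "k = int j" using nonneg_int_cases by blast
    have "cmod (?t k) \<le> (Cb * b powi (- k)) * (D * \<rho> powi (- (n - k)))"
      unfolding norm_mult using Cb D(1) D(2)[of "n - k"] pos by (intro mult_mono) auto
    also have "\<dots> = Cb * D * \<rho> powi (- n) * (\<rho> / b) ^ j"
      using pos by (simp add: j power_int_diff power_int_minus field_simps)
    also have "\<dots> \<le> max Ca Cb * D * \<rho> powi (- n) * \<sigma> ^ j"
      using pos Cb D Ca by (intro mult_mono power_mono) (auto simp: \<sigma>_def)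
    finally show ?thesis by (simp add: j)
  next
    case False
    then have "k = - int (nat (- k))" by simp
    then obtain j where j: "k = - int j" by blast
    have "cmod (?t k) \<le> (Ca * a powi (- k)) * (D * \<rho> powi (- (n - k)))"
      unfolding norm_mult using Ca D(1) D(2)[of "n - k"] pos by (intro mult_mono) auto
    also have "\<dots> = Ca * D * \<rho> powi (- n) * (a / \<rho>) ^ j"
      using pos by (simp add: j power_int_diff power_int_minus field_simps)
    also have "\<dots> \<le> max Ca Cb * D * \<rho> powi (- n) * \<sigma> ^ j"
      using pos Cb D Ca by (intro mult_mono power_mono) (auto simp: \<sigma>_def)
    finally show ?thesis by (simp add: j)
  qed
  have sum\<sigma>: "(\<lambda>k::int. max Ca Cb * D * \<rho> powi (- n) * \<sigma> ^ nat \<bar>k\<bar>) summable_on UNIV"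
    by (intro summable_on_cmult_right has_sum_imp_summable[OF has_sum_int_geometric[OF \<sigma>]])
  show summ: "?t summable_on UNIV" by (rule summable_on_dominated[OF sum\<sigma> bound])
  have summ': "?t summable_on X" for X using summ summable_on_subset_banach by blast
  \<comment> \<open>The power shifts indices so that the coefficient of \<open>?G\<close> at -j - 1
    is that of \<open>g\<close> at n - j, and the one at j is that of \<open>g\<close> at n + j +
    1.\<close>
  let ?G = "\<lambda>z. g z * z powi (- n - 1)"
  have G: "continuous_on (sphere 0 \<rho>) ?G"
    using pos r cont[of \<rho>] by (intro continuous_intros continuous_on_powi) auto
  let ?If = "\<lambda>c z. contour_integral (circlepath 0 c) (\<lambda>w. f w / (w - z))"
  have nonneg: "(\<lambda>j. ?t (int j)) sums
      (contour_integral (circlepath 0 \<rho>) (\<lambda>z. ?G z * ?If b z) / (2 * pi * \<i>)^2)"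
  proof -
    have "(\<lambda>j. lc ?G \<rho> (- int j - 1) * lc f b (int j)) sums
      (contour_integral (circlepath 0 \<rho>) (\<lambda>z. ?G z * ?If b z) / (2 * pi * \<i>)^2)"
      using pos a b r cont by (intro double_contour_sums G) auto
    moreover have "lc ?G \<rho> (- int j - 1) = lc g \<rho> (n - int j)" for j
      by (subst lc_mult_powi[OF pos(2)]) (simp add: algebra_simps)
    ultimately show ?thesis by (simp add: lcb mult_ac)
  qed
  \<comment> \<open>In the negative half \<open>f\<close> sits on the inner circle. Fubini and the
    antisymmetry of the Cauchy kernel bring it to the shape of the nonnegative half, with the
    opposite sign.\<close>
  have swap: "contour_integral (circlepath 0 a) (\<lambda>z. f z * contour_integral (circlepath 0 \<rho>) (\<lambda>w. ?G w / (w - z))) =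
      - contour_integral (circlepath 0 \<rho>) (\<lambda>z. ?G z * ?If a z)"
  proof -
    have int: "(\<lambda>w. ?G w / (w - z)) contour_integrable_on circlepath 0 \<rho>" if "cmod z = a" for z
      using pos a that by (intro contour_integrable_circlepath continuous_intros G) auto
    have intf: "(\<lambda>w. f w / (w - z)) contour_integrable_on circlepath 0 a" if "cmod z = \<rho>" for z
      using pos a b that cont[of a] by (intro contour_integrable_circlepath continuous_intros) auto
    have "contour_integral (circlepath 0 a) (\<lambda>z. f z * contour_integral (circlepath 0 \<rho>) (\<lambda>w. ?G w / (w - z))) =
        contour_integral (circlepath 0 a) (\<lambda>z. contour_integral (circlepath 0 \<rho>) (\<lambda>w. f z * (?G w / (w - z))))"
      using pos by (intro contour_integral_eq contour_integral_lmul[symmetric] int) auto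
    also have "\<dots> = contour_integral (circlepath 0 \<rho>) (\<lambda>w. contour_integral (circlepath 0 a) (\<lambda>z. f z * (?G w / (w - z))))"
    proof (rule contour_integral_swap)
      have cf: "continuous_on (sphere 0 a \<times> sphere 0 \<rho>) (\<lambda>x. f (fst x))"
        by (rule continuous_on_compose2[OF cont(1)[of a] continuous_on_fst[OF continuous_on_id]])
           (use a b r in auto)
      have cG: "continuous_on (sphere 0 a \<times> sphere 0 \<rho>) (\<lambda>x. ?G (snd x))"
        by (rule continuous_on_compose2[OF G continuous_on_snd[OF continuous_on_id]]) auto
      have "continuous_on (sphere 0 a \<times> sphere 0 \<rho>) (\<lambda>x. f (fst x) * (?G (snd x) / (snd x - fst x)))"
        using a by (intro continuous_on_mult continuous_on_divide cf cG continuous_on_diff continuous_on_fst continuous_on_snd continuous_on_id) auto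
      then show "continuous_on (path_image (circlepath 0 a) \<times> path_image (circlepath 0 \<rho>))
          (\<lambda>(y1, y2). f y1 * (?G y2 / (y2 - y1)))"
        using pos by (simp add: case_prod_unfold)
    qed (auto intro!: continuous_intros simp: vector_derivative_circlepath)
    also have "\<dots> = contour_integral (circlepath 0 \<rho>) (\<lambda>z. - (?G z * ?If a z))"
    proof (rule contour_integral_eq)
      fix w assume "w \<in> path_image (circlepath 0 \<rho>)"
      then have w: "cmod w = \<rho>" using pos by auto
      have "contour_integral (circlepath 0 a) (\<lambda>z. f z * (?G w / (w - z))) =
         contour_integral (circlepath 0 a) (\<lambda>z. - ?G w * (f z / (z - w)))"
      proof (rule contour_integral_eq)
        fix z
        have "?G w / (w - z) = - ?G w / (z - w)" by (metis minus_diff_eq minus_divide_divide)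
        then show "f z * (?G w / (w - z)) = - ?G w * (f z / (z - w))" by simp
      qed
      also have "\<dots> = - ?G w * ?If a w" by (rule contour_integral_lmul[OF intf[OF w]])
      finally show "contour_integral (circlepath 0 a) (\<lambda>z. f z * (?G w / (w - z))) = - (?G w * ?If a w)"
        by simp
    qed
    finally show ?thesis by (simp add: contour_integral_neg)
  qed
  have neg: "(\<lambda>j. ?t (- int j - 1)) sums
      (- contour_integral (circlepath 0 \<rho>) (\<lambda>z. ?G z * ?If a z) / (2 * pi * \<i>)^2)"
  proof -
    have "(\<lambda>j. lc f a (- int j - 1) * lc ?G \<rho> (int j)) sums
      (contour_integral (circlepath 0 a) (\<lambda>z. f z * contour_integral (circlepath 0 \<rho>) (\<lambda>w. ?G w / (w - z))) / (2 * pi * \<i>)^2)"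
      using pos a b r cont by (intro double_contour_sums G) auto
    moreover have "lc ?G \<rho> (int j) = lc g \<rho> (n - (- int j - 1))" for j
      by (subst lc_mult_powi[OF pos(2)]) (simp add: algebra_simps)
    ultimately show ?thesis by (simp only: lca swap)
  qed
  have i1: "infsum ?t {0..} = (\<Sum>\<^sub>\<infinity>j. ?t (int j))"
    by (rule infsum_reindex_bij_witness[of _ int nat]) auto
  have i2: "infsum ?t {..-1} = (\<Sum>\<^sub>\<infinity>j. ?t (- int j - 1))"
    by (rule infsum_reindex_bij_witness[of _ "\<lambda>j. - int j - 1" "\<lambda>k. nat (- k - 1)"]) auto
  have s1: "(\<lambda>j. ?t (int j)) summable_on UNIV"
    using summ'[of "range int"] by (subst (asm) summable_on_reindex) (auto simp: o_def)
  have s2: "(\<lambda>j. ?t (- int j - 1)) summable_on UNIV"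
    using summ'[of "range (\<lambda>j. - int j - 1)"] by (subst (asm) summable_on_reindex) (auto simp: o_def inj_on_def)
  have "infsum ?t UNIV = infsum ?t ({0..} \<union> {..-1})" by (rule arg_cong[where f = "infsum ?t"]) auto
  also have "\<dots> = infsum ?t {0..} + infsum ?t {..-1}"
    by (rule infsum_Un_disjoint) (auto intro: summ')
  also have "\<dots> = contour_integral (circlepath 0 \<rho>) (\<lambda>z. ?G z * ?If b z) / (2 * pi * \<i>)^2 +
      (- contour_integral (circlepath 0 \<rho>) (\<lambda>z. ?G z * ?If a z) / (2 * pi * \<i>)^2)"
    unfolding i1 i2
    using sums_unique2[OF has_sum_imp_sums[OF has_sum_infsum[OF s1]] nonneg]
      sums_unique2[OF has_sum_imp_sums[OF has_sum_infsum[OF s2]] neg] by simp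
  also have "\<dots> = (contour_integral (circlepath 0 \<rho>) (\<lambda>z. ?G z * ?If b z) -
      contour_integral (circlepath 0 \<rho>) (\<lambda>z. ?G z * ?If a z)) / (2 * pi * \<i>)^2"
    by (simp add: diff_divide_distrib)
  also have "contour_integral (circlepath 0 \<rho>) (\<lambda>z. ?G z * ?If b z) -
      contour_integral (circlepath 0 \<rho>) (\<lambda>z. ?G z * ?If a z) =
      contour_integral (circlepath 0 \<rho>) (\<lambda>z. ?G z * ?If b z - ?G z * ?If a z)"
  proof (rule contour_integral_diff[symmetric])
    show "(\<lambda>z. ?G z * ?If b z) contour_integrable_on circlepath 0 \<rho>"
      using pos a b r cont by (intro double_contour_integrable G) auto
    \<comment> \<open>Integrability for radius \<open>a\<close> is inherited from radius
      \<open>b\<close>, as the two integrands differ by the continuous function 2 pi i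
      \<open>?G z * f z\<close>.\<close>
    have "(\<lambda>z. ?G z * ?If b z - 2 * pi * \<i> * (?G z * f z)) contour_integrable_on circlepath 0 \<rho>"
      using pos a b r cont
      by (intro contour_integrable_diff contour_integrable_lmul double_contour_integrable G
            contour_integrable_circlepath continuous_on_mult) auto
    then show "(\<lambda>z. ?G z * ?If a z) contour_integrable_on circlepath 0 \<rho>"
    proof (rule contour_integrable_eq)
      fix z assume "z \<in> path_image (circlepath 0 \<rho>)"
      then have z: "cmod z = \<rho>" using pos by auto
      have "?If b z = ?If a z + 2 * pi * \<i> * f z"
        using cauchy_integral_annulus[OF f, of a z b] r a b z by (simp add: algebra_simps)
      then show "?G z * ?If b z - 2 * pi * \<i> * (?G z * f z) = ?G z * ?If a z"
        by (simp add: algebra_simps)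
    qed
  qed
  also have "\<dots> = contour_integral (circlepath 0 \<rho>) (\<lambda>z. 2 * pi * \<i> * (f z * g z * z powi (- n - 1)))"
  proof (rule contour_integral_eq)
    fix z assume "z \<in> path_image (circlepath 0 \<rho>)"
    then have z: "cmod z = \<rho>" using pos by auto
    show "?G z * ?If b z - ?G z * ?If a z = 2 * pi * \<i> * (f z * g z * z powi (- n - 1))"
      using cauchy_integral_annulus[OF f, of a z b] r a b z
      by (simp add: right_diff_distrib[symmetric])
  qed
  also have "\<dots> = 2 * pi * \<i> * contour_integral (circlepath 0 \<rho>) (\<lambda>z. f z * g z * z powi (- n - 1))"
    using cont[of \<rho>] r pos
    by (intro contour_integral_lmul contour_integrable_circlepath continuous_intros continuous_on_powi) auto
  finally show "infsum ?t UNIV = lc (\<lambda>z. f z * g z) \<rho> n"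
    by (simp add: lc_def power2_eq_square)
qed

text \<open>Both circles are parametrized by the same angle, so the integrands agree up to powers of
  \<open>c\<close>. With c = q this identifies q^k times a coefficient of the symbol as a
  coefficient of its q-dilate.\<close>

lemma lc_dilate:
  assumes "0 < \<rho>" "0 < c"
  shows "lc (\<lambda>z. f (of_real c * z)) \<rho> k = of_real c powi k * lc f (c * \<rho>) k"
proof -
  let ?\<gamma> = "circlepath 0 \<rho>"
  have \<gamma>: "circlepath 0 (c * \<rho>) t = of_real c * ?\<gamma> t" for t
    by (simp add: circlepath)
  have c: "of_real c powi k * (of_real c powi (- k - 1) * of_real c) = (1::complex)"
    using assms by (simp add: power_int_diff power_int_minus)
  have "of_real c powi k * contour_integral (circlepath 0 (c * \<rho>)) (\<lambda>z. f z * z powi (- k - 1)) =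
     contour_integral ?\<gamma> (\<lambda>z. f (of_real c * z) * z powi (- k - 1))"
    unfolding contour_integral_integral integral_mult_right[symmetric]
  proof (intro integral_cong)
    fix t :: real
    have "of_real c powi k * (f (circlepath 0 (c * \<rho>) t) * circlepath 0 (c * \<rho>) t powi (- k - 1) *
        vector_derivative (circlepath 0 (c * \<rho>)) (at t)) =
      (of_real c powi k * (of_real c powi (- k - 1) * of_real c)) *
      (f (of_real c * ?\<gamma> t) * ?\<gamma> t powi (- k - 1) * vector_derivative ?\<gamma> (at t))"
      unfolding \<gamma> vector_derivative_circlepath power_int_mult_distrib by simp
    then show "of_real c powi k * (f (circlepath 0 (c * \<rho>) t) * circlepath 0 (c * \<rho>) t powi (- k - 1) *
        vector_derivative (circlepath 0 (c * \<rho>)) (at t)) =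
      f (of_real c * ?\<gamma> t) * ?\<gamma> t powi (- k - 1) * vector_derivative ?\<gamma> (at t)"
      unfolding c by simp
  qed
  then show ?thesis by (simp add: lc_def)
qed

section \<open>The factorization for abstract symbols\<close>

text \<open>The abstract content of a Cauchy estimate on the circle of radius \<open>x\<close>, with
  one constant for both signs of \<open>k\<close>.\<close>

definition decay :: "(int \<Rightarrow> complex) \<Rightarrow> real \<Rightarrow> bool" where
  "decay f x \<longleftrightarrow> (\<exists>C\<ge>0. \<forall>k. cmod (f k) \<le> C * x powi (- k))"

lemma decay_reflect: "decay f x \<Longrightarrow> decay (\<lambda>k. f (- k)) (inverse x)"
  unfolding decay_def power_int_inverse power_int_minus[symmetric] by fastforce

text \<open>Entry of (Laurent matrix) (projection onto \<open>X\<close>) (Laurent matrix). The set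
  \<open>X\<close> is free so that the projection can be truncated to \<open>{..<k}\<close> and to a
  single index.\<close>

definition half_conv :: "(int \<Rightarrow> complex) \<Rightarrow> (int \<Rightarrow> complex) \<Rightarrow> nat set \<Rightarrow> int \<Rightarrow> int \<Rightarrow> complex" where
  "half_conv f g X m1 m2 = (\<Sum>\<^sub>\<infinity>n\<in>X. f (m1 - int n) * g (int n - m2))"

text \<open>With \<open>f\<close> estimated on the smaller and \<open>g\<close> on the larger
  circle, the n-th term carries \<open>(x / y) ^ n\<close>. The bound separates into a row weight
  and a column weight; the sum of the geometric series is absorbed into \<open>C\<close>, so that
  one constant serves terms and sums.\<close>

lemma half_conv_bound:
  assumes fg: "decay f x" "decay g y" and xy: "0 < x" "x < y"
  obtains C where "0 \<le> C"
    "\<And>m1 m2 n. cmod (f (m1 - int n) * g (int n - m2)) \<le> C * (x powi (- m1) * y powi m2) * (x / y) ^ n"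
    "\<And>m1 m2 X. (\<lambda>n. f (m1 - int n) * g (int n - m2)) summable_on X"
    "\<And>m1 m2 X. cmod (half_conv f g X m1 m2) \<le> C * (x powi (- m1) * y powi m2)"
proof -
  obtain Cf Cg where C: "0 \<le> Cf" "\<And>k. cmod (f k) \<le> Cf * x powi (- k)"
      "0 \<le> Cg" "\<And>k. cmod (g k) \<le> Cg * y powi (- k)"
    using fg unfolding decay_def by blast
  define c where "c = 1 / (1 - x / y)"
  have c1: "1 \<le> c" using xy by (simp add: c_def field_simps)
  have geo: "((\<lambda>n. (x / y) ^ n) has_sum c) UNIV"
    unfolding c_def using geometric_sums[of "x / y"] xy by (intro sums_nonneg_imp_has_sum) auto
  have fgle: "cmod (f (m1 - int n) * g (int n - m2)) \<le> Cf * Cg * (x powi (- m1) * y powi m2) * (x / y) ^ n"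
    for m1 m2 n
  proof -
    have "cmod (f (m1 - int n) * g (int n - m2)) \<le>
        (Cf * x powi (- (m1 - int n))) * (Cg * y powi (- (int n - m2)))"
      unfolding norm_mult using C(1,3) C(2)[of "m1 - int n"] C(4)[of "int n - m2"] xy
      by (intro mult_mono) auto
    also have "\<dots> = Cf * Cg * (x powi (- m1) * y powi m2) * (x / y) ^ n"
      using xy by (simp add: power_int_diff power_int_minus field_simps)
    finally show ?thesis .
  qed
  have nn: "0 \<le> Cf * Cg * (x powi (- m1) * y powi m2)" for m1 m2 using C xy by auto
  have summ: "(\<lambda>n. Cf * Cg * (x powi (- m1) * y powi m2) * (x / y) ^ n) summable_on X" for m1 m2 X
    using has_sum_imp_summable[OF geo] summable_on_subset_banach[of _ UNIV X]
    by (intro summable_on_cmult_right) auto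
  have fgsumm: "(\<lambda>n. f (m1 - int n) * g (int n - m2)) summable_on X" for m1 m2 X
    by (rule summable_on_dominated[OF summ fgle])
  show thesis
  proof (rule that)
    show "0 \<le> Cf * Cg * c" using C c1 by auto
    show "cmod (f (m1 - int n) * g (int n - m2)) \<le> Cf * Cg * c * (x powi (- m1) * y powi m2) * (x / y) ^ n"
      for m1 m2 n
    proof -
      have "Cf * Cg * (x powi (- m1) * y powi m2) \<le> Cf * Cg * c * (x powi (- m1) * y powi m2)"
        using mult_left_mono[OF c1 nn[of m1 m2]] by (simp add: mult_ac)
      from mult_right_mono[OF this, of "(x / y) ^ n"] xy
      have "Cf * Cg * (x powi (- m1) * y powi m2) * (x / y) ^ n \<le> Cf * Cg * c * (x powi (- m1) * y powi m2) * (x / y) ^ n"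
        by simp
      with fgle show ?thesis by (rule order_trans)
    qed
    show "(\<lambda>n. f (m1 - int n) * g (int n - m2)) summable_on X" for m1 m2 X by (rule fgsumm)
    show "cmod (half_conv f g X m1 m2) \<le> Cf * Cg * c * (x powi (- m1) * y powi m2)" for m1 m2 X
    proof -
      have "cmod (half_conv f g X m1 m2) \<le> (\<Sum>\<^sub>\<infinity>n\<in>X. Cf * Cg * (x powi (- m1) * y powi m2) * (x / y) ^ n)"
        unfolding half_conv_def
        by (rule norm_infsum_le[OF has_sum_infsum[OF fgsumm] has_sum_infsum[OF summ] fgle])
      also have "\<dots> \<le> (\<Sum>\<^sub>\<infinity>n. Cf * Cg * (x powi (- m1) * y powi m2) * (x / y) ^ n)"
        by (rule infsum_mono_neutral[OF summ summ]) (use nn xy in auto)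
      also have "\<dots> = Cf * Cg * (x powi (- m1) * y powi m2) * c"
        using geo by (intro infsumI has_sum_cmult_right)
      finally show ?thesis by (simp add: mult_ac)
    qed
  qed
qed

lemma infsum_swap_dominated:
  fixes F :: "'a \<Rightarrow> 'b \<Rightarrow> complex"
  assumes u: "u summable_on UNIV" "\<And>x. 0 \<le> u x" and v: "v summable_on UNIV" "\<And>y. 0 \<le> (v y :: real)"
    and F: "\<And>x y. cmod (F x y) \<le> u x * v y"
  shows "(\<Sum>\<^sub>\<infinity>x. \<Sum>\<^sub>\<infinity>y. F x y) = (\<Sum>\<^sub>\<infinity>y. \<Sum>\<^sub>\<infinity>x. F x y)"
proof (rule infsum_swap_banach)
  have "(\<lambda>(x, y). u x * v y) summable_on UNIV \<times> UNIV"
  proof (rule summable_on_SigmaI)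
    show "((\<lambda>y. case (x, y) of (x, y) \<Rightarrow> u x * v y) has_sum u x * infsum v UNIV) UNIV" for x
      using v by (auto intro!: has_sum_cmult_right)
    show "(\<lambda>x. u x * infsum v UNIV) summable_on UNIV" using u by (intro summable_on_cmult_left)
  qed (use u v in auto)
  then show "(\<lambda>(x, y). F x y) summable_on UNIV \<times> UNIV"
    by (rule summable_on_dominated) (use F in auto)
qed

lemma has_sum_sum_zero:
  "(\<And>n. n < k \<Longrightarrow> (f n has_sum 0) UNIV) \<Longrightarrow> ((\<lambda>m. \<Sum>n<k. f n m :: complex) has_sum 0) UNIV" for k :: nat
proof (induction k)
  case (Suc k)
  from has_sum_add[OF Suc.IH Suc.prems[of k]] Suc.prems show ?case by simp
qed simp

text \<open>In the application \<open>\<phi>\<close>, \<open>\<psi>\<close>, \<open>\<omega>\<close> are the Laurent coefficients of the symbol, of its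
  reciprocal inside all poles \<open>1 / (a\<^sub>i q\<^sup>j)\<close>, and of its reciprocal between the poles with
  \<open>j = 0\<close> and those with \<open>j \<ge> 1\<close>. Then \<open>P = - L\<close> and \<open>P - PR = K\<close>.\<close>

locale wiener_hopf_symbols =
  fixes \<phi> \<psi> \<omega> :: "int \<Rightarrow> complex" and s q x0 x1 x2 p y R :: real
  assumes s: "0 < s" and q: "0 < q" "q < 1" and p_def: "p = q * R"
    and radii: "0 < x0" "x0 < x1" "x1 < p" "p < x2" "x2 < y" "y < R"
    and \<phi>: "decay \<phi> x1" "decay \<phi> x2"
    and \<psi>: "decay \<psi> x0" "decay \<psi> p" "decay \<psi> y"
    and \<omega>: "decay \<omega> R"
    and inverse: "\<And>n. ((\<lambda>k. \<phi> k * \<psi> (n - k)) has_sum of_bool (n = 0)) UNIV"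
    and triangular: "\<And>n. 0 \<le> n \<Longrightarrow> ((\<lambda>k. \<omega> (n - k) * of_real (q powi k) * \<phi> k) has_sum 0) UNIV"
begin

definition mult :: "int \<Rightarrow> real" where "mult m = s * q powi m / (1 + s * q powi m)"

definition P where "P = half_conv \<phi> \<psi> UNIV"
definition PR where "PR = half_conv \<phi> \<omega> UNIV"
text \<open>The half of the convolution that \<open>P\<close> omits, over the indices -1 - j. As the
  symbols are reciprocal, \<open>Q\<close> is 1 - P, that is 1 + L.\<close>

definition Q where "Q m1 m2 = (\<Sum>\<^sub>\<infinity>j::nat. \<phi> (m1 + 1 + int j) * \<psi> (- 1 - int j - m2))"

text \<open>Rows of negative and of nonnegative index are estimated on different circles: the diagonal
  weight \<open>\<alpha> m * \<beta> m\<close> has to decay in both directions, and no single circle achieves that.\<close>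

definition e :: "int \<Rightarrow> real" where "e m = (if m < 0 then x1 else x2) powi (- m)"
definition \<alpha> where "\<alpha> m = mult m * e m"
text \<open>\<open>R powi m\<close> is the column growth of \<open>PR\<close>, and 1 + s q^m is the
  factor that \<open>A\<close> carries. Since p = q R, the product equals R^m + s p^m, which also
  dominates the columns of \<open>P\<close>.\<close>

definition \<beta> where "\<beta> m = R powi m * (1 + s * q powi m)"
definition \<tau> where "\<tau> = max (x1 / p) (p / x2)"

lemma pos: "0 < x1" "0 < p" "0 < x2" "0 < y" "0 < R" "x1 < R" "x2 < R" "p < y" "p < R" "x0 < x2" "x1 < x2"
  using radii by auto

lemma mult_pos: "0 < mult m" and one_plus: "(1 + s * q powi m) * mult m = s * q powi m" "1 + s * q powi m > 0"
proof -
  show 1: "1 + s * q powi m > 0" using s q by (simp add: add_pos_pos)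
  show "0 < mult m" using 1 s q by (simp add: mult_def)
  show "(1 + s * q powi m) * mult m = s * q powi m" using 1 by (simp add: mult_def)
qed

lemma e_pos: "0 < e m" using pos by (simp add: e_def)

lemma \<tau>: "0 < \<tau>" "\<tau> < 1" using radii pos by (auto simp: \<tau>_def less_max_iff_disj)

text \<open>Here \<open>p\<close> has to lie strictly between the row radii: x1/p is the rate for
  negative \<open>m\<close>, p/x2 the rate for the others.\<close>

lemma e_p_le: "p powi m * e m \<le> \<tau> ^ nat \<bar>m\<bar>"
proof (cases "m < 0")
  case True
  then have "m = - int (nat (- m))" by simp
  then obtain j where j: "m = - int j" by blast
  have "p powi m * e m = (x1 / p) ^ j"
    using True pos by (simp add: e_def j power_int_minus field_simps)
  also have "\<dots> \<le> \<tau> ^ j" using pos by (intro power_mono) (auto simp: \<tau>_def)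
  finally show ?thesis by (simp add: j)
next
  case False
  then obtain j where j: "m = int j" using nonneg_int_cases[of m] by auto
  have "p powi m * e m = (p / x2) ^ j"
    using False pos by (simp add: e_def j power_int_minus field_simps)
  also have "\<dots> \<le> \<tau> ^ j" using pos by (intro power_mono) (auto simp: \<tau>_def)
  finally show ?thesis by (simp add: j)
qed

lemma summable_\<tau>: "(\<lambda>m::int. c * \<tau> ^ nat \<bar>m\<bar>) summable_on UNIV"
  by (intro summable_on_cmult_right has_sum_imp_summable[OF has_sum_int_geometric[OF \<tau>]])

text \<open>The factor 1 + s q^m of \<beta> cancels the denominator of \<open>mult\<close>, leaving
  s (q R)^m \<open>e m\<close>, which is s p^m \<open>e m\<close>.\<close>

lemma weight: "0 \<le> \<alpha> m" "0 \<le> \<beta> m" "\<alpha> m * \<beta> m \<le> s * \<tau> ^ nat \<bar>m\<bar>"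
proof -
  show "0 \<le> \<alpha> m" using mult_pos[of m] e_pos[of m] by (simp add: \<alpha>_def)
  show "0 \<le> \<beta> m" using one_plus(2)[of m] pos by (simp add: \<beta>_def)
  have "\<alpha> m * \<beta> m = ((1 + s * q powi m) * mult m) * (R powi m * e m)"
    by (simp add: \<alpha>_def \<beta>_def)
  also have "\<dots> = s * (p powi m * e m)"
    unfolding one_plus by (simp add: p_def power_int_mult_distrib)
  also have "\<dots> \<le> s * \<tau> ^ nat \<bar>m\<bar>" using e_p_le[of m] s by simp
  finally show "\<alpha> m * \<beta> m \<le> s * \<tau> ^ nat \<bar>m\<bar>" .
qed

section \<open>Weighted bounds for the kernels \<open>PR\<close>, \<open>P\<close> and
  \<open>Q\<close>\<close>

lemma PR_bound:
  obtains C where "0 \<le> C" "\<And>X m1 m2. cmod (half_conv \<phi> \<omega> X m1 m2) \<le> C * (e m1 * R powi m2)"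
proof -
  obtain C1 where C1: "0 \<le> C1" "\<And>m1 m2 X. cmod (half_conv \<phi> \<omega> X m1 m2) \<le> C1 * (x1 powi (- m1) * R powi m2)"
    using half_conv_bound[OF \<phi>(1) \<omega>] pos by metis
  obtain C2 where C2: "0 \<le> C2" "\<And>m1 m2 X. cmod (half_conv \<phi> \<omega> X m1 m2) \<le> C2 * (x2 powi (- m1) * R powi m2)"
    using half_conv_bound[OF \<phi>(2) \<omega>] pos by metis
  show thesis
  proof (rule that[of "max C1 C2"])
    show "0 \<le> max C1 C2" using C1 by simp
    fix X m1 m2
    have "C * (e m1 * R powi m2) \<le> max C1 C2 * (e m1 * R powi m2)" if "C = C1 \<or> C = C2" for C
      using that e_pos[of m1] pos by (intro mult_right_mono) auto
    then show "cmod (half_conv \<phi> \<omega> X m1 m2) \<le> max C1 C2 * (e m1 * R powi m2)"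
      using C1(2)[of X m1 m2] C2(2)[of X m1 m2] by (fastforce simp: e_def split: if_splits)
  qed
qed

text \<open>Each row circle is paired with a larger column circle: \<open>p\<close> for
  \<open>x1\<close>, \<open>y\<close> for \<open>x2\<close>. Because p < y < R, the power y^m is at
  most p^m for negative m and at most R^m otherwise, so both column powers are dominated by a
  multiple of R^m + s p^m.\<close>

lemma P_bound: obtains C where "0 \<le> C" "\<And>m1 m2. cmod (P m1 m2) \<le> C * (e m1 * \<beta> m2)"
proof -
  obtain C1 where C1: "0 \<le> C1" "\<And>m1 m2. cmod (P m1 m2) \<le> C1 * (x1 powi (- m1) * p powi m2)"
    unfolding P_def using half_conv_bound[OF \<phi>(1) \<psi>(2)] radii pos by metis
  obtain C2 where C2: "0 \<le> C2" "\<And>m1 m2. cmod (P m1 m2) \<le> C2 * (x2 powi (- m1) * y powi m2)"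
    unfolding P_def using half_conv_bound[OF \<phi>(2) \<psi>(3)] radii pos by metis
  have \<beta>: "\<beta> m = R powi m + s * p powi m" for m
    by (simp add: \<beta>_def p_def power_int_mult_distrib algebra_simps)
  have Rpos: "0 < R powi m" "0 < p powi m" for m using pos by auto
  have p\<beta>: "p powi m \<le> (1 + 1 / s) * \<beta> m" for m
  proof -
    have "(1 + 1 / s) * \<beta> m = R powi m + s * p powi m + R powi m / s + p powi m"
      using s by (simp add: \<beta> field_simps)
    then show ?thesis using s Rpos[of m] by (simp add: add_nonneg_nonneg)
  qed
  have R\<beta>: "R powi m \<le> (1 + 1 / s) * \<beta> m" for m
  proof -
    have "(1 + 1 / s) * \<beta> m = R powi m + (s * p powi m + R powi m / s + p powi m)"
      using s by (simp add: \<beta> field_simps)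
    then show ?thesis using s Rpos[of m] by (simp add: add_nonneg_nonneg)
  qed
  have y\<beta>: "y powi m \<le> (1 + 1 / s) * \<beta> m" for m
  proof (cases "m < 0")
    case True
    then have "m = - int (nat (- m))" by simp
    then obtain j where j: "m = - int j" by blast
    have "y powi m \<le> p powi m" unfolding j power_int_minus using pos radii
      by (intro le_imp_inverse_le) (auto intro!: power_mono)
    with p\<beta>[of m] show ?thesis by simp
  next
    case False
    then obtain j where j: "m = int j" using nonneg_int_cases[of m] by auto
    have "y powi m \<le> R powi m" unfolding j using pos radii by (auto intro!: power_mono)
    with R\<beta>[of m] show ?thesis by simp
  qed
  define C where "C = max C1 C2"
  show thesis
  proof (rule that[of "C * (1 + 1 / s)"])
    show "0 \<le> C * (1 + 1 / s)" using C1 s by (simp add: C_def)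
    fix m1 m2
    have *: "cmod (P m1 m2) \<le> C * (e m1 * (if m1 < 0 then p else y) powi m2)"
    proof (cases "m1 < 0")
      case True
      have "C1 * (x1 powi (- m1) * p powi m2) \<le> C * (x1 powi (- m1) * p powi m2)"
        using pos by (intro mult_right_mono) (auto simp: C_def)
      with C1(2)[of m1 m2] True show ?thesis by (simp add: e_def)
    next
      case False
      have "C2 * (x2 powi (- m1) * y powi m2) \<le> C * (x2 powi (- m1) * y powi m2)"
        using pos by (intro mult_right_mono) (auto simp: C_def)
      with C2(2)[of m1 m2] False show ?thesis by (simp add: e_def)
    qed
    also have "\<dots> \<le> C * (e m1 * ((1 + 1 / s) * \<beta> m2))"
      using p\<beta>[of m2] y\<beta>[of m2] e_pos[of m1] C1 by (intro mult_left_mono) (auto simp: C_def)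
    finally show "cmod (P m1 m2) \<le> C * (1 + 1 / s) * (e m1 * \<beta> m2)" by (simp add: mult_ac)
  qed
qed

text \<open>The summation runs towards negative indices, so \<psi> must be estimated on a circle
  smaller than that of \<phi>, namely \<open>x0\<close>. Reflecting k to -k inverts the radii and
  reduces this to \<open>half_conv_bound\<close>.\<close>

lemma Q_bound:
  obtains C where "0 \<le> C" "\<And>m1 m2. cmod (Q m1 m2) \<le> C * (e m1 * x0 powi m2)"
    "\<And>m1 m2 j. cmod (\<phi> (m1 + 1 + int j) * \<psi> (- 1 - int j - m2)) \<le> C * (e m1 * x0 powi m2) * (x0 / x1) ^ j"
    "\<And>m1 m2. (\<lambda>j::nat. \<phi> (m1 + 1 + int j) * \<psi> (- 1 - int j - m2)) summable_on UNIV"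
proof -
  have *: "\<exists>C\<ge>0. (\<forall>m1 m2. cmod (Q m1 m2) \<le> C * (x powi (- m1) * x0 powi m2)) \<and>
    (\<forall>m1 m2 j. cmod (\<phi> (m1 + 1 + int j) * \<psi> (- 1 - int j - m2)) \<le> C * (x powi (- m1) * x0 powi m2) * (x0 / x1) ^ j) \<and>
    (\<forall>m1 m2. (\<lambda>j::nat. \<phi> (m1 + 1 + int j) * \<psi> (- 1 - int j - m2)) summable_on UNIV)"
    if x: "decay \<phi> x" "x1 \<le> x" for x
  proof -
    have pos': "0 < x" "x0 < x" using x(2) radii pos by auto
    have inv: "0 < inverse x" "inverse x < inverse x0"
      using pos' radii by (auto intro: less_imp_inverse_less)
    obtain C where C: "0 \<le> C"
      "\<And>m1 m2 n. cmod (\<phi> (- (m1 - int n)) * \<psi> (- (int n - m2))) \<le>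
         C * (inverse x powi (- m1) * inverse x0 powi m2) * (inverse x / inverse x0) ^ n"
      "\<And>m1 m2 X. (\<lambda>n. \<phi> (- (m1 - int n)) * \<psi> (- (int n - m2))) summable_on X"
      "\<And>m1 m2 X. cmod (half_conv (\<lambda>k. \<phi> (- k)) (\<lambda>k. \<psi> (- k)) X m1 m2) \<le> C * (inverse x powi (- m1) * inverse x0 powi m2)"
      by (rule half_conv_bound[OF decay_reflect[OF x(1)] decay_reflect[OF \<psi>(1)] inv]) (rule that; blast)
    let ?C = "C * (x0 / x)"
    \<comment> \<open>The index starts at -1 and not at 0, hence the arguments
      \<open>- m1 - 1\<close> and \<open>- m2 - 1\<close>; this shift costs the factor
      \<open>x0 / x\<close>.\<close>
    have scale: "C * (inverse x powi (- (- m1 - 1)) * inverse x0 powi (- m2 - 1)) = ?C * (x powi (- m1) * x0 powi m2)" for m1 m2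
      using pos' radii by (simp add: power_int_inverse power_int_diff power_int_add power_int_minus field_simps)
    have arg: "- (- m1 - 1 - int j) = m1 + 1 + int j" "- (int j - (- m2 - 1)) = - 1 - int j - m2" for m1 m2 j by auto
    have C0: "0 \<le> ?C" using C(1) pos' radii by auto
    show ?thesis
    proof (intro exI[of _ ?C] conjI allI C0)
      show "cmod (Q m1 m2) \<le> ?C * (x powi (- m1) * x0 powi m2)" for m1 m2
        using C(4)[of UNIV "- m1 - 1" "- m2 - 1"] unfolding scale half_conv_def arg Q_def .
      show "(\<lambda>j::nat. \<phi> (m1 + 1 + int j) * \<psi> (- 1 - int j - m2)) summable_on UNIV" for m1 m2
        using C(3)[of "- m1 - 1" "- m2 - 1" UNIV] unfolding arg .
      show "cmod (\<phi> (m1 + 1 + int j) * \<psi> (- 1 - int j - m2)) \<le> ?C * (x powi (- m1) * x0 powi m2) * (x0 / x1) ^ j" for m1 m2 j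
      proof -
        have "cmod (\<phi> (m1 + 1 + int j) * \<psi> (- 1 - int j - m2)) \<le> ?C * (x powi (- m1) * x0 powi m2) * (inverse x / inverse x0) ^ j"
          using C(2)[of "- m1 - 1" j "- m2 - 1"] unfolding scale arg .
        also have "\<dots> \<le> ?C * (x powi (- m1) * x0 powi m2) * (x0 / x1) ^ j"
          using C(1) C0 pos' radii x(2) by (intro mult_left_mono power_mono mult_nonneg_nonneg) (auto simp: field_simps)
        finally show ?thesis .
      qed
    qed
  qed
  obtain C1 where C1: "0 \<le> C1" "\<And>m1 m2. cmod (Q m1 m2) \<le> C1 * (x1 powi (- m1) * x0 powi m2)"
    "\<And>m1 m2 j. cmod (\<phi> (m1 + 1 + int j) * \<psi> (- 1 - int j - m2)) \<le> C1 * (x1 powi (- m1) * x0 powi m2) * (x0 / x1) ^ j"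
    "\<And>m1 m2. (\<lambda>j::nat. \<phi> (m1 + 1 + int j) * \<psi> (- 1 - int j - m2)) summable_on UNIV"
    using *[OF \<phi>(1)] by auto
  obtain C2 where C2: "0 \<le> C2" "\<And>m1 m2. cmod (Q m1 m2) \<le> C2 * (x2 powi (- m1) * x0 powi m2)"
    "\<And>m1 m2 j. cmod (\<phi> (m1 + 1 + int j) * \<psi> (- 1 - int j - m2)) \<le> C2 * (x2 powi (- m1) * x0 powi m2) * (x0 / x1) ^ j"
    using *[OF \<phi>(2)] pos by auto
  have max: "c * (e m1 * x0 powi m2) \<le> max C1 C2 * (e m1 * x0 powi m2)" if "c = C1 \<or> c = C2" for m1 m2 c
    using that e_pos[of m1] radii by (intro mult_right_mono) auto
  show thesis
  proof (rule that[of "max C1 C2"])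
    show "0 \<le> max C1 C2" using C1 by simp
    show "cmod (Q m1 m2) \<le> max C1 C2 * (e m1 * x0 powi m2)" for m1 m2
      using C1(2)[of m1 m2] C2(2)[of m1 m2] max[of C1 m1 m2] max[of C2 m1 m2]
      by (cases "m1 < 0") (auto simp: e_def)
    show "cmod (\<phi> (m1 + 1 + int j) * \<psi> (- 1 - int j - m2)) \<le> max C1 C2 * (e m1 * x0 powi m2) * (x0 / x1) ^ j" for m1 m2 j
    proof -
      have "cmod (\<phi> (m1 + 1 + int j) * \<psi> (- 1 - int j - m2)) \<le> (if m1 < 0 then C1 else C2) * (e m1 * x0 powi m2) * (x0 / x1) ^ j"
        using C1(3)[of m1 j m2] C2(3)[of m1 j m2] by (auto simp: e_def)
      also have "\<dots> \<le> max C1 C2 * (e m1 * x0 powi m2) * (x0 / x1) ^ j"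
        using max radii by (intro mult_right_mono[of _ _ "(x0 / x1) ^ j"]) auto
      finally show ?thesis .
    qed
  qed (rule C1(4))
qed

text \<open>The full convolution of the reciprocal symbols is the identity matrix; it is cut at
  index 0 into its nonnegative half \<open>P\<close> and its negative half \<open>Q\<close>.\<close>

lemma P_eq: "P m1 m2 = of_bool (m1 = m2) - Q m1 m2"
proof -
  let ?t = "\<lambda>n::int. \<phi> (m1 - n) * \<psi> (n - m2)"
  have "((\<lambda>k. \<phi> k * \<psi> ((m1 - m2) - k)) has_sum of_bool (m1 - m2 = 0)) UNIV" by (rule inverse)
  also have "?this \<longleftrightarrow> (?t has_sum of_bool (m1 - m2 = 0)) UNIV"
    by (rule has_sum_reindex_bij_witness[of _ "\<lambda>n. m1 - n" "\<lambda>n. m1 - n"]) (simp_all add: algebra_simps)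
  finally have t: "(?t has_sum of_bool (m1 = m2)) UNIV" by simp
  have s: "?t summable_on X" for X
    using has_sum_imp_summable[OF t] summable_on_subset_banach by blast
  have "infsum ?t ({0..} \<union> {..-1}) = infsum ?t {0..} + infsum ?t {..-1}"
    by (rule infsum_Un_disjoint) (auto intro: s)
  also have "{0..} \<union> {..-1} = (UNIV :: int set)" by auto
  also have "infsum ?t {0..} = P m1 m2"
    unfolding P_def half_conv_def by (rule infsum_reindex_bij_witness[of _ int nat]) auto
  also have "infsum ?t {..-1} = Q m1 m2"
    unfolding Q_def
    by (rule infsum_reindex_bij_witness[of _ "\<lambda>j. - int j - 1" "\<lambda>k. nat (- k - 1)"]) (auto simp: algebra_simps)
  finally show ?thesis using infsumI[OF t] by simp
qed

text \<open>Writing q^m = q^n' q^(m - n') shows that the (n, n') entry of the matrix is q^n' times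
  the coefficient of index n - n'.\<close>

lemma triangular_shift:
  assumes "n' \<le> n"
  shows "((\<lambda>m. \<omega> (n - m) * of_real (q powi m) * \<phi> (m - n')) has_sum 0) UNIV"
proof -
  have "((\<lambda>k. of_real (q powi n') * (\<omega> ((n - n') - k) * of_real (q powi k) * \<phi> k)) has_sum of_real (q powi n') * 0) UNIV"
    using assms by (intro has_sum_cmult_right triangular) auto
  also have "?this \<longleftrightarrow> ((\<lambda>m. \<omega> (n - m) * of_real (q powi m) * \<phi> (m - n')) has_sum 0) UNIV"
    using q by (intro has_sum_reindex_bij_witness[of _ "\<lambda>m. m - n'" "\<lambda>k. k + n'"])
       (auto simp: power_int_add algebra_simps)
  finally show ?thesis .
qed

text \<open>\<open>Q\<close> contains \<phi> only in the form \<phi>(m - n') with n' = -1 - j < 0,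
  so for n at least 0 every term vanishes by triangularity once the sums are exchanged. The exchange
  is paid for by the decay of p^m \<open>e m\<close>.\<close>

lemma \<omega>_q_Q: "0 \<le> n \<Longrightarrow> (\<Sum>\<^sub>\<infinity>m. \<omega> (n - m) * of_real (q powi m) * Q m m2) = 0"
proof -
  assume n: "0 \<le> n"
  obtain CQ where CQ: "0 \<le> CQ"
    "\<And>m1 m2 j. cmod (\<phi> (m1 + 1 + int j) * \<psi> (- 1 - int j - m2)) \<le> CQ * (e m1 * x0 powi m2) * (x0 / x1) ^ j"
    "\<And>m1 m2. (\<lambda>j::nat. \<phi> (m1 + 1 + int j) * \<psi> (- 1 - int j - m2)) summable_on UNIV"
    using Q_bound by metis
  obtain D where D: "0 \<le> D" "\<And>k. cmod (\<omega> k) \<le> D * R powi (- k)" using \<omega> unfolding decay_def by blast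
  let ?F = "\<lambda>m j. \<omega> (n - m) * of_real (q powi m) * (\<phi> (m + 1 + int j) * \<psi> (- 1 - int j - m2))"
  have F: "cmod (?F m j) \<le> (D * R powi (- n) * CQ * x0 powi m2 * \<tau> ^ nat \<bar>m\<bar>) * (x0 / x1) ^ j" for m j
  proof -
    have "cmod (?F m j) = cmod (\<omega> (n - m)) * q powi m * cmod (\<phi> (m + 1 + int j) * \<psi> (- 1 - int j - m2))"
      using q by (simp add: norm_mult norm_power_int)
    also have "\<dots> \<le> (D * R powi (- (n - m))) * q powi m * (CQ * (e m * x0 powi m2) * (x0 / x1) ^ j)"
      using D(1) D(2)[of "n - m"] CQ pos q by (intro mult_mono) auto
    also have "\<dots> = (D * R powi (- n) * CQ * x0 powi m2) * (p powi m * e m) * (x0 / x1) ^ j"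
      using pos by (simp add: p_def power_int_mult_distrib power_int_diff power_int_minus field_simps)
    also have "\<dots> \<le> (D * R powi (- n) * CQ * x0 powi m2) * \<tau> ^ nat \<bar>m\<bar> * (x0 / x1) ^ j"
      using D CQ pos radii e_p_le[of m] by (intro mult_right_mono mult_left_mono) auto
    finally show ?thesis .
  qed
  have "(\<Sum>\<^sub>\<infinity>m. \<omega> (n - m) * of_real (q powi m) * Q m m2) = (\<Sum>\<^sub>\<infinity>m. \<Sum>\<^sub>\<infinity>j. ?F m j)"
    unfolding Q_def using CQ(3) by (subst infsum_cmult_right) auto
  also have "\<dots> = (\<Sum>\<^sub>\<infinity>j. \<Sum>\<^sub>\<infinity>m. ?F m j)"
  proof (rule infsum_swap_dominated[OF _ _ _ _ F])
    show "(\<lambda>j::nat. (x0 / x1) ^ j) summable_on UNIV"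
      using radii by (intro summable_nonneg_imp_summable_on) auto
  qed (use summable_\<tau> D CQ pos radii \<tau> in auto)
  also have "\<dots> = (\<Sum>\<^sub>\<infinity>j::nat. 0)"
  proof (rule infsum_cong)
    fix j :: nat
    have "((\<lambda>m. \<psi> (- 1 - int j - m2) * (\<omega> (n - m) * of_real (q powi m) * \<phi> (m - (- 1 - int j)))) has_sum
        \<psi> (- 1 - int j - m2) * 0) UNIV"
      using n by (intro has_sum_cmult_right triangular_shift) auto
    then show "(\<Sum>\<^sub>\<infinity>m. ?F m j) = 0" by (intro infsumI) (simp add: algebra_simps)
  qed
  finally show ?thesis by simp
qed

text \<open>This is L' q^m (1 + L) = 0: the projection inside \<open>PR\<close> leaves only rows n
  at least 0 of the second symbol, and each of them annihilates q^m \<open>Q\<close>.\<close>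

lemma PR_q_Q:
  shows "(\<lambda>m. PR m1 m * of_real (q powi m) * Q m m2) summable_on UNIV"
    and "(\<Sum>\<^sub>\<infinity>m. PR m1 m * of_real (q powi m) * Q m m2) = 0"
proof -
  obtain CQ where CQ: "0 \<le> CQ" "\<And>m1 m2. cmod (Q m1 m2) \<le> CQ * (e m1 * x0 powi m2)"
    using Q_bound by metis
  obtain C where C: "0 \<le> C"
    "\<And>m1 m2 n. cmod (\<phi> (m1 - int n) * \<omega> (int n - m2)) \<le> C * (x2 powi (- m1) * R powi m2) * (x2 / R) ^ n"
    "\<And>m1 m2 X. (\<lambda>n. \<phi> (m1 - int n) * \<omega> (int n - m2)) summable_on X"
    "\<And>m1 m2 X. cmod (half_conv \<phi> \<omega> X m1 m2) \<le> C * (x2 powi (- m1) * R powi m2)"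
    by (rule half_conv_bound[OF \<phi>(2) \<omega> pos(3) pos(7)]) (rule that; blast)
  let ?F = "\<lambda>m n. \<phi> (m1 - int n) * \<omega> (int n - m) * (of_real (q powi m) * Q m m2)"
  let ?K = "C * x2 powi (- m1) * CQ * x0 powi m2"
  have K: "0 \<le> ?K" using C CQ pos radii by auto
  have qQ: "cmod (of_real (q powi m) * Q m m2) \<le> q powi m * (CQ * (e m * x0 powi m2))" for m
    unfolding norm_mult norm_of_real using CQ q by (intro mult_mono) auto
  have F: "cmod (?F m n) \<le> (?K * \<tau> ^ nat \<bar>m\<bar>) * (x2 / R) ^ n" for m n
  proof -
    have "cmod (?F m n) \<le> (C * (x2 powi (- m1) * R powi m) * (x2 / R) ^ n) * (q powi m * (CQ * (e m * x0 powi m2)))"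
      unfolding norm_mult[of "_ * _" "_ * _"] using C qQ pos by (intro mult_mono) auto
    also have "\<dots> = ?K * (p powi m * e m) * (x2 / R) ^ n"
      by (simp add: p_def power_int_mult_distrib)
    also have "\<dots> \<le> ?K * \<tau> ^ nat \<bar>m\<bar> * (x2 / R) ^ n"
      using K pos e_p_le[of m] by (intro mult_right_mono mult_left_mono) auto
    finally show ?thesis .
  qed
  have "cmod (PR m1 m * of_real (q powi m) * Q m m2) \<le> ?K * \<tau> ^ nat \<bar>m\<bar>" for m
  proof -
    have "cmod (PR m1 m * (of_real (q powi m) * Q m m2)) \<le>
        (C * (x2 powi (- m1) * R powi m)) * (q powi m * (CQ * (e m * x0 powi m2)))"
      unfolding norm_mult[of "PR m1 m"] unfolding PR_def using C qQ pos by (intro mult_mono) auto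
    also have "\<dots> = ?K * (p powi m * e m)" by (simp add: p_def power_int_mult_distrib)
    also have "\<dots> \<le> ?K * \<tau> ^ nat \<bar>m\<bar>" by (rule mult_left_mono[OF e_p_le K])
    finally show ?thesis by (simp only: mult.assoc)
  qed
  then show "(\<lambda>m. PR m1 m * of_real (q powi m) * Q m m2) summable_on UNIV"
    by (rule summable_on_dominated[OF summable_\<tau>])
  have "(\<Sum>\<^sub>\<infinity>m. PR m1 m * of_real (q powi m) * Q m m2) = (\<Sum>\<^sub>\<infinity>m. \<Sum>\<^sub>\<infinity>n. ?F m n)"
    unfolding PR_def half_conv_def mult.assoc[of "infsum _ _"]
    by (rule infsum_cong, rule infsum_cmult_left[symmetric]) (rule C(3))
  also have "\<dots> = (\<Sum>\<^sub>\<infinity>n. \<Sum>\<^sub>\<infinity>m. ?F m n)"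
  proof (rule infsum_swap_dominated[OF _ _ _ _ F])
    show "(\<lambda>j::nat. (x2 / R) ^ j) summable_on UNIV"
      using pos by (intro summable_nonneg_imp_summable_on) auto
  qed (use summable_\<tau> K pos \<tau> in auto)
  also have "\<dots> = (\<Sum>\<^sub>\<infinity>n::nat. 0)"
  proof (rule infsum_cong)
    fix n :: nat
    have "(\<Sum>\<^sub>\<infinity>m. ?F m n) = \<phi> (m1 - int n) * (\<Sum>\<^sub>\<infinity>m. \<omega> (int n - m) * of_real (q powi m) * Q m m2)"
      by (subst infsum_cmult_right'[symmetric]) (simp add: mult_ac)
    then show "(\<Sum>\<^sub>\<infinity>m. ?F m n) = 0" using \<omega>_q_Q[of "int n" m2] by simp
  qed
  finally show "(\<Sum>\<^sub>\<infinity>m. PR m1 m * of_real (q powi m) * Q m m2) = 0" by simp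
qed

lemma PR_q_P: "(\<Sum>\<^sub>\<infinity>m. PR m1 m * of_real (q powi m) * P m m2) = PR m1 m2 * of_real (q powi m2)"
proof -
  have "((\<lambda>m. PR m1 m * of_real (q powi m) * of_bool (m = m2)) has_sum PR m1 m2 * of_real (q powi m2)) UNIV"
    by (rule has_sum_finite_neutralI[of "{m2}"]) auto
  moreover have "((\<lambda>m. - (PR m1 m * of_real (q powi m) * Q m m2)) has_sum - 0) UNIV"
    using has_sum_infsum[OF PR_q_Q(1)[of m1 m2]] unfolding PR_q_Q(2) by (rule has_sum_uminusI)
  ultimately have "((\<lambda>m. PR m1 m * of_real (q powi m) * of_bool (m = m2) + - (PR m1 m * of_real (q powi m) * Q m m2))
      has_sum PR m1 m2 * of_real (q powi m2) + - 0) UNIV" by (rule has_sum_add)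
  then show ?thesis
    by (intro infsumI) (simp add: P_eq right_diff_distrib)
qed

text \<open>The sign is positive because L' = - PR, so that this is - f L' (1 + s q^m) for
  \<open>X = UNIV\<close>; correspondingly \<open>B\<close> is f L.\<close>

definition A where "A X m1 m2 = of_real (mult m1) * half_conv \<phi> \<omega> X m1 m2 * of_real (1 + s * q powi m2)"
definition B where "B m1 m2 = - (of_real (mult m1) * P m1 m2)"

lemma A_bound: obtains C where "0 \<le> C" "\<And>X m1 m2. cmod (A X m1 m2) \<le> C * (\<alpha> m1 * \<beta> m2)"
proof -
  obtain C where C: "0 \<le> C" "\<And>X m1 m2. cmod (half_conv \<phi> \<omega> X m1 m2) \<le> C * (e m1 * R powi m2)"
    using PR_bound by metis
  have "cmod (A X m1 m2) \<le> C * (\<alpha> m1 * \<beta> m2)" for X m1 m2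
  proof -
    have "cmod (A X m1 m2) = mult m1 * cmod (half_conv \<phi> \<omega> X m1 m2) * (1 + s * q powi m2)"
      unfolding A_def norm_mult norm_of_real using mult_pos[of m1] one_plus(2)[of m2] by simp
    also have "\<dots> \<le> mult m1 * (C * (e m1 * R powi m2)) * (1 + s * q powi m2)"
      using mult_pos[of m1] one_plus(2)[of m2] C(2)[of X m1 m2] by (intro mult_right_mono mult_left_mono) auto
    also have "\<dots> = C * (\<alpha> m1 * \<beta> m2)" by (simp add: \<alpha>_def \<beta>_def)
    finally show ?thesis .
  qed
  with C(1) show thesis by (rule that)
qed

lemma B_bound: obtains C where "0 \<le> C" "\<And>m1 m2. cmod (B m1 m2) \<le> C * (\<alpha> m1 * \<beta> m2)"
proof -
  obtain C where C: "0 \<le> C" "\<And>m1 m2. cmod (P m1 m2) \<le> C * (e m1 * \<beta> m2)" using P_bound by metis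
  have "cmod (B m1 m2) \<le> C * (\<alpha> m1 * \<beta> m2)" for m1 m2
  proof -
    have "cmod (B m1 m2) = mult m1 * cmod (P m1 m2)"
      unfolding B_def norm_minus_cancel norm_mult norm_of_real using mult_pos[of m1] by simp
    also have "\<dots> \<le> mult m1 * (C * (e m1 * \<beta> m2))"
      using mult_pos[of m1] C(2)[of m1 m2] by (intro mult_left_mono) auto
    also have "\<dots> = C * (\<alpha> m1 * \<beta> m2)" by (simp add: \<alpha>_def)
    finally show ?thesis .
  qed
  with C(1) show thesis by (rule that)
qed

text \<open>\<open>A {k}\<close> is the rank-one kernel \<open>?X k\<close> times
  \<open>?Y k\<close>. As 1 + s q^m cancels the denominator of \<open>mult\<close>, the pairing of
  \<open>?Y k\<close> with \<open>?X n\<close> is s times an entry of the triangular matrix and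
  vanishes for n at most k. The case n < k kills the product of \<open>A {k}\<close> with
  \<open>A {..<k}\<close>, so determinants multiply; the case n = k makes the trace of the new
  factor zero.\<close>

lemma fredholm_det_A_partial: "fredholm_det (A {..<k}) = 1"
proof (induction k)
  case 0
  have "A {..<0::nat} = (\<lambda>x y. 0 * 0)" by (simp add: A_def half_conv_def fun_eq_iff)
  then show ?case using fredholm_det_rank_one[of "\<lambda>_. 0" "\<lambda>_. 0"] by simp
next
  case (Suc k)
  let ?X = "\<lambda>n m. of_real (mult m) * \<phi> (m - int n)"
  let ?Y = "\<lambda>n m. \<omega> (int n - m) * of_real (1 + s * q powi m)"
  have A: "A S m1 m2 = (\<Sum>n\<in>S. ?X n m1 * ?Y n m2)" if "finite S" for S m1 m2
    using that by (simp add: A_def half_conv_def sum_distrib_left sum_distrib_right mult_ac)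
  have YX: "((\<lambda>m. ?Y k m * ?X n m) has_sum 0) UNIV" if "n \<le> k" for n
  proof -
    have "((\<lambda>m. of_real s * (\<omega> (int k - m) * of_real (q powi m) * \<phi> (m - int n))) has_sum of_real s * 0) UNIV"
      using that by (intro has_sum_cmult_right triangular_shift) auto
    moreover have "of_real s * (\<omega> (int k - m) * of_real (q powi m) * \<phi> (m - int n)) = ?Y k m * ?X n m" for m
    proof -
      have "complex_of_real (1 + s * q powi m) * of_real (mult m) = of_real s * of_real (q powi m)"
        unfolding of_real_mult[symmetric] one_plus(1) ..
      moreover have "?Y k m * ?X n m =
          \<omega> (int k - m) * (complex_of_real (1 + s * q powi m) * of_real (mult m)) * \<phi> (m - int n)"
        by (simp only: mult_ac)
      ultimately show ?thesis by (simp only: mult_ac)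
    qed
    ultimately show ?thesis by (simp only: mult_zero_right)
  qed
  obtain C where C: "0 \<le> C" "\<And>X m1 m2. cmod (A X m1 m2) \<le> C * (\<alpha> m1 * \<beta> m2)" using A_bound by metis
  have prod: "(\<Sum>\<^sub>\<infinity>m. A {k} x m * A {..<k} m y) = 0" for x y
  proof -
    have "((\<lambda>m. \<Sum>n<k. ?X k x * ?Y n y * (?Y k m * ?X n m)) has_sum 0) UNIV"
    proof (rule has_sum_sum_zero)
      fix n assume "n < k"
      then have "((\<lambda>m. ?X k x * ?Y n y * (?Y k m * ?X n m)) has_sum ?X k x * ?Y n y * 0) UNIV"
        by (intro has_sum_cmult_right YX) auto
      then show "((\<lambda>m. ?X k x * ?Y n y * (?Y k m * ?X n m)) has_sum 0) UNIV" by simp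
    qed
    then show ?thesis
      by (intro infsumI) (simp add: A sum_distrib_left mult_ac)
  qed
  have "fredholm_det (A {..<Suc k}) = fredholm_det (\<lambda>x y. A {k} x y + A {..<k} x y + (\<Sum>\<^sub>\<infinity>m. A {k} x m * A {..<k} m y))"
    unfolding prod by (rule arg_cong[where f = fredholm_det]) (simp add: A fun_eq_iff add.commute)
  also have "\<dots> = fredholm_det (A {k}) * fredholm_det (A {..<k})"
    by (rule fredholm_det_mult[OF weight(1,2) \<tau> weight(3) C(2) C(2) C(1) C(1)])
  also have "fredholm_det (A {k}) = fredholm_det (\<lambda>x y. ?X k x * ?Y k y)"
    by (rule arg_cong[where f = fredholm_det]) (simp add: A fun_eq_iff)
  also have "\<dots> = 1 + (\<Sum>\<^sub>\<infinity>m. ?X k m * ?Y k m)" by (rule fredholm_det_rank_one)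
  also have "(\<Sum>\<^sub>\<infinity>m. ?X k m * ?Y k m) = 0" using infsumI[OF YX[of k]] by (simp add: mult_ac)
  finally show ?case using Suc.IH by simp
qed

text \<open>The bound on \<open>A X\<close> is uniform in \<open>X\<close>, so the truncations
  converge under a single majorant.\<close>

lemma fredholm_det_A: "fredholm_det (A UNIV) = 1"
proof -
  obtain C where C: "0 \<le> C" "\<And>X m1 m2. cmod (A X m1 m2) \<le> C * (\<alpha> m1 * \<beta> m2)" using A_bound by metis
  have "(\<lambda>k. fredholm_det (A {..<k})) \<longlonglongrightarrow> fredholm_det (A UNIV)"
  proof (rule tendsto_fredholm_det[OF weight(1,2) \<tau> weight(3) C(2) C(1)])
    fix x y
    have "(\<lambda>n. \<phi> (x - int n) * \<omega> (int n - y)) summable_on UNIV"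
      using half_conv_bound[OF \<phi>(2) \<omega> pos(3) pos(7)] by metis
    from has_sum_imp_sums[OF has_sum_infsum[OF this]]
    have "(\<lambda>k. half_conv \<phi> \<omega> {..<k} x y) \<longlonglongrightarrow> half_conv \<phi> \<omega> UNIV x y"
      by (simp add: sums_def half_conv_def)
    then show "(\<lambda>k. A {..<k} x y) \<longlonglongrightarrow> A UNIV x y" unfolding A_def by (intro tendsto_intros)
  qed
  then show ?thesis by (simp add: fredholm_det_A_partial LIMSEQ_const_iff)
qed

theorem fredholm_det_eq:
  "fredholm_det (\<lambda>m1 m2. - (of_real (mult m1) * (P m1 m2 - PR m1 m2))) =
   fredholm_det (\<lambda>m1 m2. - (of_real (mult m1) * P m1 m2))"
proof -
  obtain C where C: "0 \<le> C" "\<And>X m1 m2. cmod (A X m1 m2) \<le> C * (\<alpha> m1 * \<beta> m2)" using A_bound by metis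
  obtain D where D: "0 \<le> D" "\<And>m1 m2. cmod (B m1 m2) \<le> D * (\<alpha> m1 * \<beta> m2)" using B_bound by metis
  have AB: "(\<Sum>\<^sub>\<infinity>m. A UNIV m1 m * B m m2) = - (of_real (mult m1 * s * q powi m2) * PR m1 m2)" for m1 m2
  proof -
    have "A UNIV m1 m * B m m2 = - of_real (mult m1 * s) * (PR m1 m * of_real (q powi m) * P m m2)" for m
    proof -
      have "complex_of_real (1 + s * q powi m) * of_real (mult m) = of_real s * of_real (q powi m)"
        unfolding of_real_mult[symmetric] one_plus(1) ..
      then have "A UNIV m1 m * B m m2 = - of_real (mult m1) * PR m1 m * (of_real s * of_real (q powi m)) * P m m2"
        unfolding A_def B_def PR_def[symmetric] by (simp add: mult_ac)
      then show ?thesis by simp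
    qed
    then have "(\<Sum>\<^sub>\<infinity>m. A UNIV m1 m * B m m2) =
        (\<Sum>\<^sub>\<infinity>m. - of_real (mult m1 * s) * (PR m1 m * of_real (q powi m) * P m m2))" by (simp only:)
    also have "\<dots> = - of_real (mult m1 * s) * (\<Sum>\<^sub>\<infinity>m. PR m1 m * of_real (q powi m) * P m m2)"
      by (rule infsum_cmult_right')
    finally have "(\<Sum>\<^sub>\<infinity>m. A UNIV m1 m * B m m2) = - of_real (mult m1 * s) * (\<Sum>\<^sub>\<infinity>m. PR m1 m * of_real (q powi m) * P m m2)" .
    then show ?thesis unfolding PR_q_P by simp
  qed
  \<comment> \<open>\<open>A UNIV\<close> equals f PR + s f PR q^m, and its second summand is
    cancelled by the product computed in \<open>AB\<close>.\<close>
  have "(\<lambda>m1 m2. - (of_real (mult m1) * (P m1 m2 - PR m1 m2))) =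
      (\<lambda>m1 m2. A UNIV m1 m2 + B m1 m2 + (\<Sum>\<^sub>\<infinity>m. A UNIV m1 m * B m m2))"
    unfolding AB by (simp add: fun_eq_iff A_def B_def PR_def[symmetric] algebra_simps)
  then have "fredholm_det (\<lambda>m1 m2. - (of_real (mult m1) * (P m1 m2 - PR m1 m2))) =
      fredholm_det (A UNIV) * fredholm_det B"
    using fredholm_det_mult[OF weight(1,2) \<tau> weight(3) C(2) D(2) C(1) D(1)] by simp
  then show ?thesis unfolding fredholm_det_A by (simp add: B_def[abs_def])
qed

end

section \<open>q-Pochhammer symbols and contour deformation\<close>

lemma convergent_prod_qpoch:
  assumes "0 < q" "q < 1"
  shows "convergent_prod (\<lambda>j. 1 - x * complex_of_real (q ^ j))"
proof (rule abs_convergent_prod_imp_convergent_prod, rule summable_imp_abs_convergent_prod)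
  have "summable (\<lambda>j. cmod x * q ^ j)" using assms by (intro summable_mult summable_geometric) auto
  then show "summable (\<lambda>j. norm (1 - x * complex_of_real (q ^ j) - 1))"
    using assms by (simp add: norm_mult norm_power)
qed

lemma qpoch_LIMSEQ:
  assumes "0 < q" "q < 1"
  shows "(\<lambda>n. \<Prod>j<n. 1 - x * complex_of_real (q ^ j)) \<longlonglongrightarrow> qpoch x q"
  using convergent_prod_LIMSEQ[OF convergent_prod_qpoch[OF assms, of x]]
  unfolding qpoch_def lessThan_Suc_atMost[symmetric] by (subst (asm) filterlim_sequentially_Suc)

lemma qpoch_nonzero:
  assumes "0 < q" "q < 1" "\<And>j. x * complex_of_real (q ^ j) \<noteq> 1"
  shows "qpoch x q \<noteq> 0"
  unfolding qpoch_def using assms(3)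
  by (intro prodinf_nonzero convergent_prod_qpoch[OF assms(1,2)]) (metis right_minus_eq)

lemma qpoch_nonzero_small:
  assumes "0 < q" "q < 1" "cmod x < 1"
  shows "qpoch x q \<noteq> 0"
proof (rule qpoch_nonzero[OF assms(1,2)])
  fix j
  have "cmod (x * complex_of_real (q ^ j)) \<le> cmod x * 1"
    unfolding norm_mult norm_of_real using assms by (intro mult_left_mono) (auto simp: power_le_one)
  with assms(3) show "x * complex_of_real (q ^ j) \<noteq> 1" by auto
qed

lemma qpoch_rec:
  assumes "0 < q" "q < 1"
  shows "qpoch x q = (1 - x) * qpoch (of_real q * x) q"
proof (rule LIMSEQ_unique)
  show "(\<lambda>n. \<Prod>j<Suc n. 1 - x * complex_of_real (q ^ j)) \<longlonglongrightarrow> qpoch x q"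
    by (rule LIMSEQ_Suc[OF qpoch_LIMSEQ[OF assms]])
  have "(\<lambda>n. (1 - x) * (\<Prod>j<n. 1 - of_real q * x * complex_of_real (q ^ j))) \<longlonglongrightarrow> (1 - x) * qpoch (of_real q * x) q"
    by (intro tendsto_mult tendsto_const qpoch_LIMSEQ[OF assms])
  then show "(\<lambda>n. \<Prod>j<Suc n. 1 - x * complex_of_real (q ^ j)) \<longlonglongrightarrow> (1 - x) * qpoch (of_real q * x) q"
    by (simp only: prod.lessThan_Suc_shift) (simp add: mult_ac)
qed

lemma holomorphic_qpoch:
  assumes "0 < q" "q < 1"
  shows "(\<lambda>x. qpoch x q) holomorphic_on UNIV"
proof (rule holomorphic_uniform_sequence)
  let ?P = "\<lambda>n x. \<Prod>j<n. 1 - x * complex_of_real (q ^ j)"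
  show "?P n holomorphic_on UNIV" for n by (intro holomorphic_intros)
  fix z :: complex
  have "uniformly_convergent_on (cball z 1) (\<lambda>n x. \<Sum>j<n. norm (1 - x * complex_of_real (q ^ j) - 1))"
  proof (rule Weierstrass_m_test')
    show "norm (norm (1 - x * complex_of_real (q ^ j) - 1)) \<le> (cmod z + 1) * q ^ j" if "x \<in> cball z 1" for j x
    proof -
      have "cmod x \<le> cmod z + 1"
        using that norm_triangle_sub[of x z] by (simp add: dist_norm norm_minus_commute)
      then show ?thesis using assms by (simp add: norm_mult norm_power)
    qed
    show "summable (\<lambda>j. (cmod z + 1) * q ^ j)"
      using assms by (intro summable_mult summable_geometric) auto
  qed
  then have "uniformly_convergent_on (cball z 1) ?P"
    by (intro uniformly_convergent_on_prod') (auto intro!: continuous_intros)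
  then obtain l where l: "uniform_limit (cball z 1) ?P l sequentially"
    by (auto simp: uniformly_convergent_on_def)
  have "l x = qpoch x q" if "x \<in> cball z 1" for x
    using tendsto_uniform_limitI[OF l that] qpoch_LIMSEQ[OF assms] LIMSEQ_unique by blast
  then have "uniform_limit (cball z 1) ?P (\<lambda>x. qpoch x q) sequentially"
    using l by (subst uniform_limit_cong'[where g = ?P and i = l]) auto
  then show "\<exists>d>0. cball z d \<subseteq> UNIV \<and> uniform_limit (cball z d) ?P (\<lambda>x. qpoch x q) sequentially"
    by (intro exI[of _ 1]) auto
qed auto

lemma holomorphic_on_qpoch [holomorphic_intros]:
  assumes "0 < q" "q < 1" "f holomorphic_on S"
  shows "(\<lambda>z. qpoch (f z) q) holomorphic_on S"
  using holomorphic_on_compose[OF assms(3) holomorphic_on_subset[OF holomorphic_qpoch[OF assms(1,2)]]]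
  by (simp add: o_def)

text \<open>There may be infinitely many singularities, but they are locally finite, so the residue
  theorem is applied in a large ball. Stating it for all large \<open>M\<close> lets several
  contours share one ball.\<close>

lemma eventually_contour_integral_eq_residues:
  assumes P: "\<And>M. finite (P \<inter> ball 0 M)" and f: "f holomorphic_on - P"
    and \<gamma>: "valid_path \<gamma>" "pathfinish \<gamma> = pathstart \<gamma>" "path_image \<gamma> \<inter> P = {}"
  shows "\<forall>\<^sub>F M in at_top. contour_integral \<gamma> f =
    2 * pi * \<i> * (\<Sum>p\<in>P \<inter> ball 0 M. winding_number \<gamma> p * residue f p)"
proof -
  have "bounded (path_image \<gamma>)" using \<gamma>(1) by (intro compact_imp_bounded compact_valid_path_image)
  then obtain M0 where M0: "\<And>x. x \<in> path_image \<gamma> \<Longrightarrow> cmod x < M0"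
    by (meson bounded_pos_less)
  show ?thesis
    using eventually_ge_at_top[of M0]
  proof eventually_elim
    case (elim M)
    have sub: "path_image \<gamma> \<subseteq> ball 0 M" using M0 elim by force
    show ?case
    proof (rule Residue_theorem[of "ball 0 M"])
      show "f holomorphic_on ball 0 M - P \<inter> ball 0 M"
        by (rule holomorphic_on_subset[OF f]) auto
      show "path_image \<gamma> \<subseteq> ball 0 M - P \<inter> ball 0 M" using sub \<gamma>(3) by auto
      show "\<forall>z. z \<notin> ball 0 M \<longrightarrow> winding_number \<gamma> z = 0"
        using winding_number_zero_outside[OF valid_path_imp_path[OF \<gamma>(1)], of "ball 0 M"] \<gamma>(2) sub by auto
    qed (use P \<gamma> in auto)
  qed
qed

lemma contour_integral_eq_if_winding_numbers:
  assumes P: "\<And>M. finite (P \<inter> ball 0 M)" and f: "f holomorphic_on - P"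
    and \<gamma>: "valid_path \<gamma>" "pathfinish \<gamma> = pathstart \<gamma>" "path_image \<gamma> \<inter> P = {}"
    and \<gamma>1: "valid_path \<gamma>1" "pathfinish \<gamma>1 = pathstart \<gamma>1" "path_image \<gamma>1 \<inter> P = {}"
    and w: "\<And>p. p \<in> P \<Longrightarrow> winding_number \<gamma> p = winding_number \<gamma>1 p"
  shows "contour_integral \<gamma> f = contour_integral \<gamma>1 f"
proof -
  have "\<forall>\<^sub>F M::real in at_top. contour_integral \<gamma> f = contour_integral \<gamma>1 f"
    using eventually_contour_integral_eq_residues[OF P f \<gamma>]
      eventually_contour_integral_eq_residues[OF P f \<gamma>1]
    by eventually_elim (simp add: w)
  then show ?thesis by (simp add: eventually_const)
qed

text \<open>The contours enter only through their winding numbers about the singularities. The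
  residues are common to all of them, so they need not be computed and may belong to essential
  singularities.\<close>

lemma contour_integral_diff_if_winding_numbers:
  assumes P: "\<And>M. finite (P \<inter> ball 0 M)" and f: "f holomorphic_on - P"
    and \<gamma>: "valid_path \<gamma>" "pathfinish \<gamma> = pathstart \<gamma>" "path_image \<gamma> \<inter> P = {}"
    and \<gamma>1: "valid_path \<gamma>1" "pathfinish \<gamma>1 = pathstart \<gamma>1" "path_image \<gamma>1 \<inter> P = {}"
    and \<gamma>2: "valid_path \<gamma>2" "pathfinish \<gamma>2 = pathstart \<gamma>2" "path_image \<gamma>2 \<inter> P = {}"
    and w: "\<And>p. p \<in> P \<Longrightarrow> winding_number \<gamma> p = winding_number \<gamma>1 p - winding_number \<gamma>2 p"
  shows "contour_integral \<gamma> f = contour_integral \<gamma>1 f - contour_integral \<gamma>2 f"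
proof -
  have "\<forall>\<^sub>F M::real in at_top. contour_integral \<gamma> f = contour_integral \<gamma>1 f - contour_integral \<gamma>2 f"
    using eventually_contour_integral_eq_residues[OF P f \<gamma>]
      eventually_contour_integral_eq_residues[OF P f \<gamma>1]
      eventually_contour_integral_eq_residues[OF P f \<gamma>2]
    by eventually_elim (simp add: w left_diff_distrib sum_subtractf right_diff_distrib)
  then show ?thesis by (simp add: eventually_const)
qed

section \<open>Winding numbers of circles and special Laurent coefficients\<close>

lemma winding_number_circlepath_inside: "cmod p < \<rho> \<Longrightarrow> winding_number (circlepath 0 \<rho>) p = 1"
  by (rule winding_number_circlepath) simp

lemma winding_number_circlepath_outside:
  assumes "0 < \<rho>" "\<rho> < cmod p"
  shows "winding_number (circlepath 0 \<rho>) p = 0"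
  by (rule winding_number_zero_outside[of _ "cball 0 \<rho>"]) (use assms in auto)

lemma lc_one: "0 < \<rho> \<Longrightarrow> lc (\<lambda>_. 1) \<rho> n = of_bool (n = 0)"
proof (cases "n = 0")
  case True
  then show "0 < \<rho> \<Longrightarrow> lc (\<lambda>_. 1) \<rho> n = of_bool (n = 0)"
    using contour_integral_circlepath[of \<rho> 0] by (simp add: lc_def field_simps)
next
  case False
  assume \<rho>: "0 < \<rho>"
  have "((\<lambda>z. z powi (- n - 1)) has_contour_integral 0) (circlepath 0 \<rho>)"
  proof (rule Cauchy_theorem_primitive[where S = "- {0}" and f = "\<lambda>z. z powi (- n) / of_int (- n)"])
    show "((\<lambda>z. z powi (- n) / of_int (- n)) has_field_derivative x powi (- n - 1)) (at x within - {0})"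
      if "x \<in> - {0}" for x :: complex
      using that False by (auto intro!: derivative_eq_intros)
  qed (use \<rho> in auto)
  then show ?thesis using False by (simp add: lc_def contour_integral_unique)
qed

lemma lc_cong: "0 < \<rho> \<Longrightarrow> (\<And>z. cmod z = \<rho> \<Longrightarrow> f z = g z) \<Longrightarrow> lc f \<rho> k = lc g \<rho> k"
  unfolding lc_def by (intro arg_cong[where f = "\<lambda>x. x / _"] contour_integral_eq) auto

text \<open>The circle may be pushed to infinity. There the Cauchy estimate is at most |C|/\<rho>'
  times a nonpositive power of \<rho>', and this tends to 0.\<close>

lemma lc_eq_0_if_decay:
  assumes h: "h holomorphic_on {z. r1 < cmod z}" and r: "0 \<le> r1" "r1 < \<rho>" and "0 \<le> n"
    and bound: "\<And>z. M \<le> cmod z \<Longrightarrow> cmod (h z) \<le> C / cmod z"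
  shows "lc h \<rho> n = 0"
proof -
  have "cmod (lc h \<rho> n) \<le> \<bar>C\<bar> / \<rho>'" if \<rho>': "\<rho>' \<ge> max (max 1 M) (\<rho> + 1)" for \<rho>'
  proof -
    have "lc h \<rho> n = lc h \<rho>' n"
    proof (rule lc_annulus)
      show "h holomorphic_on annulus r1 (\<rho>' + 1)"
        by (rule holomorphic_on_subset[OF h]) (auto simp: annulus_def)
    qed (use r \<rho>' in auto)
    also have "cmod \<dots> \<le> (\<bar>C\<bar> / \<rho>') * \<rho>' powi (- n)"
    proof (rule norm_lc_le)
      show "continuous_on (sphere 0 \<rho>') h"
        by (rule holomorphic_on_imp_continuous_on, rule holomorphic_on_subset[OF h]) (use r \<rho>' in auto)
      show "cmod (h z) \<le> \<bar>C\<bar> / \<rho>'" if "cmod z = \<rho>'" for z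
      proof -
        have "cmod (h z) \<le> C / \<rho>'" using bound[of z] that \<rho>' by auto
        also have "\<dots> \<le> \<bar>C\<bar> / \<rho>'" using \<rho>' by (intro divide_right_mono) auto
        finally show ?thesis .
      qed
    qed (use \<rho>' in auto)
    also have "\<dots> \<le> (\<bar>C\<bar> / \<rho>') * 1"
      using \<rho>' \<open>0 \<le> n\<close> by (intro mult_left_mono) (auto simp: power_int_minus inverse_le_1_iff)
    finally show ?thesis by simp
  qed
  then have ev: "\<forall>\<^sub>F \<rho>' in at_top. cmod (lc h \<rho> n) \<le> \<bar>C\<bar> / \<rho>'"
    unfolding eventually_at_top_linorder by blast
  have "((\<lambda>\<rho>'. \<bar>C\<bar> / \<rho>') \<longlongrightarrow> 0) at_top"
    by (intro tendsto_divide_0[OF tendsto_const]) (auto simp: filterlim_at_top_imp_at_infinity filterlim_ident)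
  from tendsto_lowerbound[OF this ev] show ?thesis by simp
qed

text \<open>The bound \<open>ratio\<close> makes the annulus between 1/amin and 1/(q amax) nonempty,
  which separates the poles with j = 0 from those with j at least 1. The bound \<open>ab\<close>
  makes room for the annulus between bmax and 1/amax, on which the two symbols are
  reciprocal.\<close>

locale q_symbol =
  fixes N :: nat and q :: real and a b :: "nat \<Rightarrow> real" and amin amax bmax :: real
  assumes N: "1 \<le> N" and q: "0 < q" "q < 1"
    and a: "0 < amin" "\<And>i. i \<in> {1..N} \<Longrightarrow> amin \<le> a i" "\<And>i. i \<in> {1..N} \<Longrightarrow> a i \<le> amax"
    and ratio: "q * amax < amin"
    and b: "0 < bmax" "\<And>j. j \<in> {1..N} \<Longrightarrow> 0 < b j" "\<And>j. j \<in> {1..N} \<Longrightarrow> b j \<le> bmax"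
    and ab: "amax * bmax < 1"
begin

definition \<Phi> :: "complex \<Rightarrow> complex" where
  "\<Phi> z = (\<Prod>i\<in>{1..N}. qpoch (of_real (a i) * z) q) / (\<Prod>j\<in>{1..N}. qpoch (of_real (b j) / z) q)"

definition \<Psi> :: "complex \<Rightarrow> complex" where
  "\<Psi> w = (\<Prod>j\<in>{1..N}. qpoch (of_real (b j) / w) q) / (\<Prod>i\<in>{1..N}. qpoch (of_real (a i) * w) q)"

definition poles :: "complex set" where
  "poles = {1 / complex_of_real (a i * q ^ j) | i j. i \<in> {1..N}}"

text \<open>Closed form of \<Phi>(q z) \<Psi>(z). Its nonzero poles 1/a_i and b_j/q all lie in a
  bounded disk, so it continues to the whole exterior, whereas \<Psi> has poles going to
  infinity.\<close>

definition H :: "complex \<Rightarrow> complex" where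
  "H z = (\<Prod>i\<in>{1..N}. 1 / (1 - of_real (a i) * z)) * (\<Prod>j\<in>{1..N}. 1 / (1 - of_real (b j) / (of_real q * z)))"

lemma a_pos: "i \<in> {1..N} \<Longrightarrow> 0 < a i" using a by fastforce

lemma amax_pos: "0 < amax" using a(1) a(2)[of 1] a(3)[of 1] N by auto

lemma amin_le_amax: "amin \<le> amax" using a(2)[of 1] a(3)[of 1] N by auto

lemma gfun_eq:
  "gfun N q a b z w m1 m2 = (w powi m2 / z powi m1) * (w / (z - w)) * (\<Phi> z * \<Psi> w)"
  by (simp add: gfun_def \<Phi>_def \<Psi>_def prod_dividef mult_ac)

lemma qpoch_b_nonzero: "j \<in> {1..N} \<Longrightarrow> bmax < cmod z \<Longrightarrow> qpoch (of_real (b j) / z) q \<noteq> 0"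
  using b(2)[of j] b(3)[of j] b(1) by (intro qpoch_nonzero_small q) (auto simp: norm_divide divide_less_eq)

lemma qpoch_a_nonzero: "i \<in> {1..N} \<Longrightarrow> w \<notin> poles \<Longrightarrow> qpoch (of_real (a i) * w) q \<noteq> 0"
proof (rule qpoch_nonzero[OF q], rule notI)
  fix j assume i: "i \<in> {1..N}" and w: "w \<notin> poles" and eq: "of_real (a i) * w * complex_of_real (q ^ j) = 1"
  have "complex_of_real (a i * q ^ j) \<noteq> 0" using a_pos[OF i] q by simp
  moreover have "complex_of_real (a i * q ^ j) * w = 1" using eq by (simp add: mult_ac)
  ultimately have "w = 1 / complex_of_real (a i * q ^ j)" by (subst nonzero_eq_divide_eq) (simp_all add: mult.commute)
  with i w show False by (auto simp: poles_def)
qed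

lemma holomorphic_\<Phi>: "\<Phi> holomorphic_on {z. bmax < cmod z}"
  unfolding \<Phi>_def[abs_def] using b(1) qpoch_b_nonzero
  by (intro holomorphic_on_divide holomorphic_on_prod holomorphic_on_qpoch q holomorphic_intros) auto

lemma holomorphic_\<Psi>: "\<Psi> holomorphic_on - ({0} \<union> poles)"
  unfolding \<Psi>_def[abs_def] using qpoch_a_nonzero
  by (intro holomorphic_on_divide holomorphic_on_prod holomorphic_on_qpoch q holomorphic_intros) auto

lemma cmod_pole: "i \<in> {1..N} \<Longrightarrow> cmod (1 / complex_of_real (a i * q ^ j)) = 1 / (a i * q ^ j)"
  using a_pos[of i] q by (simp add: norm_divide norm_mult norm_power)

lemma cmod_pole_ge: "p \<in> poles \<Longrightarrow> 1 / amax \<le> cmod p"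
proof -
  assume "p \<in> poles"
  then obtain i j where i: "i \<in> {1..N}" and p: "p = 1 / complex_of_real (a i * q ^ j)"
    by (auto simp: poles_def)
  have "a i * q ^ j \<le> amax * 1"
    using a(3)[OF i] a_pos[OF i] q amax_pos by (intro mult_mono) (auto simp: power_le_one)
  then show ?thesis unfolding p cmod_pole[OF i]
    using a_pos[OF i] q amax_pos by (intro divide_left_mono) auto
qed

lemma cmod_pole_0: "i \<in> {1..N} \<Longrightarrow> cmod (1 / complex_of_real (a i)) \<le> 1 / amin"
  using a_pos[of i] a(1) a(2)[of i] by (simp add: norm_divide divide_left_mono)

lemma cmod_pole_Suc: "i \<in> {1..N} \<Longrightarrow> 1 \<le> j \<Longrightarrow> 1 / (q * amax) \<le> cmod (1 / complex_of_real (a i * q ^ j))"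
proof -
  assume i: "i \<in> {1..N}" and j: "1 \<le> j"
  have "q ^ j \<le> q ^ 1" using j q by (intro power_decreasing) auto
  then have "a i * q ^ j \<le> amax * q"
    using a(3)[OF i] a_pos[OF i] q amax_pos by (intro mult_mono) auto
  then show ?thesis unfolding cmod_pole[OF i]
    using a_pos[OF i] q amax_pos by (intro divide_left_mono) (auto simp: mult_ac)
qed

lemma poles_outer: "1 / amin < cmod p \<Longrightarrow> cmod p < 1 / (q * amax) \<Longrightarrow> p \<notin> poles"
proof
  assume p: "1 / amin < cmod p" "cmod p < 1 / (q * amax)" and "p \<in> poles"
  then obtain i j where i: "i \<in> {1..N}" and eq: "p = 1 / complex_of_real (a i * q ^ j)"
    by (auto simp: poles_def)
  show False
  proof (cases j)
    case 0
    with p cmod_pole_0[OF i] eq show False by simp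
  next
    case (Suc j')
    with p cmod_pole_Suc[OF i, of j] eq show False by simp
  qed
qed

lemma finite_poles_ball: "finite (poles \<inter> ball 0 M)"
proof -
  have "(\<lambda>j. q ^ j) \<longlonglongrightarrow> 0" using q by (intro LIMSEQ_realpow_zero) auto
  then have "\<forall>\<^sub>F j in sequentially. q ^ j < 1 / (amax * max M 1)"
    using amax_pos by (intro order_tendstoD) auto
  then obtain J where J: "\<And>j. j \<ge> J \<Longrightarrow> q ^ j < 1 / (amax * max M 1)"
    by (auto simp: eventually_sequentially)
  have "poles \<inter> ball 0 M \<subseteq> (\<lambda>(i, j). 1 / complex_of_real (a i * q ^ j)) ` ({1..N} \<times> {..<J})"
  proof
    fix p assume p: "p \<in> poles \<inter> ball 0 M"
    then obtain i j where i: "i \<in> {1..N}" and eq: "p = 1 / complex_of_real (a i * q ^ j)"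
      by (auto simp: poles_def)
    have "j < J"
    proof (rule ccontr)
      assume "\<not> j < J"
      then have "q ^ j < 1 / (amax * max M 1)" using J by simp
      then have "amax * max M 1 * q ^ j < 1" using amax_pos by (simp add: field_simps)
      moreover have "a i * q ^ j * max M 1 \<le> amax * q ^ j * max M 1"
        using a(3)[OF i] q by (intro mult_right_mono) auto
      ultimately have "a i * q ^ j * max M 1 < 1" by (simp add: mult_ac)
      then have "max M 1 < 1 / (a i * q ^ j)"
        using a_pos[OF i] q by (simp only: less_divide_eq mult_ac) simp
      moreover have "1 / (a i * q ^ j) < M" using p unfolding eq by (simp only: cmod_pole[OF i] Int_iff mem_ball_0)
      ultimately show False by simp
    qed
    then show "p \<in> (\<lambda>(i, j). 1 / complex_of_real (a i * q ^ j)) ` ({1..N} \<times> {..<J})"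
      using i eq by auto
  qed
  then show ?thesis by (rule finite_subset) auto
qed

lemma \<Phi>_annulus: "\<Phi> holomorphic_on annulus bmax r2"
  by (rule holomorphic_on_subset[OF holomorphic_\<Phi>]) (auto simp: annulus_def)

lemma \<Psi>_annulus_inner: "\<Psi> holomorphic_on annulus 0 (1 / amax)"
  by (rule holomorphic_on_subset[OF holomorphic_\<Psi>]) (use cmod_pole_ge in \<open>fastforce simp: annulus_def\<close>)

lemma \<Psi>_annulus_outer: "\<Psi> holomorphic_on annulus (1 / amin) (1 / (q * amax))"
  by (rule holomorphic_on_subset[OF holomorphic_\<Psi>])
     (use poles_outer a(1) in \<open>auto simp: annulus_def divide_less_0_iff\<close>)

lemma \<Phi>_\<Psi>: "bmax < cmod z \<Longrightarrow> cmod z < 1 / amax \<Longrightarrow> \<Phi> z * \<Psi> z = 1"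
proof -
  assume z: "bmax < cmod z" "cmod z < 1 / amax"
  then have "z \<notin> poles" using cmod_pole_ge[of z] by auto
  then have "(\<Prod>i\<in>{1..N}. qpoch (of_real (a i) * z) q) \<noteq> 0"
      "(\<Prod>j\<in>{1..N}. qpoch (of_real (b j) / z) q) \<noteq> 0"
    using z qpoch_a_nonzero qpoch_b_nonzero by auto
  then show ?thesis by (simp add: \<Phi>_def \<Psi>_def)
qed

text \<open>The \<open>q\<close>-shift telescopes both products, leaving a rational function that vanishes at infinity.\<close>

lemma \<Phi>_dilate_\<Psi>:
  assumes z: "1 / amin < cmod z" "bmax / q < cmod z" "cmod z < 1 / (q * amax)"
  shows "\<Phi> (of_real q * z) * \<Psi> z = H z"
proof -
  have qz: "bmax < cmod (of_real q * z)" using z q by (simp add: norm_mult field_simps)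
  have "bmax \<le> bmax / q" using b(1) q by (simp add: field_simps)
  then have zb: "bmax < cmod z" using z by simp
  have z0: "z \<noteq> 0" using zb b(1) by auto
  have an: "qpoch (of_real q * (of_real (a i) * z)) q \<noteq> 0" if i: "i \<in> {1..N}" for i
  proof (rule qpoch_nonzero_small[OF q])
    have "q * (a i * cmod z) \<le> q * amax * cmod z"
      using a(3)[OF i] q by (simp add: mult_right_mono)
    also have "\<dots> < 1" using z(3) q amax_pos by (simp add: field_simps)
    finally show "cmod (of_real q * (of_real (a i) * z)) < 1"
      using q a_pos[OF i] by (simp add: norm_mult)
  qed
  have A: "(\<Prod>i\<in>{1..N}. qpoch (of_real (a i) * z) q) =
      (\<Prod>i\<in>{1..N}. 1 - of_real (a i) * z) * (\<Prod>i\<in>{1..N}. qpoch (of_real (a i) * (of_real q * z)) q)"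
    unfolding prod.distrib[symmetric]
    by (rule prod.cong[OF refl]) (subst qpoch_rec[OF q], simp add: mult_ac)
  have B: "(\<Prod>j\<in>{1..N}. qpoch (of_real (b j) / (of_real q * z)) q) =
      (\<Prod>j\<in>{1..N}. 1 - of_real (b j) / (of_real q * z)) * (\<Prod>j\<in>{1..N}. qpoch (of_real (b j) / z) q)"
    unfolding prod.distrib[symmetric]
    by (rule prod.cong[OF refl]) (subst qpoch_rec[OF q], use q in simp)
  have nz: "(\<Prod>i\<in>{1..N}. qpoch (of_real (a i) * (of_real q * z)) q) \<noteq> 0"
    "(\<Prod>j\<in>{1..N}. qpoch (of_real (b j) / z) q) \<noteq> 0"
    using an qpoch_b_nonzero zb by (auto simp: mult_ac)
  show ?thesis
    unfolding \<Phi>_def \<Psi>_def A B H_def prod_dividef using nz by (simp add: field_simps)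
qed

lemma holomorphic_H: "H holomorphic_on {z. max (1 / amin) (bmax / q) < cmod z}"
  unfolding H_def[abs_def]
proof (intro holomorphic_on_mult holomorphic_on_prod holomorphic_on_divide holomorphic_intros)
  fix z assume "z \<in> {z. max (1 / amin) (bmax / q) < cmod z}"
  then have z: "1 / amin < cmod z" "bmax / q < cmod z" by auto
  show "of_real q * z \<noteq> 0" using z q b(1) by (auto simp: divide_less_0_iff)
  show "1 - of_real (a i) * z \<noteq> 0" if i: "i \<in> {1..N}" for i
  proof
    assume "1 - of_real (a i) * z = 0"
    then have "cmod (of_real (a i) * z) = 1" by simp
    then have "a i * cmod z = 1" using a_pos[OF i] by (simp add: norm_mult)
    moreover have "amin * cmod z \<le> a i * cmod z" using a(2)[OF i] by (intro mult_right_mono) auto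
    moreover have "amin * cmod z > 1" using z(1) a(1) by (simp add: field_simps)
    ultimately show False by simp
  qed
  show "1 - of_real (b j) / (of_real q * z) \<noteq> 0" if j: "j \<in> {1..N}" for j
  proof
    assume "1 - of_real (b j) / (of_real q * z) = 0"
    then have "1 = cmod (of_real (b j) / (of_real q * z))" by simp
    also have "\<dots> = b j / (q * cmod z)" using b(2)[OF j] q by (simp add: norm_mult norm_divide)
    also have "\<dots> < 1" using z(2) q b(1) b(3)[OF j] by (auto simp: field_simps)
    finally show False by simp
  qed
qed

text \<open>Each factor 1/(1 - a_i z) is O(1/|z|), and at least one is present because N is at least
  1; the factors with b_j stay bounded. The thresholds are twice the pole bounds, which gives a
  constant 2 per factor.\<close>

lemma H_bound: "\<exists>M C. \<forall>z. M \<le> cmod z \<longrightarrow> cmod (H z) \<le> C / cmod z"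
proof (intro exI allI impI)
  fix z assume "max (2 / amin) (2 * bmax / q) \<le> cmod z"
  then have z: "2 / amin \<le> cmod z" "2 * bmax / q \<le> cmod z" by auto
  have z0: "0 < cmod z" using z(1) a(1) by (smt (verit) divide_pos_pos)
  have "cmod (\<Prod>i\<in>{1..N}. 1 / (1 - of_real (a i) * z)) \<le> (\<Prod>i\<in>{1..N}. 2 / (amin * cmod z))"
    unfolding prod_norm[symmetric]
  proof (rule prod_mono, intro conjI)
    fix i assume i: "i \<in> {1..N}"
    have "amin * cmod z / 2 \<le> amin * cmod z - 1" using z(1) a(1) by (simp add: field_simps)
    also have "\<dots> \<le> a i * cmod z - 1" using a(2)[OF i] by (simp add: mult_right_mono)
    also have "\<dots> = cmod (of_real (a i) * z) - cmod 1" using a_pos[OF i] by (simp add: norm_mult)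
    also have "\<dots> \<le> cmod (1 - of_real (a i) * z)" using norm_triangle_ineq3[of 1 "of_real (a i) * z"] by auto
    finally have "1 / cmod (1 - of_real (a i) * z) \<le> 1 / (amin * cmod z / 2)"
      using z0 a(1) by (intro frac_le) simp_all
    then show "cmod (1 / (1 - of_real (a i) * z)) \<le> 2 / (amin * cmod z)" by (simp add: norm_divide)
  qed auto
  also have "\<dots> = (2 / (amin * cmod z)) ^ N" by simp
  also have "\<dots> \<le> (2 / (amin * cmod z)) ^ 1"
    using z(1) z0 a(1) N by (intro power_decreasing) (auto simp: field_simps)
  finally have 1: "cmod (\<Prod>i\<in>{1..N}. 1 / (1 - of_real (a i) * z)) \<le> 2 / amin / cmod z" by simp
  have "cmod (\<Prod>j\<in>{1..N}. 1 / (1 - of_real (b j) / (of_real q * z))) \<le> (\<Prod>j\<in>{1..N}. 2)"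
    unfolding prod_norm[symmetric]
  proof (rule prod_mono, intro conjI)
    fix j assume j: "j \<in> {1..N}"
    have "cmod (of_real (b j) / (of_real q * z)) = b j / (q * cmod z)"
      using b(2)[OF j] q by (simp add: norm_mult norm_divide)
    also have "\<dots> \<le> 1 / 2" using z(2) z0 q b(3)[OF j] by (simp add: field_simps)
    finally have "1 / 2 \<le> cmod (1 - of_real (b j) / (of_real q * z))"
      using norm_triangle_ineq2[of 1 "of_real (b j) / (of_real q * z)"] by simp
    then have "1 / cmod (1 - of_real (b j) / (of_real q * z)) \<le> 1 / (1 / 2)"
      by (intro divide_left_mono) auto
    then show "cmod (1 / (1 - of_real (b j) / (of_real q * z))) \<le> 2" by (simp add: norm_divide)
  qed auto
  then have 2: "cmod (\<Prod>j\<in>{1..N}. 1 / (1 - of_real (b j) / (of_real q * z))) \<le> 2 ^ N" by simp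
  have "cmod (H z) \<le> (2 / amin / cmod z) * 2 ^ N"
    unfolding H_def norm_mult using z0 a(1) by (intro mult_mono 1 2) auto
  then show "cmod (H z) \<le> (2 / amin * 2 ^ N) / cmod z" by simp
qed

end

section \<open>The kernels as half-convolutions, and reduction of the contours to circles\<close>

context q_symbol
begin

text \<open>The minus sign comes from 1/(z - w) = -1/(w - z). The \<open>w\<close> in the numerator
  of \<open>gfun\<close> cancels dw/w, while dz/z contributes the extra -1 in the exponent of
  \<open>z\<close>.\<close>

lemma
  assumes r: "bmax < r" "r < \<rho>" and \<Psi>: "continuous_on (sphere 0 \<rho>) \<Psi>"
  shows kernel_circlepath_sums:
      "(\<lambda>n. lc \<Phi> r (m1 - int n) * lc \<Psi> \<rho> (int n - m2)) sums - kernel N q a b r (circlepath 0 \<rho>) m1 m2" (is ?A)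
    and kernel_circlepath_integrable:
      "(\<lambda>z. contour_integral (circlepath 0 \<rho>) (\<lambda>w. gfun N q a b z w m1 m2 / w) / z)
         contour_integrable_on circlepath 0 r" (is ?B)
proof -
  have pos: "0 < r" "0 < \<rho>" using b(1) r by auto
  let ?F = "\<lambda>z. \<Phi> z * z powi (- m1 - 1)" and ?G = "\<lambda>w. \<Psi> w * w powi m2"
  let ?I = "\<lambda>z. contour_integral (circlepath 0 \<rho>) (\<lambda>w. ?G w / (w - z))"
  let ?J = "\<lambda>z. contour_integral (circlepath 0 \<rho>) (\<lambda>w. gfun N q a b z w m1 m2 / w) / z"
  have "continuous_on (sphere 0 r) \<Phi>"
    by (rule holomorphic_on_imp_continuous_on, rule holomorphic_on_subset[OF holomorphic_\<Phi>]) (use r in auto)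
  then have F: "continuous_on (sphere 0 r) ?F"
    using pos by (intro continuous_intros continuous_on_powi) auto
  have G: "continuous_on (sphere 0 \<rho>) ?G"
    using pos by (intro continuous_intros \<Psi> continuous_on_powi) auto
  have J: "?J z = - (?F z * ?I z)" if z: "cmod z = r" for z
  proof -
    have z0: "z \<noteq> 0" using z pos by auto
    have i: "(\<lambda>w. ?G w / (w - z)) contour_integrable_on circlepath 0 \<rho>"
      using z r pos by (intro contour_integrable_circlepath continuous_on_divide G continuous_intros) auto
    have "contour_integral (circlepath 0 \<rho>) (\<lambda>w. gfun N q a b z w m1 m2 / w) =
        contour_integral (circlepath 0 \<rho>) (\<lambda>w. - (\<Phi> z / z powi m1) * (?G w / (w - z)))"
    proof (rule contour_integral_eq)
      fix w assume "w \<in> path_image (circlepath 0 \<rho>)"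
      then have w: "cmod w = \<rho>" "w \<noteq> 0" using pos by auto
      have "1 / (z - w) = - (1 / (w - z))" by (metis minus_diff_eq divide_minus_right)
      moreover have "gfun N q a b z w m1 m2 / w = (\<Phi> z / z powi m1) * ?G w * (1 / (z - w))"
        unfolding gfun_eq using w by simp
      ultimately show "gfun N q a b z w m1 m2 / w = - (\<Phi> z / z powi m1) * (?G w / (w - z))" by simp
    qed
    also have "\<dots> = - (\<Phi> z / z powi m1) * ?I z" by (rule contour_integral_lmul[OF i])
    finally have "?J z = - (\<Phi> z / z powi m1) * ?I z / z" by simp
    also have "\<dots> = - (?F z * ?I z)"
      using z0 by (simp add: power_int_diff power_int_minus field_simps)
    finally show ?thesis .
  qed
  have int: "(\<lambda>z. ?F z * ?I z) contour_integrable_on circlepath 0 r"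
    using pos(1) r(2) F G by (rule double_contour_integrable)
  show ?B
    by (rule contour_integrable_eq[OF contour_integrable_neg[OF int]]) (use J pos in auto)
  have K: "kernel N q a b r (circlepath 0 \<rho>) m1 m2 =
      - (contour_integral (circlepath 0 r) (\<lambda>z. ?F z * ?I z) / (2 * pi * \<i>)^2)"
  proof -
    have "contour_integral (circlepath 0 r) ?J = contour_integral (circlepath 0 r) (\<lambda>z. - (?F z * ?I z))"
      using J pos by (intro contour_integral_eq) auto
    also have "\<dots> = - contour_integral (circlepath 0 r) (\<lambda>z. ?F z * ?I z)"
      by (rule contour_integral_neg)
    finally show ?thesis by (simp add: kernel_def)
  qed
  have "(\<lambda>n. lc ?F r (- int n - 1) * lc ?G \<rho> (int n)) sums - kernel N q a b r (circlepath 0 \<rho>) m1 m2"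
    unfolding K minus_minus using pos(1) r(2) F G by (rule double_contour_sums)
  moreover have "lc ?F r (- int n - 1) = lc \<Phi> r (m1 - int n)" for n
    by (subst lc_mult_powi[OF pos(1)]) (simp add: algebra_simps)
  moreover have "lc ?G \<rho> (int n) = lc \<Psi> \<rho> (int n - m2)" for n
    by (rule lc_mult_powi[OF pos(2)])
  ultimately show ?A by simp
qed

lemma gfun_holomorphic:
  "(\<lambda>w. gfun N q a b z w m1 m2 / w) holomorphic_on - ({0, z} \<union> poles)"
  unfolding gfun_eq
  by (intro holomorphic_intros holomorphic_on_subset[OF holomorphic_\<Psi>]) auto

lemma finite_singularities_ball: "finite (({0, z} \<union> poles) \<inter> ball 0 M)"
  by (rule finite_subset[of _ "{0, z} \<union> (poles \<inter> ball 0 M)"]) (use finite_poles_ball in auto)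

text \<open>For each fixed \<open>z\<close> on the inner circle, both contours wind once around 0
  and \<open>z\<close> and not at all around the poles.\<close>

lemma kernel_eq_circlepath:
  assumes r: "bmax < r" "r < y" "y < 1 / amax"
    and \<gamma>: "valid_path \<gamma>" "pathfinish \<gamma> = pathstart \<gamma>" "path_image \<gamma> \<subseteq> {w. r < cmod w}"
    and encl: "\<And>w. cmod w \<le> r \<Longrightarrow> winding_number \<gamma> w = 1"
    and poles: "\<And>i j. i \<in> {1..N} \<Longrightarrow> 1 / complex_of_real (a i * q ^ j) \<notin> path_image \<gamma> \<and>
        winding_number \<gamma> (1 / complex_of_real (a i * q ^ j)) = 0"
  shows "kernel N q a b r \<gamma> m1 m2 = kernel N q a b r (circlepath 0 y) m1 m2"
proof -
  have pos: "0 < r" "0 < y" using b(1) r by auto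
  have out: "y < cmod p" if "p \<in> poles" for p using cmod_pole_ge[OF that] r by simp
  have pl: "p \<notin> path_image \<gamma> \<and> winding_number \<gamma> p = 0" if "p \<in> poles" for p
    using that poles by (auto simp: poles_def)
  have "contour_integral \<gamma> (\<lambda>w. gfun N q a b z w m1 m2 / w) =
      contour_integral (circlepath 0 y) (\<lambda>w. gfun N q a b z w m1 m2 / w)" if z: "cmod z = r" for z
  proof (rule contour_integral_eq_if_winding_numbers[OF finite_singularities_ball gfun_holomorphic \<gamma>(1,2)])
    show "path_image \<gamma> \<inter> ({0, z} \<union> poles) = {}" using \<gamma>(3) pl z pos by auto
    show "path_image (circlepath 0 y) \<inter> ({0, z} \<union> poles) = {}" using pos r z out by force
    fix p assume "p \<in> {0, z} \<union> poles"
    then consider "p \<in> poles" | "p = 0 \<or> p = z" by auto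
    then show "winding_number \<gamma> p = winding_number (circlepath 0 y) p"
    proof cases
      case 1
      then show ?thesis using pl out pos by (simp add: winding_number_circlepath_outside)
    next
      case 2
      then have "cmod p \<le> r" using z pos by auto
      then show ?thesis using encl r by (simp add: winding_number_circlepath_inside)
    qed
  qed auto
  then have "contour_integral (circlepath 0 r) (\<lambda>z. contour_integral \<gamma> (\<lambda>w. gfun N q a b z w m1 m2 / w) / z) =
      contour_integral (circlepath 0 r) (\<lambda>z. contour_integral (circlepath 0 y) (\<lambda>w. gfun N q a b z w m1 m2 / w) / z)"
    using pos by (intro contour_integral_eq) auto
  then show ?thesis by (simp add: kernel_def)
qed

text \<open>Circle \<open>R\<close> winds once around 0, \<open>z\<close> and the poles with j = 0,
  circle \<open>y\<close> only around 0 and \<open>z\<close>. Their difference has the winding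
  numbers of \<gamma> at every singularity.\<close>

lemma kernel_eq_circlepath_diff:
  assumes r: "bmax < r" "r < y" "y < 1 / amax" and R: "1 / amin < R" "R < 1 / (q * amax)"
    and \<gamma>: "valid_path \<gamma>" "pathfinish \<gamma> = pathstart \<gamma>" "path_image \<gamma> \<subseteq> {w. r < cmod w}"
    and inside: "\<And>w. cmod w \<le> r \<Longrightarrow> winding_number \<gamma> w = 0"
    and poles: "\<And>i j. i \<in> {1..N} \<Longrightarrow> 1 / complex_of_real (a i * q ^ j) \<notin> path_image \<gamma> \<and>
        winding_number \<gamma> (1 / complex_of_real (a i * q ^ j)) = of_bool (j = 0)"
  shows "kernel N q a b r \<gamma> m1 m2 = kernel N q a b r (circlepath 0 R) m1 m2 - kernel N q a b r (circlepath 0 y) m1 m2"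
proof -
  have "1 / amax \<le> 1 / amin" using amin_le_amax a(1) by (intro divide_left_mono) auto
  with r R b(1) have pos: "0 < r" "0 < y" "0 < R" "y < R" "r < R" by auto
  have out: "y < cmod p" if "p \<in> poles" for p using cmod_pole_ge[OF that] r by simp
  have out': "cmod p \<noteq> R" if "p \<in> poles" for p using poles_outer[of p] that R by auto
  let ?g = "\<lambda>z w. gfun N q a b z w m1 m2 / w"
  let ?c = "\<lambda>\<rho>. circlepath 0 \<rho>"
  have "contour_integral \<gamma> (?g z) = contour_integral (?c R) (?g z) - contour_integral (?c y) (?g z)"
    if z: "cmod z = r" for z
  proof (rule contour_integral_diff_if_winding_numbers[OF finite_singularities_ball gfun_holomorphic \<gamma>(1,2)])
    show "path_image \<gamma> \<inter> ({0, z} \<union> poles) = {}" using \<gamma>(3) poles z pos by (auto simp: poles_def)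
    show "path_image (?c y) \<inter> ({0, z} \<union> poles) = {}" using pos r z out by force
    show "path_image (?c R) \<inter> ({0, z} \<union> poles) = {}" using pos r z out' by force
    fix p assume "p \<in> {0, z} \<union> poles"
    then consider i j where "i \<in> {1..N}" "p = 1 / complex_of_real (a i * q ^ j)" | "p = 0 \<or> p = z"
      by (auto simp: poles_def)
    then show "winding_number \<gamma> p = winding_number (?c R) p - winding_number (?c y) p"
    proof cases
      case (1 i j)
      then have "p \<in> poles" by (auto simp: poles_def)
      then have y0: "winding_number (?c y) p = 0" using out pos by (simp add: winding_number_circlepath_outside)
      show ?thesis
      proof (cases "j = 0")
        case True
        then have "cmod p < R" using cmod_pole_0[OF 1(1)] 1(2) R by simp
        then show ?thesis using 1 y0 poles[OF 1(1), of j] True by (simp add: winding_number_circlepath_inside)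
      next
        case False
        then have "R < cmod p" using cmod_pole_Suc[OF 1(1), of j] R unfolding 1(2) by linarith
        then have "winding_number (?c R) p = 0" using pos by (simp add: winding_number_circlepath_outside)
        then show ?thesis using y0 poles[OF 1(1), of j] False unfolding 1(2) by simp
      qed
    next
      case 2
      then have "cmod p \<le> r" using z pos by auto
      then show ?thesis using inside r pos by (simp add: winding_number_circlepath_inside)
    qed
  qed auto
  then have "contour_integral (?c r) (\<lambda>z. contour_integral \<gamma> (?g z) / z) =
      contour_integral (?c r) (\<lambda>z. contour_integral (?c R) (?g z) / z - contour_integral (?c y) (?g z) / z)"
    using pos by (intro contour_integral_eq) (auto simp: diff_divide_distrib)
  also have "\<dots> = contour_integral (?c r) (\<lambda>z. contour_integral (?c R) (?g z) / z) -
      contour_integral (?c r) (\<lambda>z. contour_integral (?c y) (?g z) / z)"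
  proof (rule contour_integral_diff; rule kernel_circlepath_integrable)
    show "continuous_on (sphere 0 R) \<Psi>"
      by (rule holomorphic_on_imp_continuous_on, rule holomorphic_on_subset[OF \<Psi>_annulus_outer])
         (use R in \<open>auto simp: annulus_def\<close>)
    show "continuous_on (sphere 0 y) \<Psi>"
      by (rule holomorphic_on_imp_continuous_on, rule holomorphic_on_subset[OF \<Psi>_annulus_inner])
         (use r pos in \<open>auto simp: annulus_def\<close>)
  qed (use r pos in auto)
  finally show ?thesis by (simp add: kernel_def right_diff_distrib)
qed

lemma decay_lc:
  assumes f: "f holomorphic_on annulus r1 r2" and r: "0 \<le> r1" "r1 < \<rho>" "\<rho> < r2" "r1 < x" "x < r2"
  shows "decay (lc f \<rho>) x"
proof -
  have "continuous_on (sphere 0 x) f"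
    using f sphere_subset_annulus[OF r(4,5)] holomorphic_on_imp_continuous_on continuous_on_subset by blast
  then obtain B where "0 \<le> B" "\<And>k. cmod (lc f x k) \<le> B * x powi (- k)"
    using lc_bounded[of x f] r by auto
  moreover have "lc f x k = lc f \<rho> k" for k using f r by (intro lc_annulus) auto
  ultimately show ?thesis unfolding decay_def by auto
qed

theorem fredholm_det_kernels:
  assumes t: "0 < t" and r: "bmax < r" "r < 1 / amax"
    and \<gamma>: "valid_path \<gamma>" "pathfinish \<gamma> = pathstart \<gamma>" "path_image \<gamma> \<subseteq> {w. r < cmod w}"
      "\<And>w. cmod w \<le> r \<Longrightarrow> winding_number \<gamma> w = 0"
      "\<And>i j. i \<in> {1..N} \<Longrightarrow> 1 / complex_of_real (a i * q ^ j) \<notin> path_image \<gamma> \<and>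
        winding_number \<gamma> (1 / complex_of_real (a i * q ^ j)) = of_bool (j = 0)"
    and \<gamma>': "valid_path \<gamma>'" "pathfinish \<gamma>' = pathstart \<gamma>'" "path_image \<gamma>' \<subseteq> {w. r < cmod w}"
      "\<And>w. cmod w \<le> r \<Longrightarrow> winding_number \<gamma>' w = 1"
      "\<And>i j. i \<in> {1..N} \<Longrightarrow> 1 / complex_of_real (a i * q ^ j) \<notin> path_image \<gamma>' \<and>
        winding_number \<gamma>' (1 / complex_of_real (a i * q ^ j)) = 0"
  shows "fredholm_det (\<lambda>m1 m2. - (fmult q t k m1 * kernel N q a b r \<gamma> m1 m2)) =
         fredholm_det (\<lambda>m1 m2. fmult q t k m1 * kernel N q a b r \<gamma>' m1 m2)"
proof -
  have "q / amin < 1 / amax" "bmax < 1 / amax"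
    using ratio ab amax_pos a(1) by (auto simp: field_simps)
  \<comment> \<open>Places \<open>p\<close> in the annulus where the symbols are reciprocal while
    \<open>R = p / q\<close> lies beyond both 1/amin and bmax/q, the region in which
    \<open>H\<close> is holomorphic.\<close>
  then obtain p where p: "max bmax (q / amin) < p" "p < 1 / amax" using dense[of "max bmax (q / amin)" "1 / amax"] by auto
  obtain x1 where x1: "bmax < x1" "x1 < p" using dense[of bmax p] p by auto
  obtain x2 where x2: "p < x2" "x2 < 1 / amax" using dense[of p "1 / amax"] p by auto
  \<comment> \<open>Above \<open>x2\<close> for the row estimates and above \<open>r\<close> so that
    this circle encloses the contour of \<open>z\<close>.\<close>
  obtain y where y: "max x2 r < y" "y < 1 / amax" using dense[of "max x2 r" "1 / amax"] x2 r by auto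
  define R where "R = p / q"
  define s where "s = t * q powr (1/2 + real k)"
  have R: "1 / amin < R" "bmax / q < R" "R < 1 / (q * amax)"
    using p q a(1) amax_pos by (auto simp: R_def field_simps)
  have amm: "1 / amax \<le> 1 / amin" using amin_le_amax a(1) by (intro divide_left_mono) auto
  have pos: "0 < x1" "0 < p" "0 < x2" "0 < y" "0 < r" "0 < R" "y < R" "r < y" "r < R" "x2 < y"
    using b(1) x1 p x2 y r R amm q by (auto simp: R_def)
  let ?\<phi> = "lc \<Phi> r" and ?\<psi> = "lc \<Psi> y" and ?\<omega> = "lc \<Psi> R"
  \<comment> \<open>The radius \<open>x1 / 2\<close> is an arbitrary choice below \<open>x1\<close>:
    inside 1/amax, \<Psi> is singular at most at 0.\<close>
  interpret W: wiener_hopf_symbols ?\<phi> ?\<psi> ?\<omega> s q "x1 / 2" x1 x2 p y R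
  proof
    show "0 < s" using t q by (simp add: s_def)
    show "p = q * R" using q by (simp add: R_def)
    show "decay ?\<phi> x1" "decay ?\<phi> x2"
      using decay_lc[OF \<Phi>_annulus[of "x2 + r + 1"], of r] b(1) r x1 x2 pos by auto
    show "decay ?\<psi> (x1 / 2)" "decay ?\<psi> p" "decay ?\<psi> y"
      using decay_lc[OF \<Psi>_annulus_inner, of y] pos x1 p y by auto
    show "decay ?\<omega> R"
      using decay_lc[OF \<Psi>_annulus_outer, of R R] R a(1) by auto
    show "((\<lambda>k. ?\<phi> k * ?\<psi> (n - k)) has_sum of_bool (n = 0)) UNIV" for n
    proof -
      have \<Psi>': "\<Psi> holomorphic_on annulus bmax (1 / amax)"
        by (rule holomorphic_on_subset[OF \<Psi>_annulus_inner]) (use b(1) in \<open>auto simp: annulus_def\<close>)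
      have "?\<psi> k = lc \<Psi> r k" for k
        using b(1) r y pos by (intro lc_annulus[OF \<Psi>']) auto
      moreover have "lc (\<lambda>z. \<Phi> z * \<Psi> z) r n = of_bool (n = 0)"
        using lc_cong[OF pos(5), of "\<lambda>z. \<Phi> z * \<Psi> z" "\<lambda>_. 1"] \<Phi>_\<Psi> r lc_one[OF pos(5)] by auto
      ultimately show ?thesis
        using lc_convolution[OF \<Phi>_annulus[of "1 / amax"] \<Psi>', of r n] b(1) r by (simp add: has_sum_iff)
    qed
    show "((\<lambda>k. ?\<omega> (n - k) * of_real (q powi k) * ?\<phi> k) has_sum 0) UNIV" if n: "0 \<le> n" for n
    proof -
      let ?f = "\<lambda>z. \<Phi> (of_real q * z)" and ?r = "max (1 / amin) (bmax / q)"
      have f: "?f holomorphic_on annulus ?r (1 / (q * amax))"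
      proof (rule holomorphic_on_compose[OF _ holomorphic_on_subset[OF holomorphic_\<Phi>], unfolded o_def])
        show "(*) (complex_of_real q) ` annulus ?r (1 / (q * amax)) \<subseteq> {z. bmax < cmod z}"
          using q by (auto simp: annulus_def norm_mult field_simps)
      qed (intro holomorphic_intros)
      have g: "\<Psi> holomorphic_on annulus ?r (1 / (q * amax))"
        by (rule holomorphic_on_subset[OF \<Psi>_annulus_outer]) (auto simp: annulus_def)
      have "lc ?f R k = of_real (q powi k) * ?\<phi> k" for k
      proof -
        have "lc ?f R k = of_real q powi k * lc \<Phi> (q * R) k" by (rule lc_dilate[OF pos(6) q(1)])
        also have "lc \<Phi> (q * R) k = ?\<phi> k"
          \<comment> \<open>Since \<Phi> is holomorphic outside bmax, its coefficients read on
            radius q R = p agree with those read on \<open>r\<close>; \<open>p + r + 1\<close> is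
            just an outer radius beyond both.\<close>
          using b(1) r p q by (intro lc_annulus[OF \<Phi>_annulus[of "p + r + 1"]]) (auto simp: R_def)
        finally show ?thesis by simp
      qed
      moreover have "lc (\<lambda>z. ?f z * \<Psi> z) R n = 0"
      proof -
        obtain M C where "\<And>z. M \<le> cmod z \<Longrightarrow> cmod (H z) \<le> C / cmod z" using H_bound by blast
        then have "lc H R n = 0"
          using R a(1) n by (intro lc_eq_0_if_decay[OF holomorphic_H]) (auto simp: le_max_iff_disj)
        moreover have "lc (\<lambda>z. ?f z * \<Psi> z) R n = lc H R n"
          using R by (intro lc_cong pos \<Phi>_dilate_\<Psi>) auto
        ultimately show ?thesis by simp
      qed
      ultimately show ?thesis
        using lc_convolution[OF f g, of R n] R a(1)
        by (simp add: has_sum_iff mult_ac le_max_iff_disj)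
    qed
  qed (use q pos x1 x2 y in auto)
  have f: "fmult q t k m = of_real (W.mult m)" for m
  proof -
    have "t * q powr (1/2 + real k + real_of_int m) = s * q powi m"
      using q by (simp add: s_def powr_add powr_real_of_int')
    then show ?thesis by (simp add: fmult_def W.mult_def)
  qed
  have cont: "continuous_on (sphere 0 y) \<Psi>" "continuous_on (sphere 0 R) \<Psi>"
    by (rule holomorphic_on_imp_continuous_on, rule holomorphic_on_subset[OF \<Psi>_annulus_inner],
        use pos y in \<open>auto simp: annulus_def\<close>)
       (rule holomorphic_on_imp_continuous_on, rule holomorphic_on_subset[OF \<Psi>_annulus_outer],
        use R in \<open>auto simp: annulus_def\<close>)
  have KP: "kernel N q a b r (circlepath 0 y) m1 m2 = - W.P m1 m2" for m1 m2
  proof -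
    have "(\<lambda>n. ?\<phi> (m1 - int n) * ?\<psi> (int n - m2)) summable_on UNIV"
      by (rule half_conv_bound[OF W.\<phi>(2) W.\<psi>(3)]) (use pos in auto)
    from has_sum_imp_sums[OF has_sum_infsum[OF this]]
    have "- kernel N q a b r (circlepath 0 y) m1 m2 = W.P m1 m2"
      unfolding W.P_def half_conv_def
      by (rule sums_unique2[OF kernel_circlepath_sums[OF r(1) pos(8) cont(1)]])
    then show ?thesis by (metis minus_minus)
  qed
  have KPR: "kernel N q a b r (circlepath 0 R) m1 m2 = - W.PR m1 m2" for m1 m2
  proof -
    have "(\<lambda>n. ?\<phi> (m1 - int n) * ?\<omega> (int n - m2)) summable_on UNIV"
      by (rule half_conv_bound[OF W.\<phi>(2) W.\<omega>]) (use pos in auto)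
    from has_sum_imp_sums[OF has_sum_infsum[OF this]]
    have "- kernel N q a b r (circlepath 0 R) m1 m2 = W.PR m1 m2"
      unfolding W.PR_def half_conv_def
      by (rule sums_unique2[OF kernel_circlepath_sums[OF r(1) pos(9) cont(2)]])
    then show ?thesis by (metis minus_minus)
  qed
  have "kernel N q a b r \<gamma>' m1 m2 = - W.P m1 m2" for m1 m2
    using kernel_eq_circlepath[OF r(1) pos(8) y(2) \<gamma>'] KP by simp
  moreover have "kernel N q a b r \<gamma> m1 m2 = W.P m1 m2 - W.PR m1 m2" for m1 m2
    using kernel_eq_circlepath_diff[OF r(1) pos(8) y(2) R(1,3) \<gamma>] KP KPR by simp
  ultimately show ?thesis using W.fredholm_det_eq by (simp add: f)
qed

end

theorem theorem3p1:
  fixes q t \<epsilon> r :: real and N k :: nat and a b :: "nat \<Rightarrow> real"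
    and D Dbar :: "real \<Rightarrow> complex"
  assumes q: "0 < q" "q < 1"
    and N: "N \<ge> 1"
    and a_range: "\<forall>i\<in>{1..N}. 0 < a i \<and> a i < 1"
    and b_range: "\<forall>j\<in>{1..N}. 0 < b j \<and> b j < 1"
    and a_decr: "\<forall>i\<in>{1..<N}. a (Suc i) < a i"
    and b_inj: "inj_on b {1..N}"
    and ab_distinct: "\<forall>i\<in>{1..N}. \<forall>j\<in>{1..N}. a i \<noteq> b j"
    and eps: "0 < \<epsilon>" "\<epsilon> < 1/2"
    and ratio: "a 1 / a N < q powr (-1/2 + \<epsilon>)"
    and t: "t > 0"
    and r_lower: "\<forall>j\<in>{1..N}. b j < r"
    and r_upper: "r < 1 / a 1"
    \<comment> \<open>D: positively oriented contour outside C enclosing exactly the points 1/a_i\<close>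
    and D_path: "valid_path D" "pathfinish D = pathstart D"
    and D_outside: "path_image D \<subseteq> {w. r < cmod w}"
    and D_inside_C: "\<forall>w. cmod w \<le> r \<longrightarrow> winding_number D w = 0"
    and D_poles: "\<forall>i\<in>{1..N}. 1 / complex_of_real (a i) \<notin> path_image D \<and>
                              winding_number D (1 / complex_of_real (a i)) = 1"
    and D_other: "\<forall>i\<in>{1..N}. \<forall>j::nat. j \<ge> 1 \<longrightarrow>
                     1 / complex_of_real (a i * q ^ j) \<notin> path_image D \<and>
                     winding_number D (1 / complex_of_real (a i * q ^ j)) = 0"
    \<comment> \<open>Dbar: positively oriented contour enclosing C and none of the points 1/(a_i q^j)\<close>
    and Dbar_path: "valid_path Dbar" "pathfinish Dbar = pathstart Dbar"
    and Dbar_outside: "path_image Dbar \<subseteq> {w. r < cmod w}"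
    and Dbar_encl: "\<forall>w. cmod w \<le> r \<longrightarrow> winding_number Dbar w = 1"
    and Dbar_poles: "\<forall>i\<in>{1..N}. \<forall>j::nat.
                     1 / complex_of_real (a i * q ^ j) \<notin> path_image Dbar \<and>
                     winding_number Dbar (1 / complex_of_real (a i * q ^ j)) = 0"
  shows "fredholm_det (\<lambda>m1 m2. - (fmult q t k m1 * kernel N q a b r D m1 m2)) =
         fredholm_det (\<lambda>m1 m2. fmult q t k m1 * kernel N q a b r Dbar m1 m2)"
proof -
  have decr: "a j \<le> a i" if "1 \<le> i" "i \<le> j" "j \<le> N" for i j
    using that(2,3)
  proof (induction j rule: dec_induct)
    case (step n)
    then have "a (Suc n) < a n" using a_decr that(1) by auto
    with step show ?case by simp
  qed simp
  define B where "B = Max (b ` {1..N})"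
  have B: "\<And>j. j \<in> {1..N} \<Longrightarrow> b j \<le> B" by (simp add: B_def)
  have "B \<in> b ` {1..N}" unfolding B_def using N by (intro Max_in) auto
  then have B': "0 < B" "B < 1" "B < r" using b_range r_lower by auto
  have aN: "0 < a N" "a N \<le> a 1" "0 < a 1" "a 1 < 1" using a_range N decr[of 1 N] by auto
  \<comment> \<open>Powers of q < 1 are antitone and -1 is below -1/2 + \<epsilon>. The resulting q
    a_1 < a_N says that the outer annulus between 1/a_N and 1/(q a_1) is nonempty.\<close>
  have "q powr (-1/2 + \<epsilon>) \<le> q powr (-1)"
    using q eps by (intro powr_mono') auto
  also have "\<dots> = 1 / q" using q by (simp add: powr_minus_divide)
  finally have "q powr (-1/2 + \<epsilon>) \<le> 1 / q" .
  with ratio have "a 1 / a N < 1 / q" by linarith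
  then have ratio': "q * a 1 < a N" using aN q by (simp add: field_simps)
  interpret q_symbol N q a b "a N" "a 1" B
  proof
    show "a 1 * B < 1" using mult_strict_mono[of "a 1" 1 B 1] aN B' by simp
  qed (use q N aN B B' b_range ratio' decr in auto)
  show ?thesis
  proof (rule fredholm_det_kernels[OF t B'(3) r_upper D_path D_outside _ _ Dbar_path Dbar_outside])
    fix i j assume "i \<in> {1..N}"
    then show "1 / complex_of_real (a i * q ^ j) \<notin> path_image D \<and>
        winding_number D (1 / complex_of_real (a i * q ^ j)) = of_bool (j = 0)"
      using D_poles D_other by (cases "j = 0") auto
  qed (use D_inside_C Dbar_encl Dbar_poles in auto)
qed

end
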